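(* Let $C\subset\partial_\infty\mathbb H^3\equiv\mathbb R^2$ be a simple closed curve of class $\mathcal C^2$, and let $R=C\times(0,\infty)\subset\mathbb H^3$. Then the following integrals converge and coincide: $$\int_{\mathcal L}\big(\#(\ell\cap R)-\lambda^2(\ell,C)\big)\,d\ell=\int_{A(2,1)}\ \sum_{x,y\in L\cap C}\frac{(-1)^{\#(\overline{xy}\cap C)}}{\|y-x\|}\,dL<\infty,$$ where $dL$ is an invariant measure (suitably normalized) on the space $A(2,1)$ of lines in $\mathbb R^2$.
   Context: The Poincaré half-space model is $\mathbb H^3=\{x\in\mathbb R^3: x_3>0\}$ with metric $x_3^{-2}(dx_1^2+dx_2^2+dx_3^2)$; $\partial_\infty\mathbb H^3$ is identified with $\mathbb R^2=\{x_3=0\}$ (together with $\infty$). $\mathcal L$ is the space of unoriented geodesics of $\mathbb H^3$ and $d\ell$ its isometry-invariant measure, normalized so that the hyperbolic area of a compact surface $\Sigma$ is $\frac1\pi\int_{\mathcal L}\#(\ell\cap\Sigma)\,d\ell$. Equivalently, on the double cover of oriented geodesics, parametrized up to null sets by ordered pairs of distinct ideal endpoints $(z,w)\in\mathbb R^2\times\mathbb R^2$, $d\ell=4\,dz\,dw/\|w-z\|^4$. $\lambda^2(\ell,C)$ is $1$ if the ideal endpoints of $\ell$ lie on different components of $\partial_\infty\mathbb H^3\setminus C$, and $0$ otherwise. The sum is over ordered pairs of distinct points $x,y\in L\cap C$, $\overline{xy}$ is the closed segment joining $x$ and $y$, and $\#$ denotes cardinality ($L\cap C$ is finite and transverse for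 almost every $L$). With $d\ell$ normalized so that the hyperbolic area of a compact surface $\Sigma$ is $\frac1\pi\int_{\mathcal L}\#(\ell\cap\Sigma)\,d\ell$, the normalization of the motion-invariant measure on unoriented lines is $dL=2\,dp\,d\varphi$, where the line is $\{x: x_1\cos\varphi+x_2\sin\varphi=p\}$, $p\geq0$, $\varphi\in[0,2\pi)$. *)

theory Defs
  imports "HOL-Analysis.Analysis"
begin

text \<open>
  Regular parametrization with period 1: simple and closed on \<open>{0..1}\<close>, and \<open>C\<^sup>2\<close> also
  across the base point.
\<close>

definition C2_simple_closed_curve :: "(real^2) set \<Rightarrow> bool" where
  "C2_simple_closed_curve C \<longleftrightarrow>
     (\<exists>(\<gamma> :: real \<Rightarrow> real^2) \<gamma>' \<gamma>''.
        simple_path \<gamma> \<and> path_image \<gamma> = C \<and> (\<forall>t. \<gamma> (t + 1) = \<gamma> t) \<and>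
        (\<forall>t. (\<gamma> has_vector_derivative \<gamma>' t) (at t)) \<and>
        (\<forall>t. (\<gamma>' has_vector_derivative \<gamma>'' t) (at t)) \<and>
        continuous_on UNIV \<gamma>'' \<and> (\<forall>t. \<gamma>' t \<noteq> 0))"

text \<open>
  Push-forward of \<open>M\<close> along \<open>f\<close> to the set \<open>\<Omega>\<close>, which carries the largest
  sigma-algebra that makes \<open>f\<close> measurable.
\<close>

definition push_measure :: "'b set \<Rightarrow> ('a \<Rightarrow> 'b) \<Rightarrow> 'a measure \<Rightarrow> 'b measure" where
  "push_measure \<Omega> f M =
     distr M (sigma \<Omega> {A. A \<subseteq> \<Omega> \<and> f -` A \<inter> space M \<in> sets M}) f"

text \<open>
  The half-space model, with \<open>\<real>\<^sup>3\<close> written as \<open>\<real>\<^sup>2 \<times> \<real>\<close>. The distance of the metric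
  \<open>x\<^sub>3\<^sup>-\<^sup>2 (dx\<^sub>1\<^sup>2 + dx\<^sub>2\<^sup>2 + dx\<^sub>3\<^sup>2)\<close> is given by
  \<open>cosh d(x,y) = 1 + \<parallel>x - y\<parallel>\<^sup>2 / (2 x\<^sub>3 y\<^sub>3)\<close>.
\<close>

type_synonym point3 = "(real^2) \<times> real"

definition H3 :: "point3 set" where
  "H3 = UNIV \<times> {0<..}"

definition h3_dist :: "point3 \<Rightarrow> point3 \<Rightarrow> real" where
  "h3_dist x y = arcosh (1 + (dist x y)\<^sup>2 / (2 * snd x * snd y))"

definition h3_geodesics :: "point3 set set" where
  "h3_geodesics = {range \<gamma> | \<gamma> :: real \<Rightarrow> point3.
     (\<forall>t. \<gamma> t \<in> H3) \<and> (\<forall>s t. h3_dist (\<gamma> s) (\<gamma> t) = \<bar>s - t\<bar>)}"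

text \<open>
  The ideal boundary \<open>\<real>\<^sup>2 \<union> {\<infinity>}\<close> is the one-point compactification of the plane,
  with \<open>None\<close> as \<open>\<infinity>\<close>.
\<close>

definition ideal_boundary :: "(real^2) option topology" where
  "ideal_boundary = Alexandroff_compactification euclidean"

definition ideal_points :: "point3 set \<Rightarrow> (real^2) option set" where
  "ideal_points S =
     {Some z | z. (z, 0) \<in> closure S} \<union> (if bounded S then {} else {None})"

definition lambda2 :: "point3 set \<Rightarrow> (real^2) set \<Rightarrow> nat" where
  "lambda2 l C =
     (if \<exists>U V. U \<in> connected_components_of (subtopology ideal_boundary (- Some ` C)) \<and>
               V \<in> connected_components_of (subtopology ideal_boundary (- Some ` C)) \<and>
               U \<noteq> V \<and> ideal_points l \<inter> U \<noteq> {} \<and> ideal_points l \<inter> V \<noteq> {}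
      then 1 else 0)"

text \<open>The geodesic with finite ideal endpoints \<open>z \<noteq> w\<close>.\<close>

definition semicircle :: "real^2 \<Rightarrow> real^2 \<Rightarrow> point3 set" where
  "semicircle z w =
     {(x, t). 0 < t \<and> x \<in> affine hull {z, w} \<and>
              (dist x (midpoint z w))\<^sup>2 + t\<^sup>2 = (dist z w / 2)\<^sup>2}"

text \<open>
  On oriented geodesics the invariant measure is \<open>4 dz dw / \<parallel>w - z\<parallel>\<^sup>4\<close>. Every
  unoriented geodesic arises from the two pairs \<open>(z, w)\<close> and \<open>(w, z)\<close>, hence the
  factor \<open>1/2\<close>. Geodesics with \<open>\<infinity>\<close> as an ideal endpoint form a null set. With this
  normalization, the integral of \<open>#(l \<inter> S)\<close> is \<open>pi\<close> times the hyperbolic area of \<open>S\<close>.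
\<close>

definition geodesic_measure :: "point3 set measure" where
  "geodesic_measure =
     push_measure h3_geodesics (\<lambda>(z, w). semicircle z w)
       (density (restrict_space lebesgue {(z, w). z \<noteq> w})
          (\<lambda>(z, w). ennreal (1/2 * (4 / norm (w - z) ^ 4))))"

definition plane_lines :: "(real^2) set set" where
  "plane_lines = {L. affine L \<and> aff_dim L = 1}"

definition normal_line :: "real \<Rightarrow> real \<Rightarrow> (real^2) set" where
  "normal_line p \<phi> = {x. x $ 1 * cos \<phi> + x $ 2 * sin \<phi> = p}"

text \<open>\<open>2 dp d\<phi>\<close> on \<open>p \<ge> 0\<close>, \<open>0 \<le> \<phi> < 2 pi\<close>, where every line with \<open>p > 0\<close> occurs once.\<close>

definition line_measure :: "(real^2) set measure" where
  "line_measure =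
     push_measure plane_lines (\<lambda>(p, \<phi>). normal_line p \<phi>)
       (density (restrict_space lebesgue ({0..} \<times> {0..<2*pi})) (\<lambda>_. 2))"

text \<open>The explicit parametrizations above do land in the intended spaces.\<close>

lemma semicircle_eq:
  assumes "z \<noteq> w"
  shows "semicircle z w =
    (\<lambda>u. (midpoint z w + (u / 2) *\<^sub>R (w - z), dist z w / 2 * sqrt (1 - u\<^sup>2))) ` {-1<..<1}"
    (is "_ = ?f ` _")
proof (intro equalityI subsetI)
  have pos: "dist z w > 0" using assms by simp
  have dst: "(dist (midpoint z w + (u / 2) *\<^sub>R (w - z)) (midpoint z w))\<^sup>2 = u\<^sup>2 * (dist z w / 2)\<^sup>2" for u
    by (simp add: dist_norm norm_minus_commute power_mult_distrib power_divide)
  {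
    fix q assume "q \<in> semicircle z w"
    then obtain x y where q: "q = (x, y)" "0 < y" "x \<in> affine hull {z, w}"
      "(dist x (midpoint z w))\<^sup>2 + y\<^sup>2 = (dist z w / 2)\<^sup>2"
      by (auto simp: semicircle_def)
    then obtain a b where ab: "x = a *\<^sub>R z + b *\<^sub>R w" "a + b = 1"
      by (auto simp: affine_hull_2)
    define u where "u = 2 * b - 1"
    have a: "a = (1 - u) / 2" and b: "b = (1 + u) / 2"
      using ab(2) by (simp_all add: u_def)
    have x: "x = midpoint z w + (u / 2) *\<^sub>R (w - z)"
      unfolding ab(1) a b midpoint_def vec_eq_iff by (simp add: field_simps)
    have y: "y\<^sup>2 = (dist z w / 2)\<^sup>2 * (1 - u\<^sup>2)"
      using q(4) unfolding x dst by (simp only: algebra_simps)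
    moreover have "y\<^sup>2 > 0" "(dist z w / 2)\<^sup>2 > 0" using q(2) pos by simp_all
    ultimately have "u\<^sup>2 < 1" by (simp add: zero_less_mult_iff)
    then have u: "u \<in> {-1<..<1}" by (auto simp: abs_square_less_1)
    have "y = sqrt (y\<^sup>2)" using q(2) by simp
    also have "\<dots> = dist z w / 2 * sqrt (1 - u\<^sup>2)"
      unfolding y real_sqrt_mult by (simp add: real_sqrt_divide)
    finally show "q \<in> ?f ` {-1<..<1}" using u by (auto simp: q(1) x)
  }
  {
    fix q assume "q \<in> ?f ` {-1<..<1}"
    then obtain u where u: "-1 < u" "u < 1" and q: "q = ?f u" by auto
    have u2: "u\<^sup>2 < 1" using u by (simp add: abs_square_less_1 abs_less_iff)
    have "midpoint z w + (u / 2) *\<^sub>R (w - z) = ((1 - u) / 2) *\<^sub>R z + ((1 + u) / 2) *\<^sub>R w"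
      unfolding midpoint_def vec_eq_iff by (simp add: field_simps)
    moreover have "(1 - u) / 2 + (1 + u) / 2 = 1" by (simp add: field_simps)
    ultimately have "midpoint z w + (u / 2) *\<^sub>R (w - z) \<in> affine hull {z, w}"
      unfolding affine_hull_2 by blast
    moreover have "u\<^sup>2 * (dist z w / 2)\<^sup>2 + (dist z w / 2 * sqrt (1 - u\<^sup>2))\<^sup>2 = (dist z w / 2)\<^sup>2"
      using u2 by (simp only: power_mult_distrib real_sqrt_pow2 diff_ge_0_iff_ge less_imp_le)
        (simp only: algebra_simps)
    moreover have "0 < dist z w / 2 * sqrt (1 - u\<^sup>2)" using u2 pos by simp
    ultimately show "q \<in> semicircle z w"
      unfolding semicircle_def q by (simp only: mem_Collect_eq prod.case dst)
  }
qed

lemma semicircle_geodesic: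
  assumes "z \<noteq> w"
  shows "semicircle z w \<in> h3_geodesics"
proof -
  define r where "r = dist z w / 2"
  define \<gamma> where "\<gamma> = (\<lambda>t::real. (midpoint z w + (tanh t / 2) *\<^sub>R (w - z), r / cosh t))"
  have r: "r > 0" using assms by (simp add: r_def)
  have inH: "\<gamma> t \<in> H3" for t using r by (simp add: \<gamma>_def H3_def)
  have dst: "h3_dist (\<gamma> s) (\<gamma> t) = \<bar>s - t\<bar>" for s t
  proof -
    have c: "cosh s \<noteq> 0" "cosh t \<noteq> 0" by simp_all
    have p: "(sinh s)\<^sup>2 = (cosh s)\<^sup>2 - 1" "(sinh t)\<^sup>2 = (cosh t)\<^sup>2 - 1"
      using cosh_square_eq[of s] cosh_square_eq[of t] by simp_all
    have "fst (\<gamma> s) - fst (\<gamma> t) = ((tanh s - tanh t) / 2) *\<^sub>R (w - z)"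
      by (simp add: \<gamma>_def diff_divide_distrib scaleR_diff_left)
    then have "(dist (fst (\<gamma> s)) (fst (\<gamma> t)))\<^sup>2 = (tanh s - tanh t)\<^sup>2 * r\<^sup>2"
      by (simp add: dist_norm r_def norm_minus_commute power_mult_distrib power_divide)
    then have "(dist (\<gamma> s) (\<gamma> t))\<^sup>2 = (tanh s - tanh t)\<^sup>2 * r\<^sup>2 + (r / cosh s - r / cosh t)\<^sup>2"
      by (simp add: dist_prod_def \<gamma>_def dist_real_def)
    then have "1 + (dist (\<gamma> s) (\<gamma> t))\<^sup>2 / (2 * snd (\<gamma> s) * snd (\<gamma> t)) =
        1 + ((tanh s - tanh t)\<^sup>2 * r\<^sup>2 + (r / cosh s - r / cosh t)\<^sup>2) / (2 * (r / cosh s) * (r / cosh t))"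
      by (simp add: \<gamma>_def)
    also have "\<dots> = 1 + ((sinh s * cosh t - sinh t * cosh s)\<^sup>2 + (cosh t - cosh s)\<^sup>2) / (2 * cosh s * cosh t)"
      using r c by (simp add: tanh_def field_simps power2_eq_square)
    also have "(sinh s * cosh t - sinh t * cosh s)\<^sup>2 + (cosh t - cosh s)\<^sup>2 =
        (sinh s)\<^sup>2 * (cosh t)\<^sup>2 + (sinh t)\<^sup>2 * (cosh s)\<^sup>2 + (cosh t)\<^sup>2 + (cosh s)\<^sup>2
        - 2 * cosh s * cosh t * (sinh s * sinh t + 1)"
      by (simp add: power2_eq_square algebra_simps)
    also have "\<dots> = 2 * cosh s * cosh t * (cosh s * cosh t - sinh s * sinh t - 1)"
      unfolding p by (simp add: power2_eq_square algebra_simps)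
    also have "1 + \<dots> / (2 * cosh s * cosh t) = cosh (s - t)"
      using c by (simp add: cosh_diff)
    also have "\<dots> = cosh \<bar>s - t\<bar>"
      by (cases "s \<le> t") (simp_all add: abs_if flip: cosh_minus[of "s - t"])
    finally show ?thesis unfolding h3_dist_def by (simp only: arcosh_cosh_real abs_ge_zero)
  qed
  have sq: "sqrt (1 - (tanh t)\<^sup>2) = 1 / cosh t" for t :: real
  proof (rule real_sqrt_unique)
    show "(1 / cosh t)\<^sup>2 = 1 - (tanh t)\<^sup>2"
      using hyperbolic_pythagoras[of t]
      by (simp add: tanh_def power_divide eq_divide_eq diff_divide_eq_iff)
  qed simp
  have "u \<in> range tanh" if "u \<in> {-1<..<1}" for u :: real
  proof -
    have "exp (ln ((1 - u) / (1 + u))) = (1 - u) / (1 + u)" using that by simp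
    then have "tanh (- ln ((1 - u) / (1 + u)) / 2) = (1 - (1 - u) / (1 + u)) / (1 + (1 - u) / (1 + u))"
      unfolding tanh_real_altdef by simp
    also have "\<dots> = u" using that by (simp add: field_simps)
    finally show ?thesis by (metis rangeI)
  qed
  then have "range tanh = {-1<..<1::real}"
    by (auto simp: tanh_real_gt_neg1 tanh_real_lt_1)
  then have "semicircle z w = range \<gamma>"
    unfolding semicircle_eq[OF assms] by (auto simp: \<gamma>_def image_image sq r_def simp flip: \<open>range tanh = _\<close>)
  with inH dst show ?thesis unfolding h3_geodesics_def by blast
qed

lemma ideal_points_semicircle:
  assumes "z \<noteq> w"
  shows "ideal_points (semicircle z w) = {Some z, Some w}"
proof -
  define f where "f = (\<lambda>u. (midpoint z w + (u / 2) *\<^sub>R (w - z), dist z w / 2 * sqrt (1 - u\<^sup>2)))"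
  have eq: "semicircle z w = f ` {-1<..<1}"
    unfolding semicircle_eq[OF assms] f_def ..
  have cont: "continuous_on {-1..1} f"
    unfolding f_def by (intro continuous_intros) auto
  then have comp: "compact (f ` {-1..1})" by (rule compact_continuous_image) simp
  have "closure (semicircle z w) \<subseteq> f ` {-1..1}"
    unfolding eq using comp by (intro closure_minimal compact_imp_closed image_mono) auto
  moreover have "f ` {-1..1} \<subseteq> closure (semicircle z w)"
    unfolding eq using image_closure_subset[of "{-1<..<1}" f "closure (f ` {-1<..<1})"] cont
    by (simp add: closure_subset)
  ultimately have cl: "closure (semicircle z w) = f ` {-1..1}" by (rule equalityI)
  have f1: "f (-1) = (z, 0)" "f 1 = (w, 0)"
    unfolding f_def midpoint_def by (simp_all add: vec_eq_iff field_simps)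
  have end_u: "u = -1 \<or> u = 1" if "f u = (x, 0)" for u x
    using that assms by (auto simp: f_def power2_eq_1_iff)
  then have "{x. (x, 0) \<in> closure (semicircle z w)} = {z, w}"
    unfolding cl
  proof (intro equalityI subsetI)
    fix x assume "x \<in> {z, w}"
    moreover have "f (-1) \<in> f ` {-1..1}" "f 1 \<in> f ` {-1..1}" by auto
    ultimately show "x \<in> {x. (x, 0) \<in> f ` {-1..1}}" using f1 by auto
  next
    fix x assume "x \<in> {x. (x, 0) \<in> f ` {-1..1}}"
    then obtain u where "f u = (x, 0)" by (auto dest: sym)
    then show "x \<in> {z, w}" using end_u[of u x] f1 by auto
  qed
  moreover have "bounded (semicircle z w)"
    using compact_imp_bounded[OF comp] cl bounded_subset closure_subset by metis
  ultimately show ?thesis unfolding ideal_points_def by auto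
qed

lemma normal_line_plane_line: "normal_line p \<phi> \<in> plane_lines"
proof -
  define n :: "real^2" where "n = vector [cos \<phi>, sin \<phi>]"
  have n: "normal_line p \<phi> = {x. n \<bullet> x = p}"
    by (auto simp: normal_line_def n_def inner_vec_def sum_2 mult.commute)
  have "n \<bullet> n = 1" by (simp add: n_def inner_vec_def sum_2 flip: power2_eq_square)
  then have "n \<noteq> 0" by auto
  then show ?thesis
    unfolding n plane_lines_def by (simp add: affine_hyperplane aff_dim_hyperplane)
qed

end

theory Submission
  imports Defs "HOL-Real_Asymp.Real_Asymp"
begin

text \<open>
  Write a pair of ideal endpoints as two points with coordinates \<open>s\<close>, \<open>t\<close> on the line
  \<open>L\<close> through them. Then \<open>dz dw = \<bar>t - s\<bar> dL ds dt\<close>, up to normalization, so the density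
  \<open>\<parallel>w - z\<parallel>\<^sup>-\<^sup>4\<close> turns into \<open>\<bar>t - s\<bar>\<^sup>-\<^sup>3\<close>. If \<open>L\<close> crosses \<open>C\<close> transversally and \<open>n\<close>
  crossings lie between the endpoints, then \<open>#(\<ell> \<inter> R) - \<lambda>\<^sup>2(\<ell>, C) = n - n mod 2\<close>, because
  each crossing changes the side of the curve. This number is
  twice the sum of \<open>(-1)\<^bsup>#([a,b] \<inter> C)\<^esup>\<close> over the pairs \<open>a < b\<close> of these crossings, while the
  integral of \<open>\<bar>t - s\<bar>\<^sup>-\<^sup>3\<close> over the pairs \<open>(s, t)\<close> that enclose \<open>a < b\<close> is \<open>1 / (b - a)\<close>.
  Hence the two integrands agree line by line, and Tonelli's theorem gives the equality of the
  integrals, all quantities being nonnegative.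

  For finiteness, \<open>n - n mod 2 \<le> 2 (n - 1)\<close> bounds the contribution of a line by the sum of the
  inverse gaps between consecutive crossings. Since \<open>C\<close> is \<open>C\<^sup>2\<close>, a gap at a crossing \<open>x\<close> is
  at least a constant times the sine of the angle between the line and the curve at \<open>x\<close>, and the sum of
  the inverse sines has a finite integral over the lines of each fixed direction.
\<close>

section \<open>Alternating sums over the crossings of a line\<close>

lemma alternating_sum_ranks:
  fixes B :: "real set"
  assumes "finite B"
  shows "(\<Sum>a\<in>B. (-1::real) ^ card (B \<inter> {a..})) = (if even (card B) then 0 else -1)"
  using assms
proof (induction B rule: finite_linorder_min_induct)
  case empty
  then show ?case by simp
next
  case (insert m B)
  have m: "m \<notin> B" "insert m B \<inter> {m..} = insert m B"
    using insert by force+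
  have "insert m B \<inter> {a..} = B \<inter> {a..}" if "a \<in> B" for a
    using insert that by force
  then have "(\<Sum>a\<in>B. (-1::real) ^ card (insert m B \<inter> {a..})) = (\<Sum>a\<in>B. (-1) ^ card (B \<inter> {a..}))"
    by (intro sum.cong) auto
  then show ?case using insert m by simp
qed

lemma alternating_sum_pairs:
  fixes B :: "real set"
  assumes "finite B"
  shows "(\<Sum>(a, b) \<in> {(a, b). a \<in> B \<and> b \<in> B \<and> a < b}. (-1::real) ^ card (B \<inter> {a..b})) = real (card B div 2)"
  using assms
proof (induction B rule: finite_linorder_max_induct)
  case empty
  then show ?case by simp
next
  case (insert m B)
  let ?P = "\<lambda>B. {(a, b). a \<in> B \<and> b \<in> B \<and> a < (b::real)}"
  have m: "m \<notin> B" using insert by force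
  have eq: "?P (insert m B) = ?P B \<union> (\<lambda>a. (a, m)) ` B"
    using insert by (force simp: image_iff)
  have fin: "finite (?P B)"
    by (rule finite_subset[of _ "B \<times> B"]) (use insert in auto)
  have "(\<Sum>(a, b)\<in>?P (insert m B). (-1::real) ^ card (insert m B \<inter> {a..b})) =
     (\<Sum>(a, b)\<in>?P B. (-1) ^ card (insert m B \<inter> {a..b})) +
     (\<Sum>(a, b)\<in>(\<lambda>a. (a, m)) ` B. (-1) ^ card (insert m B \<inter> {a..b}))"
    unfolding eq by (rule sum.union_disjoint) (use fin insert m in auto)
  also have "(\<Sum>(a, b)\<in>?P B. (-1::real) ^ card (insert m B \<inter> {a..b})) = (\<Sum>(a, b)\<in>?P B. (-1) ^ card (B \<inter> {a..b}))"
  proof (rule sum.cong[OF refl], clarify)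
    fix a b assume "a \<in> B" "b \<in> B" "a < b"
    then have "insert m B \<inter> {a..b} = B \<inter> {a..b}" using insert by force
    then show "(-1::real) ^ card (insert m B \<inter> {a..b}) = (-1) ^ card (B \<inter> {a..b})" by simp
  qed
  also have "(\<Sum>(a, b)\<in>(\<lambda>a. (a, m)) ` B. (-1::real) ^ card (insert m B \<inter> {a..b})) =
      (\<Sum>a\<in>B. (-1) ^ card (insert m B \<inter> {a..m}))"
    by (subst sum.reindex) (auto simp: inj_on_def)
  also have "\<dots> = (\<Sum>a\<in>B. - ((-1) ^ card (B \<inter> {a..})))"
  proof (rule sum.cong[OF refl])
    fix a assume "a \<in> B"
    then have "insert m B \<inter> {a..m} = insert m (B \<inter> {a..})" using insert by force
    then show "(-1::real) ^ card (insert m B \<inter> {a..m}) = - ((-1) ^ card (B \<inter> {a..}))"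
      using m insert by simp
  qed
  also have "\<dots> = (if even (card B) then 0 else 1)"
    using alternating_sum_ranks[of B] insert by (simp add: sum_negf)
  finally show ?case using insert m by simp
qed

definition span_pairs :: "real \<Rightarrow> real \<Rightarrow> (real \<times> real) set" where
  "span_pairs a b = {(s, t). s < a \<and> b < t \<or> t < a \<and> b < s}"

lemma span_pairs_borel [measurable]: "span_pairs a b \<in> sets borel"
proof -
  have "span_pairs a b = {..<a} \<times> {b<..} \<union> {b<..} \<times> {..<a}"
    by (auto simp: span_pairs_def)
  then show ?thesis by (simp add: open_Times borel_open open_Un)
qed

lemma nn_integral_cube_tail:
  fixes s b :: real
  assumes "s < b"
  shows "(\<integral>\<^sup>+t. ennreal (1 / \<bar>t - s\<bar> ^ 3) * indicator {b<..} t \<partial>lborel) = ennreal (1 / (2 * (b - s)\<^sup>2))"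
proof -
  have "(\<integral>\<^sup>+t. ennreal (1 / \<bar>t - s\<bar> ^ 3) * indicator {b<..} t \<partial>lborel) =
     (\<integral>\<^sup>+t. ennreal (1 / \<bar>t - s\<bar> ^ 3) * indicator {b..} t \<partial>lborel)"
    by (rule nn_integral_cong_AE, rule AE_mp[OF AE_lborel_singleton[of b]]) (auto split: split_indicator)
  also have "\<dots> = ennreal (0 - (- (1 / (2 * (b - s)\<^sup>2))))"
  proof (rule nn_integral_FTC_atLeast)
    show "(\<lambda>t. 1 / \<bar>t - s\<bar> ^ 3) \<in> borel_measurable borel" by measurable
    show "((\<lambda>t. - (1 / (2 * (t - s)\<^sup>2))) has_real_derivative 1 / \<bar>t - s\<bar> ^ 3) (at t)" if "b \<le> t" for t
    proof -
      define u where "u = t - s"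
      have u: "u > 0" using that assms by (simp add: u_def)
      have "((\<lambda>t. - (1 / (2 * (t - s)\<^sup>2))) has_real_derivative 4 * u / (2 * u\<^sup>2)\<^sup>2) (at t)"
        using u by (auto intro!: derivative_eq_intros simp: u_def power2_eq_square)
          (metis minus_diff_eq minus_divide_left)
      also have "4 * u / (2 * u\<^sup>2)\<^sup>2 = 1 / \<bar>u\<bar> ^ 3"
        using u by (simp add: field_simps power2_eq_square power3_eq_cube)
      finally show ?thesis by (simp add: u_def)
    qed
    show "((\<lambda>t. - (1 / (2 * (t - s)\<^sup>2))) \<longlongrightarrow> 0) at_top"
      by real_asymp
  qed auto
  finally show ?thesis by simp
qed

lemma nn_integral_square_tail:
  fixes a b :: real
  assumes "a < b"
  shows "(\<integral>\<^sup>+s. ennreal (1 / (2 * (b - s)\<^sup>2)) * indicator {..<a} s \<partial>lborel) = ennreal (1 / (2 * (b - a)))"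
proof -
  have "(\<integral>\<^sup>+s. ennreal (1 / (2 * (b - s)\<^sup>2)) * indicator {..<a} s \<partial>lborel) =
     (\<integral>\<^sup>+s. ennreal (1 / (2 * (b + s)\<^sup>2)) * indicator {..<a} (- s) \<partial>lborel)"
    by (subst nn_integral_real_affine[where c = "-1" and t = 0]) auto
  also have "\<dots> = (\<integral>\<^sup>+s. ennreal (1 / (2 * (b + s)\<^sup>2)) * indicator {-a..} s \<partial>lborel)"
    by (rule nn_integral_cong_AE, rule AE_mp[OF AE_lborel_singleton[of "-a"]]) (auto split: split_indicator)
  also have "\<dots> = ennreal (0 - (- (1 / (2 * (b + (-a))))))"
  proof (rule nn_integral_FTC_atLeast)
    show "((\<lambda>s. - (1 / (2 * (b + s)))) has_real_derivative 1 / (2 * (b + s)\<^sup>2)) (at s)" if "- a \<le> s" for s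
    proof -
      define u where "u = b + s"
      have u: "u > 0" using that assms by (simp add: u_def)
      have "((\<lambda>s. - (1 / (2 * (b + s)))) has_real_derivative 2 / (2 * u)\<^sup>2) (at s)"
        using u by (auto intro!: derivative_eq_intros simp: u_def power2_eq_square)
      also have "2 / (2 * u)\<^sup>2 = 1 / (2 * u\<^sup>2)"
        using u by (simp add: field_simps power2_eq_square)
      finally show ?thesis by (simp add: u_def)
    qed
    show "((\<lambda>s. - (1 / (2 * (b + s)))) \<longlongrightarrow> 0) at_top"
      by real_asymp
  qed auto
  finally show ?thesis by simp
qed

lemma nn_integral_span_pairs:
  assumes "a < b"
  shows "(\<integral>\<^sup>+(s, t). ennreal (1 / \<bar>t - s\<bar> ^ 3) * indicator (span_pairs a b) (s, t) \<partial>lborel) = ennreal (1 / (b - a))"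
proof -
  have half: "(\<integral>\<^sup>+s. \<integral>\<^sup>+t. ennreal (1 / \<bar>t - s\<bar> ^ 3) * (indicator {..<a} s * indicator {b<..} t) \<partial>lborel \<partial>lborel) = ennreal (1 / (2 * (b - a)))"
  proof -
    have "(\<integral>\<^sup>+t. ennreal (1 / \<bar>t - s\<bar> ^ 3) * (indicator {..<a} s * indicator {b<..} t) \<partial>lborel) =
       ennreal (1 / (2 * (b - s)\<^sup>2)) * indicator {..<a} s" for s
    proof (cases "s < a")
      case True
      then show ?thesis using nn_integral_cube_tail[of s b] assms by simp
    qed simp
    then show ?thesis by (simp add: nn_integral_square_tail[OF assms])
  qed
  have "(\<integral>\<^sup>+(s, t). ennreal (1 / \<bar>t - s\<bar> ^ 3) * indicator (span_pairs a b) (s, t) \<partial>lborel) =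
     (\<integral>\<^sup>+(s, t). ennreal (1 / \<bar>t - s\<bar> ^ 3) * (indicator {..<a} s * indicator {b<..} t)
       + ennreal (1 / \<bar>s - t\<bar> ^ 3) * (indicator {..<a} t * indicator {b<..} s) \<partial>(lborel \<Otimes>\<^sub>M lborel))"
    unfolding lborel_prod using assms
    by (intro nn_integral_cong) (auto simp: span_pairs_def abs_minus_commute split: split_indicator)
  also have "\<dots> = (\<integral>\<^sup>+(s, t). ennreal (1 / \<bar>t - s\<bar> ^ 3) * (indicator {..<a} s * indicator {b<..} t) \<partial>(lborel \<Otimes>\<^sub>M lborel))
     + (\<integral>\<^sup>+(s, t). ennreal (1 / \<bar>s - t\<bar> ^ 3) * (indicator {..<a} t * indicator {b<..} s) \<partial>(lborel \<Otimes>\<^sub>M lborel))"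
    unfolding case_prod_beta by (rule nn_integral_add) measurable
  also have "(\<integral>\<^sup>+(s, t). ennreal (1 / \<bar>t - s\<bar> ^ 3) * (indicator {..<a} s * indicator {b<..} t) \<partial>(lborel \<Otimes>\<^sub>M lborel))
      = ennreal (1 / (2 * (b - a)))"
    unfolding half[symmetric] by (subst lborel.nn_integral_fst[symmetric]) simp_all
  also have "(\<integral>\<^sup>+(s, t). ennreal (1 / \<bar>s - t\<bar> ^ 3) * (indicator {..<a} t * indicator {b<..} s) \<partial>(lborel \<Otimes>\<^sub>M lborel))
      = ennreal (1 / (2 * (b - a)))"
    unfolding half[symmetric] by (subst lborel_pair.nn_integral_snd[symmetric]) (simp_all add: abs_minus_commute)
  also have "ennreal (1 / (2 * (b - a))) + ennreal (1 / (2 * (b - a))) = ennreal (1 / (b - a))"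
    using assms by (subst ennreal_plus[symmetric]) (auto simp: field_simps)
  finally show ?thesis .
qed

definition even_part :: "real set \<Rightarrow> real \<Rightarrow> real \<Rightarrow> nat" where
  "even_part A s t = 2 * (card (A \<inter> {min s t<..<max s t}) div 2)"

definition next_in :: "real set \<Rightarrow> real \<Rightarrow> real" where
  "next_in A a = Min {b \<in> A. a < b}"

lemma mem_span_pairs: "a < b \<Longrightarrow> (s, t) \<in> span_pairs a b \<longleftrightarrow> a \<in> {min s t<..<max s t} \<and> b \<in> {min s t<..<max s t}"
  by (auto simp: span_pairs_def min_def max_def)

lemma span_kernel_borel:
  "(\<lambda>(s, t). 1 / \<bar>t - s\<bar> ^ 3 * indicator (span_pairs a b) (s, t) :: real) \<in> borel_measurable borel"
proof -
  have [measurable]: "(fst :: real \<times> real \<Rightarrow> real) \<in> borel_measurable borel" "(snd :: real \<times> real \<Rightarrow> real) \<in> borel_measurable borel"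
    by (auto intro!: borel_measurable_continuous_onI continuous_intros)
  show ?thesis
    unfolding case_prod_beta prod.collapse
    by (intro borel_measurable_times borel_measurable_indicator span_pairs_borel) measurable
qed

lemma even_part_alternating_sum:
  assumes "finite A"
  shows "real (even_part A s t) = 2 * (\<Sum>(a, b)\<in>{(a, b). a \<in> A \<and> b \<in> A \<and> a < b}. (-1) ^ card (A \<inter> {a..b}) * indicator (span_pairs a b) (s, t))"
proof -
  let ?P = "\<lambda>A. {(a, b). a \<in> A \<and> b \<in> A \<and> a < (b::real)}"
  define B where "B = A \<inter> {min s t<..<max s t}"
  have finB: "finite B" using assms by (simp add: B_def)
  have finP: "finite (?P A)" by (rule finite_subset[of _ "A \<times> A"]) (use assms in auto)
  have "(\<Sum>(a, b)\<in>?P A. (-1) ^ card (A \<inter> {a..b}) * indicator (span_pairs a b) (s, t)) =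
    (\<Sum>(a, b)\<in>?P B. (-1::real) ^ card (A \<inter> {a..b}) * indicator (span_pairs a b) (s, t))"
    by (rule sum.mono_neutral_right[OF finP]) (auto simp: B_def mem_span_pairs indicator_eq_0_iff)
  also have "\<dots> = (\<Sum>(a, b)\<in>?P B. (-1) ^ card (B \<inter> {a..b}))"
  proof (rule sum.cong[OF refl], clarify)
    fix a b assume ab: "a \<in> B" "b \<in> B" "a < b"
    then have "A \<inter> {a..b} = B \<inter> {a..b}" by (auto simp: B_def)
    moreover have "(s, t) \<in> span_pairs a b" using ab by (simp add: mem_span_pairs B_def)
    ultimately show "(-1::real) ^ card (A \<inter> {a..b}) * indicator (span_pairs a b) (s, t) = (-1) ^ card (B \<inter> {a..b})"
      by simp
  qed
  also have "\<dots> = real (card B div 2)" by (rule alternating_sum_pairs[OF finB])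
  finally show ?thesis by (simp add: even_part_def B_def)
qed

lemma even_part_le_consecutive:
  assumes A: "finite A"
  shows "real (even_part A s t) \<le> 2 * (\<Sum>a\<in>A - {Max A}. indicator (span_pairs a (next_in A a)) (s, t))"
proof -
  define B where "B = A \<inter> {min s t<..<max s t}"
  have finB: "finite B" using A by (simp add: B_def)
  show ?thesis
  proof (cases "B = {}")
    case True
    then show ?thesis by (simp add: even_part_def flip: B_def) (intro sum_nonneg, auto)
  next
    case False
    have maxB: "Max B \<in> B" using finB False by (rule Max_in)
    have sub: "(s, t) \<in> span_pairs a (next_in A a) \<and> a \<in> A - {Max A}" if a: "a \<in> B - {Max B}" for a
    proof -
      have lt: "a < Max B" using a finB by (metis DiffE Max_ge insertCI less_eq_real_def)
      have ne: "{b \<in> A. a < b} \<noteq> {}" "finite {b \<in> A. a < b}" using A lt maxB by (auto simp: B_def)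
      from Min_in[OF ne(2,1)] have nx: "next_in A a \<in> A" "a < next_in A a" by (auto simp: next_in_def)
      have "next_in A a \<le> Max B" unfolding next_in_def using ne lt maxB by (intro Min_le) (auto simp: B_def)
      then have "next_in A a \<in> {min s t<..<max s t}" using nx a maxB by (auto simp: B_def)
      moreover have "a \<noteq> Max A" using nx A by (metis Max_ge not_le)
      ultimately show ?thesis using nx a by (auto simp: mem_span_pairs B_def)
    qed
    have "real (card (B - {Max B})) = (\<Sum>a\<in>B - {Max B}. indicator (span_pairs a (next_in A a)) (s, t))"
      using sub by (subst sum.cong[OF refl, of _ _ "\<lambda>_. 1"]) auto
    also have "\<dots> \<le> (\<Sum>a\<in>A - {Max A}. indicator (span_pairs a (next_in A a)) (s, t))"
      by (rule sum_mono2) (use A sub in auto)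
    finally have le: "real (card (B - {Max B})) \<le> \<dots>" .
    have "card B \<noteq> 0" using finB False by simp
    moreover have "card (B - {Max B}) = card B - 1" using finB maxB by simp
    moreover have "2 * (n div 2) \<le> 2 * (n - 1)" if "n \<noteq> 0" for n :: nat using that by presburger
    ultimately have "2 * (card B div 2) \<le> 2 * card (B - {Max B})" by simp
    then have "real (even_part A s t) \<le> 2 * real (card (B - {Max B}))" unfolding even_part_def B_def[symmetric] by linarith
    then show ?thesis using le by linarith
  qed
qed

lemma
  assumes A: "finite A"
  shows nn_integral_even_part: "(\<integral>\<^sup>+(s, t). ennreal (1 / \<bar>t - s\<bar> ^ 3) * ennreal (real (even_part A s t)) \<partial>lborel) =
    ennreal (\<Sum>(a, b)\<in>{(a, b). a \<in> A \<and> b \<in> A \<and> a \<noteq> b}. (-1) ^ card (A \<inter> {min a b..max a b}) / \<bar>b - a\<bar>)"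
    and alternating_chord_sum_nonneg:
      "0 \<le> (\<Sum>(a, b)\<in>{(a, b). a \<in> A \<and> b \<in> A \<and> a \<noteq> b}. (-1) ^ card (A \<inter> {min a b..max a b}) / \<bar>b - a\<bar>)"
proof -
  let ?P = "{(a, b). a \<in> A \<and> b \<in> A \<and> a < b}"
  let ?f = "\<lambda>(s, t). \<Sum>(a, b)\<in>?P. 2 * (-1) ^ card (A \<inter> {a..b}) * (1 / \<bar>t - s\<bar> ^ 3 * indicator (span_pairs a b) (s, t))"
  have f: "1 / \<bar>t - s\<bar> ^ 3 * real (even_part A s t) = ?f (s, t)" for s t
    unfolding even_part_alternating_sum[OF A] by (simp add: sum_distrib_left case_prod_beta mult_ac)
  have one: "has_bochner_integral lborel (\<lambda>(s, t). 1 / \<bar>t - s\<bar> ^ 3 * indicator (span_pairs a b) (s, t)) (1 / (b - a))"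
    if "a < b" for a b
  proof (rule has_bochner_integral_nn_integral)
    show "(\<lambda>(s, t). 1 / \<bar>t - s\<bar> ^ 3 * indicator (span_pairs a b) (s, t)) \<in> borel_measurable lborel"
      using span_kernel_borel by simp
    have "(\<integral>\<^sup>+x. ennreal (case x of (s, t) \<Rightarrow> 1 / \<bar>t - s\<bar> ^ 3 * indicator (span_pairs a b) (s, t)) \<partial>lborel) =
       (\<integral>\<^sup>+(s, t). ennreal (1 / \<bar>t - s\<bar> ^ 3) * indicator (span_pairs a b) (s, t) \<partial>lborel)"
      by (intro nn_integral_cong) (auto split: split_indicator)
    then show "(\<integral>\<^sup>+x. ennreal (case x of (s, t) \<Rightarrow> 1 / \<bar>t - s\<bar> ^ 3 * indicator (span_pairs a b) (s, t)) \<partial>lborel) = ennreal (1 / (b - a))"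
      using nn_integral_span_pairs[OF that] by simp
  qed (use that in auto)
  have hb: "has_bochner_integral lborel ?f (\<Sum>(a, b)\<in>?P. 2 * (-1) ^ card (A \<inter> {a..b}) * (1 / (b - a)))"
    unfolding case_prod_beta
    by (intro has_bochner_integral_sum has_bochner_integral_mult_right) (use one[unfolded case_prod_beta prod.collapse] in auto)
  have nonneg: "0 \<le> ?f x" for x
    using f[of "snd x" "fst x", symmetric] by (cases x) (simp only: f[symmetric], simp)
  have int: "(\<integral>\<^sup>+x. ennreal (?f x) \<partial>lborel) = ennreal (\<Sum>(a, b)\<in>?P. 2 * (-1) ^ card (A \<inter> {a..b}) * (1 / (b - a)))"
    using hb nonneg by (subst nn_integral_eq_integral) (auto simp: has_bochner_integral_iff)
  have sum_eq: "(\<Sum>(a, b)\<in>{(a, b). a \<in> A \<and> b \<in> A \<and> a \<noteq> b}. (-1) ^ card (A \<inter> {min a b..max a b}) / \<bar>b - a\<bar>) =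
      (\<Sum>(a, b)\<in>?P. 2 * (-1) ^ card (A \<inter> {a..b}) * (1 / (b - a)))"
  proof -
    let ?g = "\<lambda>(a, b). (-1::real) ^ card (A \<inter> {min a b..max a b}) / \<bar>b - a\<bar>"
    have finP: "finite ?P" by (rule finite_subset[of _ "A \<times> A"]) (use A in auto)
    have "{(a, b). a \<in> A \<and> b \<in> A \<and> a \<noteq> b} = ?P \<union> prod.swap ` ?P" by (force simp: image_iff)
    then have "sum ?g {(a, b). a \<in> A \<and> b \<in> A \<and> a \<noteq> b} = sum ?g ?P + sum ?g (prod.swap ` ?P)"
      using finP by (simp only:) (rule sum.union_disjoint, auto)
    also have "sum ?g (prod.swap ` ?P) = sum ?g ?P"
      by (subst sum.reindex) (auto intro!: sum.cong simp: min.commute max.commute abs_minus_commute)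
    also have "sum ?g ?P + sum ?g ?P = (\<Sum>(a, b)\<in>?P. 2 * (-1) ^ card (A \<inter> {a..b}) * (1 / (b - a)))"
      unfolding sum.distrib[symmetric] by (rule sum.cong) (auto simp: min_def max_def)
    finally show ?thesis .
  qed
  have "(\<integral>\<^sup>+(s, t). ennreal (1 / \<bar>t - s\<bar> ^ 3) * ennreal (real (even_part A s t)) \<partial>lborel) = (\<integral>\<^sup>+x. ennreal (?f x) \<partial>lborel)"
  proof (rule nn_integral_cong)
    fix x :: "real \<times> real"
    obtain s t where x: "x = (s, t)" by (cases x)
    show "(case x of (s, t) \<Rightarrow> ennreal (1 / \<bar>t - s\<bar> ^ 3) * ennreal (real (even_part A s t))) = ennreal (?f x)"
      unfolding x using f[of t s] by (simp add: ennreal_mult[symmetric])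
  qed
  then show "(\<integral>\<^sup>+(s, t). ennreal (1 / \<bar>t - s\<bar> ^ 3) * ennreal (real (even_part A s t)) \<partial>lborel) =
    ennreal (\<Sum>(a, b)\<in>{(a, b). a \<in> A \<and> b \<in> A \<and> a \<noteq> b}. (-1) ^ card (A \<inter> {min a b..max a b}) / \<bar>b - a\<bar>)"
    unfolding sum_eq int .
  show "0 \<le> (\<Sum>(a, b)\<in>{(a, b). a \<in> A \<and> b \<in> A \<and> a \<noteq> b}. (-1) ^ card (A \<inter> {min a b..max a b}) / \<bar>b - a\<bar>)"
    unfolding sum_eq has_bochner_integral_integral_eq[OF hb, symmetric]
    by (intro integral_nonneg_AE AE_I2 nonneg)
qed

lemma nn_integral_even_part_le:
  assumes A: "finite A"
  shows "(\<integral>\<^sup>+(s, t). ennreal (1 / \<bar>t - s\<bar> ^ 3) * ennreal (real (even_part A s t)) \<partial>lborel) \<le>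
    ennreal (2 * (\<Sum>a\<in>A - {Max A}. 1 / (next_in A a - a)))"
proof -
  have nx: "a < next_in A a" if "a \<in> A - {Max A}" for a
  proof -
    have "Max A \<in> {b \<in> A. a < b}" using that A by (auto intro: Max_in simp: less_le)
    then have "next_in A a \<in> {b \<in> A. a < b}" unfolding next_in_def using A by (intro Min_in) auto
    then show ?thesis by simp
  qed
  have "(\<integral>\<^sup>+(s, t). ennreal (1 / \<bar>t - s\<bar> ^ 3) * ennreal (real (even_part A s t)) \<partial>lborel) \<le>
    (\<integral>\<^sup>+x. 2 * (\<Sum>a\<in>A - {Max A}. (case x of (s, t) \<Rightarrow> ennreal (1 / \<bar>t - s\<bar> ^ 3) * indicator (span_pairs a (next_in A a)) (s, t))) \<partial>lborel)"
  proof (rule nn_integral_mono, clarify)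
    fix s t :: real
    have "ennreal (real (even_part A s t)) \<le> ennreal (2 * (\<Sum>a\<in>A - {Max A}. indicator (span_pairs a (next_in A a)) (s, t)))"
      by (intro ennreal_leI even_part_le_consecutive A)
    also have "\<dots> = 2 * (\<Sum>a\<in>A - {Max A}. indicator (span_pairs a (next_in A a)) (s, t))"
      by (simp add: ennreal_mult sum_nonneg sum_ennreal[symmetric] ennreal_indicator)
    finally have "ennreal (1 / \<bar>t - s\<bar> ^ 3) * ennreal (real (even_part A s t)) \<le>
      ennreal (1 / \<bar>t - s\<bar> ^ 3) * (2 * (\<Sum>a\<in>A - {Max A}. indicator (span_pairs a (next_in A a)) (s, t)))"
      by (rule mult_left_mono) simp
    then show "ennreal (1 / \<bar>t - s\<bar> ^ 3) * ennreal (real (even_part A s t)) \<le>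
      2 * (\<Sum>a\<in>A - {Max A}. ennreal (1 / \<bar>t - s\<bar> ^ 3) * indicator (span_pairs a (next_in A a)) (s, t))"
      by (simp add: sum_distrib_left mult_ac)
  qed
  also have "\<dots> = 2 * (\<Sum>a\<in>A - {Max A}. \<integral>\<^sup>+x. (case x of (s, t) \<Rightarrow> ennreal (1 / \<bar>t - s\<bar> ^ 3) * indicator (span_pairs a (next_in A a)) (s, t)) \<partial>lborel)"
  proof -
    have m: "(\<lambda>x. (case x of (s, t) \<Rightarrow> ennreal (1 / \<bar>t - s\<bar> ^ 3) * indicator (span_pairs a (next_in A a)) (s, t))) \<in> borel_measurable borel" for a
    proof -
      have eq: "(\<lambda>x. (case x of (s, t) \<Rightarrow> ennreal (1 / \<bar>t - s\<bar> ^ 3) * indicator (span_pairs a (next_in A a)) (s, t))) =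
        (\<lambda>x. ennreal (case x of (s, t) \<Rightarrow> 1 / \<bar>t - s\<bar> ^ 3 * indicator (span_pairs a (next_in A a)) (s, t)))"
        by (auto simp: fun_eq_iff split: split_indicator)
      show ?thesis
        unfolding eq using measurable_compose[OF span_kernel_borel measurable_ennreal] by simp
    qed
    show ?thesis by (subst nn_integral_cmult) (auto intro!: borel_measurable_sum m simp: nn_integral_sum m)
  qed
  also have "\<dots> = 2 * (\<Sum>a\<in>A - {Max A}. ennreal (1 / (next_in A a - a)))"
    using nn_integral_span_pairs[OF nx] by simp
  also have "\<dots> = ennreal (2 * (\<Sum>a\<in>A - {Max A}. 1 / (next_in A a - a)))"
  proof -
    have "0 \<le> 1 / (next_in A a - a)" if "a \<in> A - {Max A}" for a using nx[OF that] by simp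
    note nn = this
    have "(\<Sum>a\<in>A - {Max A}. ennreal (1 / (next_in A a - a))) = ennreal (\<Sum>a\<in>A - {Max A}. 1 / (next_in A a - a))"
      by (rule sum_ennreal) (rule nn)
    moreover have "0 \<le> (\<Sum>a\<in>A - {Max A}. 1 / (next_in A a - a))" by (rule sum_nonneg) (rule nn)
    ultimately show ?thesis by (simp add: ennreal_mult)
  qed
  finally show ?thesis .
qed

section \<open>Pairs of points of the plane and lines\<close>

definition pt :: "real \<Rightarrow> real \<Rightarrow> real^2" where
  "pt x y = x *\<^sub>R axis 1 1 + y *\<^sub>R axis 2 1"

lemma pt_nth [simp]: "pt x y $ 1 = x" "pt x y $ 2 = y"
  by (simp_all add: pt_def axis_def)

lemma pt_measurable [measurable]: "(\<lambda>(x, y). pt x y) \<in> borel_measurable (borel \<Otimes>\<^sub>M borel)"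
  unfolding pt_def case_prod_beta by measurable

lemma pt_measurable_compose [measurable (raw)]:
  "f \<in> borel_measurable M \<Longrightarrow> g \<in> borel_measurable M \<Longrightarrow> (\<lambda>x. pt (f x) (g x)) \<in> borel_measurable M"
  unfolding pt_def by (intro borel_measurable_add borel_measurable_scaleR) auto

lemma lborel_plane: "(lborel :: (real^2) measure) = distr (lborel \<Otimes>\<^sub>M lborel) borel (\<lambda>(x, y). pt x y)"
proof (rule lborel_eqI)
  fix l u :: "real^2"
  assume "\<And>b. b \<in> Basis \<Longrightarrow> l \<bullet> b \<le> u \<bullet> b"
  from this[of "axis 1 1"] this[of "axis 2 1"] have le: "l $ 1 \<le> u $ 1" "l $ 2 \<le> u $ 2"
    by (auto simp: axis_in_Basis_iff inner_axis)
  have "(\<lambda>(x, y). pt x y) -` box l u \<inter> space (lborel \<Otimes>\<^sub>M lborel) = {l$1<..<u$1} \<times> {l$2<..<u$2}"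
    by (auto simp: mem_box_cart forall_2 space_pair_measure)
  then have "emeasure (distr (lborel \<Otimes>\<^sub>M lborel) borel (\<lambda>(x, y). pt x y)) (box l u) =
      emeasure (lborel \<Otimes>\<^sub>M lborel) ({l$1<..<u$1} \<times> {l$2<..<u$2})"
    by (subst emeasure_distr) auto
  also have "\<dots> = ennreal (u$1 - l$1) * ennreal (u$2 - l$2)"
    using le by (subst lborel.emeasure_pair_measure_Times) auto
  also have "\<dots> = ennreal ((u$1 - l$1) * (u$2 - l$2))"
    using le by (simp add: ennreal_mult)
  also have "(u$1 - l$1) * (u$2 - l$2) = (\<Prod>b\<in>Basis. (u - l) \<bullet> b)"
  proof -
    have "(Basis :: (real^2) set) = {axis 1 1, axis 2 1}"
      by (auto simp: Basis_vec_def exhaust_2) (metis exhaust_2)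
    moreover have "axis 1 1 \<noteq> (axis 2 1 :: real^2)" by (simp add: axis_eq_axis)
    ultimately have "(\<Prod>b\<in>Basis. (u - l) \<bullet> b) = (\<Prod>b\<in>{axis 1 1, axis 2 1 :: real^2}. (u - l) \<bullet> b)"
      by (simp only:)
    also have "\<dots> = (u$1 - l$1) * (u$2 - l$2)"
      using \<open>axis 1 1 \<noteq> (axis 2 1 :: real^2)\<close> by (simp add: inner_axis)
    finally show ?thesis ..
  qed
  finally show "emeasure (distr (lborel \<Otimes>\<^sub>M lborel) borel (\<lambda>(x, y). pt x y)) (box l u) = ennreal (\<Prod>b\<in>Basis. (u - l) \<bullet> b)" .
qed simp

lemma nn_integral_plane:
  assumes [measurable]: "h \<in> borel_measurable borel"
  shows "(\<integral>\<^sup>+z. h z \<partial>(lborel :: (real^2) measure)) = (\<integral>\<^sup>+x. \<integral>\<^sup>+y. h (pt x y) \<partial>lborel \<partial>lborel)"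
proof -
  have "(\<integral>\<^sup>+z. h z \<partial>(lborel :: (real^2) measure)) = (\<integral>\<^sup>+q. h (case q of (x, y) \<Rightarrow> pt x y) \<partial>(lborel \<Otimes>\<^sub>M lborel))"
    by (subst lborel_plane, subst nn_integral_distr) auto
  also have "\<dots> = (\<integral>\<^sup>+x. \<integral>\<^sup>+y. h (pt x y) \<partial>lborel \<partial>lborel)"
    by (subst lborel.nn_integral_fst[symmetric]) auto
  finally show ?thesis .
qed

lemma borel_measurable_sin_cos [measurable (raw)]:
  fixes f :: "'a \<Rightarrow> real"
  assumes "f \<in> borel_measurable M"
  shows "(\<lambda>x. sin (f x)) \<in> borel_measurable M" "(\<lambda>x. cos (f x)) \<in> borel_measurable M"
  using assms by (auto intro!: measurable_compose[OF assms] borel_measurable_continuous_onI continuous_intros)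

lemma nn_integral_tan:
  fixes f :: "real \<Rightarrow> ennreal"
  assumes [measurable]: "f \<in> borel_measurable borel"
  shows "(\<integral>\<^sup>+m. f m \<partial>lborel) =
    (\<integral>\<^sup>+\<psi>. f (tan \<psi>) * ennreal (1 / (cos \<psi>)\<^sup>2) * indicator {-pi/2<..<pi/2} \<psi> \<partial>lborel)"
proof -
  define b where "b n = pi / 2 - 1 / real (Suc n)" for n
  have b: "0 < b n" "b n < pi / 2" for n
  proof -
    have "1 / real (Suc n) \<le> 1" by simp
    then show "0 < b n" using pi_gt3 unfolding b_def by linarith
    show "b n < pi / 2" by (simp add: b_def)
  qed
  have b_mono: "b m \<le> b n" if "m \<le> n" for m n
    using that by (auto simp: b_def frac_le)
  have ex: "\<exists>n. \<bar>x\<bar> \<le> b n" if "\<bar>x\<bar> < pi / 2" for x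
  proof -
    have "0 < pi / 2 - \<bar>x\<bar>" using that by simp
    then obtain n where "1 / real (Suc n) < pi / 2 - \<bar>x\<bar>"
      using reals_Archimedean unfolding inverse_eq_divide by blast
    then show ?thesis by (intro exI[of _ n]) (simp add: b_def)
  qed
  define g where "g \<psi> = f (tan \<psi>) * ennreal (1 / (cos \<psi>)\<^sup>2)" for \<psi>
  have [measurable]: "g \<in> borel_measurable borel" unfolding g_def tan_def by measurable
  have sub: "emeasure (density lborel f) {tan (- b n)..tan (b n)} = emeasure (density lborel g) {- b n..b n}" for n
  proof -
    have c: "cos x \<noteq> 0" if "x \<in> {- b n..b n}" for x
      using that b[of n] by (intro less_imp_neq[symmetric] cos_gt_zero_pi) auto
    have "(\<integral>\<^sup>+x. f x * indicator {tan (- b n)..tan (b n)} x \<partial>lborel) =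
             (\<integral>\<^sup>+x. f (tan x) * ennreal (inverse ((cos x)\<^sup>2)) * indicator {- b n..b n} x \<partial>lborel)"
    proof (rule nn_integral_substitution_aux)
      show "(tan has_real_derivative inverse ((cos x)\<^sup>2)) (at x)" if "x \<in> {- b n..b n}" for x
        using c[OF that] by (rule DERIV_tan)
      show "continuous_on {- b n..b n} (\<lambda>x. inverse ((cos x)\<^sup>2))"
        using c by (intro continuous_intros) auto
    qed (use b[of n] in auto)
    then show ?thesis by (simp add: emeasure_density g_def inverse_eq_divide)
  qed
  have tan_le: "tan (- b n) \<le> y \<and> y \<le> tan (b n) \<longleftrightarrow> \<bar>arctan y\<bar> \<le> b n" for y n
  proof -
    have "tan (- b n) \<le> tan (arctan y) \<longleftrightarrow> - b n \<le> arctan y"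
      using b[of n] arctan_bounded[of y] by (intro tan_mono_le_eq) auto
    moreover have "tan (arctan y) \<le> tan (b n) \<longleftrightarrow> arctan y \<le> b n"
      using b[of n] arctan_bounded[of y] by (intro tan_mono_le_eq) auto
    ultimately show ?thesis by (auto simp: tan_arctan abs_le_iff)
  qed
  have "(\<integral>\<^sup>+m. f m \<partial>lborel) = emeasure (density lborel f) (\<Union>n. {tan (- b n)..tan (b n)})"
  proof -
    have "\<exists>n. \<bar>arctan y\<bar> \<le> b n" for y
      using ex[of "arctan y"] arctan_bounded[of y] by (auto simp: abs_less_iff)
    then have "(\<Union>n. {tan (- b n)..tan (b n)}) = UNIV"
      unfolding set_eq_iff UN_iff atLeastAtMost_iff tan_le by simp
    then show ?thesis by (simp add: emeasure_density)
  qed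
  also have "\<dots> = (SUP n. emeasure (density lborel f) {tan (- b n)..tan (b n)})"
  proof (rule SUP_emeasure_incseq[symmetric])
    show "incseq (\<lambda>n. {tan (- b n)..tan (b n)})"
      unfolding incseq_def subset_iff atLeastAtMost_iff tan_le using b_mono by (meson order_trans)
  qed auto
  also have "\<dots> = (SUP n. emeasure (density lborel g) {- b n..b n})" by (simp only: sub)
  also have "\<dots> = emeasure (density lborel g) (\<Union>n. {- b n..b n})"
  proof (rule SUP_emeasure_incseq)
    show "incseq (\<lambda>n. {- b n..b n})"
      using b_mono by (auto simp: incseq_def intro: order_trans)
  qed auto
  also have "(\<Union>n. {- b n..b n}) = {-pi/2<..<pi/2}"
  proof (intro equalityI subsetI)
    fix x assume "x \<in> {-pi/2<..<pi/2}"
    then have "\<bar>x\<bar> < pi / 2" by auto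
    from ex[OF this] show "x \<in> (\<Union>n. {- b n..b n})" by (simp add: abs_le_iff) (metis minus_le_iff)
  next
    fix x assume "x \<in> (\<Union>n. {- b n..b n})"
    then obtain n where "- b n \<le> x" "x \<le> b n" by auto
    then show "x \<in> {-pi/2<..<pi/2}" using b[of n] by auto
  qed
  also have "emeasure (density lborel g) {-pi/2<..<pi/2} =
      (\<integral>\<^sup>+\<psi>. f (tan \<psi>) * ennreal (1 / (cos \<psi>)\<^sup>2) * indicator {-pi/2<..<pi/2} \<psi> \<partial>lborel)"
    by (simp add: emeasure_density g_def)
  finally show ?thesis .
qed

definition line_pt :: "real \<Rightarrow> real \<Rightarrow> real \<Rightarrow> real^2" where
  "line_pt \<phi> p s = pt (p * cos \<phi> - s * sin \<phi>) (p * sin \<phi> + s * cos \<phi>)"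

lemma line_pt_measurable [measurable (raw)]:
  "f \<in> borel_measurable M \<Longrightarrow> g \<in> borel_measurable M \<Longrightarrow> k \<in> borel_measurable M \<Longrightarrow>
    (\<lambda>x. line_pt (f x) (g x) (k x)) \<in> borel_measurable M"
  unfolding line_pt_def
  by (intro pt_measurable_compose borel_measurable_add borel_measurable_diff borel_measurable_times
      borel_measurable_sin_cos)

text \<open>Substitute first the slope \<open>m\<close> of the line for the ordinate of the second point, then the intercept \<open>c\<close> for the ordinate of the first one.\<close>

lemma nn_integral_slopes:
  fixes h :: "(real^2) \<times> (real^2) \<Rightarrow> ennreal"
  assumes "h \<in> borel_measurable borel"
  shows "(\<integral>\<^sup>+q. h q \<partial>lborel) = (\<integral>\<^sup>+m. \<integral>\<^sup>+c. \<integral>\<^sup>+x. \<integral>\<^sup>+y. ennreal \<bar>y - x\<bar> * h (pt x (m * x + c), pt y (m * y + c))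
     \<partial>lborel \<partial>lborel \<partial>lborel \<partial>lborel)"
proof -
  have [measurable]: "h \<in> borel_measurable (borel \<Otimes>\<^sub>M borel)"
    using assms by (simp add: borel_prod)
  have inner: "(\<integral>\<^sup>+a. \<integral>\<^sup>+b. h (pt x a, pt y b) \<partial>lborel \<partial>lborel) =
     (\<integral>\<^sup>+m. \<integral>\<^sup>+c. ennreal \<bar>y - x\<bar> * h (pt x (m * x + c), pt y (m * y + c)) \<partial>lborel \<partial>lborel)"
    if "y \<noteq> x" for x y
  proof -
    have "(\<integral>\<^sup>+a. \<integral>\<^sup>+b. h (pt x a, pt y b) \<partial>lborel \<partial>lborel) =
       (\<integral>\<^sup>+a. \<integral>\<^sup>+m. ennreal \<bar>y - x\<bar> * h (pt x a, pt y (a + (y - x) * m)) \<partial>lborel \<partial>lborel)"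
    proof (rule nn_integral_cong)
      fix a
      show "(\<integral>\<^sup>+b. h (pt x a, pt y b) \<partial>lborel) = (\<integral>\<^sup>+m. ennreal \<bar>y - x\<bar> * h (pt x a, pt y (a + (y - x) * m)) \<partial>lborel)"
        by (subst nn_integral_real_affine[where c = "y - x" and t = a]) (use that in \<open>auto simp: nn_integral_cmult\<close>)
    qed
    also have "\<dots> = (\<integral>\<^sup>+m. \<integral>\<^sup>+a. ennreal \<bar>y - x\<bar> * h (pt x a, pt y (a + (y - x) * m)) \<partial>lborel \<partial>lborel)"
      by (rule lborel_pair.Fubini') measurable
    also have "\<dots> = (\<integral>\<^sup>+m. \<integral>\<^sup>+c. ennreal \<bar>y - x\<bar> * h (pt x (m * x + c), pt y (m * y + c)) \<partial>lborel \<partial>lborel)"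
    proof (rule nn_integral_cong)
      fix m
      show "(\<integral>\<^sup>+a. ennreal \<bar>y - x\<bar> * h (pt x a, pt y (a + (y - x) * m)) \<partial>lborel) =
         (\<integral>\<^sup>+c. ennreal \<bar>y - x\<bar> * h (pt x (m * x + c), pt y (m * y + c)) \<partial>lborel)"
        by (subst nn_integral_real_affine[where c = 1 and t = "m * x"]) (auto simp: algebra_simps)
    qed
    finally show ?thesis .
  qed
  have "(\<integral>\<^sup>+q. h q \<partial>lborel) = (\<integral>\<^sup>+z. \<integral>\<^sup>+w. h (z, w) \<partial>lborel \<partial>lborel)"
    by (subst lborel.nn_integral_fst) (simp_all add: lborel_prod assms)
  also have "\<dots> = (\<integral>\<^sup>+z. \<integral>\<^sup>+y. \<integral>\<^sup>+b. h (z, pt y b) \<partial>lborel \<partial>lborel \<partial>lborel)"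
    by (intro nn_integral_cong nn_integral_plane) measurable
  also have "\<dots> = (\<integral>\<^sup>+x. \<integral>\<^sup>+a. \<integral>\<^sup>+y. \<integral>\<^sup>+b. h (pt x a, pt y b) \<partial>lborel \<partial>lborel \<partial>lborel \<partial>lborel)"
    by (rule nn_integral_plane) measurable
  also have "\<dots> = (\<integral>\<^sup>+x. \<integral>\<^sup>+y. \<integral>\<^sup>+a. \<integral>\<^sup>+b. h (pt x a, pt y b) \<partial>lborel \<partial>lborel \<partial>lborel \<partial>lborel)"
    by (intro nn_integral_cong lborel_pair.Fubini') measurable
  also have "\<dots> = (\<integral>\<^sup>+x. \<integral>\<^sup>+y. \<integral>\<^sup>+m. \<integral>\<^sup>+c. ennreal \<bar>y - x\<bar> * h (pt x (m * x + c), pt y (m * y + c)) \<partial>lborel \<partial>lborel \<partial>lborel \<partial>lborel)"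
  proof (rule nn_integral_cong)
    fix x :: real
    show "(\<integral>\<^sup>+y. \<integral>\<^sup>+a. \<integral>\<^sup>+b. h (pt x a, pt y b) \<partial>lborel \<partial>lborel \<partial>lborel) =
      (\<integral>\<^sup>+y. \<integral>\<^sup>+m. \<integral>\<^sup>+c. ennreal \<bar>y - x\<bar> * h (pt x (m * x + c), pt y (m * y + c)) \<partial>lborel \<partial>lborel \<partial>lborel)"
      by (rule nn_integral_cong_AE, rule AE_mp[OF AE_lborel_singleton[of x]]) (auto simp: inner)
  qed
  also have "\<dots> = (\<integral>\<^sup>+x. \<integral>\<^sup>+m. \<integral>\<^sup>+y. \<integral>\<^sup>+c. ennreal \<bar>y - x\<bar> * h (pt x (m * x + c), pt y (m * y + c)) \<partial>lborel \<partial>lborel \<partial>lborel \<partial>lborel)"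
    by (intro nn_integral_cong lborel_pair.Fubini') measurable
  also have "\<dots> = (\<integral>\<^sup>+m. \<integral>\<^sup>+x. \<integral>\<^sup>+y. \<integral>\<^sup>+c. ennreal \<bar>y - x\<bar> * h (pt x (m * x + c), pt y (m * y + c)) \<partial>lborel \<partial>lborel \<partial>lborel \<partial>lborel)"
    by (intro nn_integral_cong lborel_pair.Fubini') measurable
  also have "\<dots> = (\<integral>\<^sup>+m. \<integral>\<^sup>+x. \<integral>\<^sup>+c. \<integral>\<^sup>+y. ennreal \<bar>y - x\<bar> * h (pt x (m * x + c), pt y (m * y + c)) \<partial>lborel \<partial>lborel \<partial>lborel \<partial>lborel)"
    by (intro nn_integral_cong lborel_pair.Fubini') measurable
  also have "\<dots> = (\<integral>\<^sup>+m. \<integral>\<^sup>+c. \<integral>\<^sup>+x. \<integral>\<^sup>+y. ennreal \<bar>y - x\<bar> * h (pt x (m * x + c), pt y (m * y + c)) \<partial>lborel \<partial>lborel \<partial>lborel \<partial>lborel)"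
    by (intro nn_integral_cong lborel_pair.Fubini') measurable
  finally show ?thesis .
qed

lemma nn_integral_line_pt:
  fixes h :: "(real^2) \<times> (real^2) \<Rightarrow> ennreal"
  assumes h: "h \<in> borel_measurable borel"
  shows "(\<integral>\<^sup>+q. h q \<partial>lborel) = (\<integral>\<^sup>+\<phi>. (\<integral>\<^sup>+p. \<integral>\<^sup>+s. \<integral>\<^sup>+t. ennreal \<bar>t - s\<bar> * h (line_pt \<phi> p s, line_pt \<phi> p t)
     \<partial>lborel \<partial>lborel \<partial>lborel) * indicator {0<..<pi} \<phi> \<partial>lborel)"
proof -
  have [measurable]: "h \<in> borel_measurable (borel \<Otimes>\<^sub>M borel)"
    using assms by (simp add: borel_prod)
  define K where "K m c x y = h (pt x (m * x + c), pt y (m * y + c))" for m c x y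
  have [measurable]: "(\<lambda>v. K (f1 v) (f2 v) (f3 v) (f4 v)) \<in> borel_measurable M"
    if [measurable]: "f1 \<in> borel_measurable M" "f2 \<in> borel_measurable M" "f3 \<in> borel_measurable M" "f4 \<in> borel_measurable M"
    for f1 f2 f3 f4 and M :: "'z measure"
    unfolding K_def by measurable
  have rot: "(\<integral>\<^sup>+c. \<integral>\<^sup>+x. \<integral>\<^sup>+y. ennreal \<bar>y - x\<bar> * K (tan \<psi>) c x y \<partial>lborel \<partial>lborel \<partial>lborel) * ennreal (1 / (cos \<psi>)\<^sup>2) =
     (\<integral>\<^sup>+p. \<integral>\<^sup>+s. \<integral>\<^sup>+t. ennreal \<bar>t - s\<bar> * h (line_pt (pi / 2 + \<psi>) p s, line_pt (pi / 2 + \<psi>) p t) \<partial>lborel \<partial>lborel \<partial>lborel)"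
    if "\<psi> \<in> {-pi/2<..<pi/2}" for \<psi>
  proof -
    define C where "C = cos \<psi>"
    define S where "S = sin \<psi>"
    have C: "C > 0" unfolding C_def using that by (intro cos_gt_zero_pi) auto
    have CS: "C * C + S * S = 1" by (simp add: C_def S_def flip: power2_eq_square)
    have tan: "tan \<psi> = S / C" by (simp add: tan_def C_def S_def)
    have lp: "line_pt (pi / 2 + \<psi>) p s = pt (- p * S - C * s) (tan \<psi> * (- p * S - C * s) + p / C)" for p s
    proof -
      have "p * C - s * S = (S * (- p * S - C * s) + p) / C"
      proof -
        have "S * (- p * S - C * s) + p = p * (1 - S * S) - S * C * s" by (simp add: algebra_simps)
        also have "\<dots> = C * (p * C - s * S)" using CS by (simp add: algebra_simps flip: CS)
        finally show ?thesis using C by simp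
      qed
      also have "\<dots> = tan \<psi> * (- p * S - C * s) + p / C"
        by (simp add: tan add_divide_distrib)
      finally have "p * C + s * - S = tan \<psi> * (- p * S - C * s) + p / C" by simp
      moreover have "p * - S - s * C = - p * S - C * s" by simp
      moreover have "cos (pi / 2 + \<psi>) = - S" "sin (pi / 2 + \<psi>) = C"
        by (simp_all add: sin_add cos_add C_def S_def)
      ultimately show ?thesis unfolding line_pt_def by (simp only:)
    qed
    have "(\<integral>\<^sup>+c. \<integral>\<^sup>+x. \<integral>\<^sup>+y. ennreal \<bar>y - x\<bar> * K (tan \<psi>) c x y \<partial>lborel \<partial>lborel \<partial>lborel) =
       ennreal \<bar>1 / C\<bar> * (\<integral>\<^sup>+p. \<integral>\<^sup>+x. \<integral>\<^sup>+y. ennreal \<bar>y - x\<bar> * K (tan \<psi>) (p / C) x y \<partial>lborel \<partial>lborel \<partial>lborel)"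
      by (subst nn_integral_real_affine[where c = "1 / C" and t = 0]) (use C in auto)
    also have "\<dots> = ennreal \<bar>1 / C\<bar> * (\<integral>\<^sup>+p. ennreal \<bar>- C\<bar> * (\<integral>\<^sup>+s. \<integral>\<^sup>+y. ennreal \<bar>y - (- p * S + - C * s)\<bar> * K (tan \<psi>) (p / C) (- p * S + - C * s) y \<partial>lborel \<partial>lborel) \<partial>lborel)"
      by (intro arg_cong2[where f = "(*)"] refl nn_integral_cong nn_integral_real_affine) (use C in auto)
    also have "\<dots> = ennreal \<bar>1 / C\<bar> * (\<integral>\<^sup>+p. ennreal \<bar>- C\<bar> * (\<integral>\<^sup>+s. ennreal \<bar>- C\<bar> * (\<integral>\<^sup>+t. ennreal \<bar>(- p * S + - C * t) - (- p * S + - C * s)\<bar> * K (tan \<psi>) (p / C) (- p * S + - C * s) (- p * S + - C * t) \<partial>lborel) \<partial>lborel) \<partial>lborel)"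
      by (intro arg_cong2[where f = "(*)"] refl nn_integral_cong nn_integral_real_affine) (use C in auto)
    also have "\<dots> = ennreal \<bar>1 / C\<bar> * (\<integral>\<^sup>+p. ennreal \<bar>- C\<bar> * (\<integral>\<^sup>+s. ennreal \<bar>- C\<bar> * (\<integral>\<^sup>+t. ennreal C * (ennreal \<bar>t - s\<bar> * h (line_pt (pi / 2 + \<psi>) p s, line_pt (pi / 2 + \<psi>) p t)) \<partial>lborel) \<partial>lborel) \<partial>lborel)"
    proof -
      have "\<bar>(- p * S + - C * t) - (- p * S + - C * s)\<bar> = C * \<bar>t - s\<bar>" for p s t
      proof -
        have "(- p * S + - C * t) - (- p * S + - C * s) = C * (s - t)" by (simp add: algebra_simps)
        then show ?thesis using C by (simp add: abs_mult abs_minus_commute)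
      qed
      then show ?thesis
        using C by (simp add: lp K_def ennreal_mult mult.assoc)
    qed
    also have "\<dots> = ennreal (1 / C) * (ennreal C * (ennreal C * (ennreal C * (\<integral>\<^sup>+p. \<integral>\<^sup>+s. \<integral>\<^sup>+t. ennreal \<bar>t - s\<bar> * h (line_pt (pi / 2 + \<psi>) p s, line_pt (pi / 2 + \<psi>) p t) \<partial>lborel \<partial>lborel \<partial>lborel))))"
      using C by (simp add: nn_integral_cmult)
    finally have eq: "(\<integral>\<^sup>+c. \<integral>\<^sup>+x. \<integral>\<^sup>+y. ennreal \<bar>y - x\<bar> * K (tan \<psi>) c x y \<partial>lborel \<partial>lborel \<partial>lborel) =
      ennreal (1 / C) * (ennreal C * (ennreal C * (ennreal C * (\<integral>\<^sup>+p. \<integral>\<^sup>+s. \<integral>\<^sup>+t. ennreal \<bar>t - s\<bar> * h (line_pt (pi / 2 + \<psi>) p s, line_pt (pi / 2 + \<psi>) p t) \<partial>lborel \<partial>lborel \<partial>lborel))))" .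
    have "ennreal (1 / C) * (ennreal C * X) = X" for X
      using C by (simp add: mult.assoc[symmetric] ennreal_mult[symmetric])
    moreover have "ennreal C * (ennreal C * X) * ennreal (1 / C\<^sup>2) = X" for X
    proof -
      have "ennreal C * (ennreal C * X) * ennreal (1 / C\<^sup>2) = (ennreal C * ennreal C * ennreal (1 / C\<^sup>2)) * X"
        by (simp only: mult_ac)
      also have "ennreal C * ennreal C * ennreal (1 / C\<^sup>2) = 1"
        using C by (simp add: ennreal_mult[symmetric] power2_eq_square)
      finally show ?thesis by simp
    qed
    ultimately show ?thesis unfolding eq C_def[symmetric] by simp
  qed
  have "(\<integral>\<^sup>+q. h q \<partial>lborel) = (\<integral>\<^sup>+m. \<integral>\<^sup>+c. \<integral>\<^sup>+x. \<integral>\<^sup>+y. ennreal \<bar>y - x\<bar> * K m c x y \<partial>lborel \<partial>lborel \<partial>lborel \<partial>lborel)"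
    unfolding K_def by (rule nn_integral_slopes[OF h])
  also have "\<dots> = (\<integral>\<^sup>+\<psi>. (\<integral>\<^sup>+c. \<integral>\<^sup>+x. \<integral>\<^sup>+y. ennreal \<bar>y - x\<bar> * K (tan \<psi>) c x y \<partial>lborel \<partial>lborel \<partial>lborel) *
      ennreal (1 / (cos \<psi>)\<^sup>2) * indicator {-pi/2<..<pi/2} \<psi> \<partial>lborel)"
    by (rule nn_integral_tan) measurable
  also have "\<dots> = (\<integral>\<^sup>+\<psi>. (\<integral>\<^sup>+p. \<integral>\<^sup>+s. \<integral>\<^sup>+t. ennreal \<bar>t - s\<bar> * h (line_pt (pi / 2 + \<psi>) p s, line_pt (pi / 2 + \<psi>) p t)
     \<partial>lborel \<partial>lborel \<partial>lborel) * indicator {0<..<pi} (pi / 2 + \<psi>) \<partial>lborel)"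
    by (intro nn_integral_cong) (auto simp: rot split: split_indicator)
  also have "\<dots> = (\<integral>\<^sup>+\<phi>. (\<integral>\<^sup>+p. \<integral>\<^sup>+s. \<integral>\<^sup>+t. ennreal \<bar>t - s\<bar> * h (line_pt \<phi> p s, line_pt \<phi> p t)
     \<partial>lborel \<partial>lborel \<partial>lborel) * indicator {0<..<pi} \<phi> \<partial>lborel)"
    by (subst (2) nn_integral_real_affine[where c = 1 and t = "pi / 2"]) auto
  finally show ?thesis .
qed

section \<open>Push-forward measures\<close>

lemma
  assumes f: "\<And>x. x \<in> space M \<Longrightarrow> f x \<in> \<Omega>"
  shows space_push_measure: "space (push_measure \<Omega> f M) = \<Omega>"
    and sets_push_measure: "sets (push_measure \<Omega> f M) = {A. A \<subseteq> \<Omega> \<and> f -` A \<inter> space M \<in> sets M}"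
    and measurable_push_measure: "f \<in> measurable M (push_measure \<Omega> f M)"
proof -
  let ?A = "{A. A \<subseteq> \<Omega> \<and> f -` A \<inter> space M \<in> sets M}"
  have "sigma_algebra \<Omega> ?A"
    unfolding sigma_algebra_iff2
  proof (intro conjI ballI allI impI)
    fix s assume s: "s \<in> ?A"
    have "f -` (\<Omega> - s) \<inter> space M = space M - (f -` s \<inter> space M)" using f by auto
    then show "\<Omega> - s \<in> ?A" using s by auto
  next
    fix A :: "nat \<Rightarrow> _" assume A: "range A \<subseteq> ?A"
    have "f -` (\<Union> (range A)) \<inter> space M = (\<Union>i. f -` A i \<inter> space M)" by auto
    moreover have "(\<Union>i. f -` A i \<inter> space M) \<in> sets M" using A by blast
    ultimately show "(\<Union> (range A)) \<in> ?A" using A by auto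
  qed auto
  then have s: "sigma_sets \<Omega> ?A = ?A" by (rule sigma_algebra.sigma_sets_eq)
  show *: "space (push_measure \<Omega> f M) = \<Omega>"
    unfolding push_measure_def by (auto simp: space_measure_of_conv)
  show **: "sets (push_measure \<Omega> f M) = ?A"
    unfolding push_measure_def using s by (subst sets_distr, subst sets_measure_of) auto
  show "f \<in> measurable M (push_measure \<Omega> f M)"
    by (rule measurableI) (use f * ** in auto)
qed

lemma borel_measurable_push_measure:
  fixes h :: "'b \<Rightarrow> real"
  assumes f: "\<And>x. x \<in> space M \<Longrightarrow> f x \<in> \<Omega>" and h: "(\<lambda>x. h (f x)) \<in> borel_measurable M"
  shows "h \<in> borel_measurable (push_measure \<Omega> f M)"
proof (rule measurableI)
  fix A :: "real set" assume "A \<in> sets borel"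
  then have "(\<lambda>x. h (f x)) -` A \<inter> space M \<in> sets M" using h by (rule measurable_sets[rotated])
  also have "(\<lambda>x. h (f x)) -` A \<inter> space M = f -` (h -` A \<inter> \<Omega>) \<inter> space M" using f by auto
  finally show "h -` A \<inter> space (push_measure \<Omega> f M) \<in> sets (push_measure \<Omega> f M)"
    by (simp add: space_push_measure[OF f] sets_push_measure[OF f])
qed simp

lemma borel_measurable_lebesgue_AE:
  fixes g h :: "('a::euclidean_space) \<Rightarrow> real"
  assumes g: "g \<in> borel_measurable borel" and ae: "AE x in lborel. g x = h x"
  shows "h \<in> borel_measurable lebesgue"
proof (rule measurableI)
  fix A :: "real set" assume A: "A \<in> sets borel"
  have "g -` A \<inter> space borel \<in> sets borel" using g A by (rule measurable_sets)
  then have gA: "g -` A \<in> sets lebesgue" by (metis Int_UNIV_right sets_completionI_sets sets_lborel space_borel)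
  have "AE x in lebesgue. x \<in> g -` A \<longleftrightarrow> x \<in> h -` A"
    using AE_completion[OF ae] by (rule eventually_mono) simp
  from completion.in_sets_AE[OF this gA] show "h -` A \<inter> space lebesgue \<in> sets lebesgue"
    by simp
qed simp

lemma push_lebesgue_density:
  fixes d :: "'a::euclidean_space \<Rightarrow> real" and h :: "'b \<Rightarrow> real" and F :: "'a \<Rightarrow> ennreal"
  assumes S [measurable]: "S \<in> sets borel" and f: "\<And>x. x \<in> S \<Longrightarrow> f x \<in> \<Omega>"
    and d [measurable]: "d \<in> borel_measurable borel" and F [measurable]: "F \<in> borel_measurable borel"
    and h: "AE x in lborel. x \<in> S \<longrightarrow> 0 \<le> h (f x) \<and> ennreal (h (f x)) = F x"
    and fin: "(\<integral>\<^sup>+x. ennreal (d x) * F x * indicator S x \<partial>lborel) < \<infinity>"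
  defines "N \<equiv> push_measure \<Omega> f (density (restrict_space lebesgue S) (\<lambda>x. ennreal (d x)))"
  shows "integrable N h"
    and "(\<integral>l. h l \<partial>N) = enn2real (\<integral>\<^sup>+x. ennreal (d x) * F x * indicator S x \<partial>lborel)"
proof -
  define M where "M = density (restrict_space lebesgue S) (\<lambda>x. ennreal (d x))"
  have S': "S \<inter> space lebesgue \<in> sets lebesgue" by auto
  have f': "f x \<in> \<Omega>" if "x \<in> space M" for x
    using that f by (auto simp: M_def space_restrict_space)
  have "(\<lambda>x. indicator S x *\<^sub>R h (f x)) \<in> borel_measurable lebesgue"
  proof (rule borel_measurable_lebesgue_AE)
    show "(\<lambda>x. indicator S x * enn2real (F x)) \<in> borel_measurable borel" by measurable
    show "AE x in lborel. indicator S x * enn2real (F x) = indicator S x *\<^sub>R h (f x)"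
      using h
    proof eventually_elim
      case (elim x)
      show ?case
      proof (cases "x \<in> S")
        case True
        then have "F x = ennreal (h (f x))" "0 \<le> h (f x)" using elim by auto
        then show ?thesis by simp
      qed simp
    qed
  qed
  then have hf [measurable]: "(\<lambda>x. h (f x)) \<in> borel_measurable (restrict_space lebesgue S)"
    by (subst borel_measurable_restrict_space_iff[OF S'])
  have dm [measurable]: "(\<lambda>x. ennreal (d x)) \<in> borel_measurable (restrict_space lebesgue S)"
    by (intro measurable_restrict_space1 measurable_completion) simp
  have hM: "(\<lambda>x. h (f x)) \<in> borel_measurable M" unfolding M_def by simp
  have hN: "h \<in> borel_measurable N"
    unfolding N_def M_def[symmetric] by (rule borel_measurable_push_measure[OF f' hM])
  have fM: "f \<in> measurable M N"
    unfolding N_def M_def[symmetric] by (rule measurable_push_measure[OF f'])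
  have N: "N = distr M N f"
    unfolding N_def M_def[symmetric] push_measure_def by (rule distr_cong) simp_all
  have ae: "AE x in restrict_space lebesgue S. 0 \<le> h (f x) \<and> ennreal (h (f x)) = F x"
    unfolding AE_restrict_space_iff[OF S'] using AE_completion[OF h] by simp
  then have "AE x in restrict_space lebesgue S. 0 \<le> h (f x)" by eventually_elim auto
  then have nonneg: "AE x in M. 0 \<le> h (f x)"
    unfolding M_def by (subst AE_density) auto
  have "(\<integral>\<^sup>+x. ennreal (h (f x)) \<partial>M) = (\<integral>\<^sup>+x. ennreal (d x) * ennreal (h (f x)) \<partial>restrict_space lebesgue S)"
    unfolding M_def by (subst nn_integral_density) auto
  also have "\<dots> = (\<integral>\<^sup>+x. ennreal (d x) * F x \<partial>restrict_space lebesgue S)"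
    using ae by (intro nn_integral_cong_AE) auto
  also have "\<dots> = (\<integral>\<^sup>+x. ennreal (d x) * F x * indicator S x \<partial>lborel)"
    by (subst nn_integral_restrict_space[OF S']) (simp add: nn_integral_completion)
  finally have I: "(\<integral>\<^sup>+x. ennreal (h (f x)) \<partial>M) = (\<integral>\<^sup>+x. ennreal (d x) * F x * indicator S x \<partial>lborel)" .
  have "integrable M (\<lambda>x. h (f x))"
    by (rule integrableI_nn_integral_finite[OF hM nonneg, where x = "enn2real (\<integral>\<^sup>+x. ennreal (h (f x)) \<partial>M)"])
      (use fin in \<open>simp add: I less_top\<close>)
  then show "integrable N h"
    by (subst N) (simp add: integrable_distr_eq[OF fM hN])
  show "(\<integral>l. h l \<partial>N) = enn2real (\<integral>\<^sup>+x. ennreal (d x) * F x * indicator S x \<partial>lborel)"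
    by (subst N) (simp add: integral_distr[OF fM hN] integral_eq_nn_integral[OF hM nonneg] I)
qed

lemma AE_push_lebesgue_density:
  fixes d :: "'a::euclidean_space \<Rightarrow> real"
  assumes S [measurable]: "S \<in> sets borel" and f: "\<And>x. x \<in> S \<Longrightarrow> f x \<in> \<Omega>"
    and d [measurable]: "d \<in> borel_measurable borel"
    and Q: "AE x in lborel. x \<in> S \<longrightarrow> Q (f x)"
  shows "AE l in push_measure \<Omega> f (density (restrict_space lebesgue S) (\<lambda>x. ennreal (d x))). Q l"
proof -
  define h where "h l = (if Q l then 0 else 1 :: real)" for l
  have "AE x in lborel. x \<in> S \<longrightarrow> 0 \<le> h (f x) \<and> ennreal (h (f x)) = 0"
    using Q by eventually_elim (auto simp: h_def)
  from push_lebesgue_density[OF S f d _ this]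
  have "integrable (push_measure \<Omega> f (density (restrict_space lebesgue S) (\<lambda>x. ennreal (d x)))) h"
    "(\<integral>l. h l \<partial>push_measure \<Omega> f (density (restrict_space lebesgue S) (\<lambda>x. ennreal (d x)))) = 0"
    by auto
  moreover have "0 \<le> h l" for l by (simp add: h_def)
  ultimately have "AE l in push_measure \<Omega> f (density (restrict_space lebesgue S) (\<lambda>x. ennreal (d x))). h l = 0"
    by (subst (asm) integral_nonneg_eq_0_iff_AE) auto
  then show ?thesis by eventually_elim (auto simp: h_def split: if_splits)
qed

section \<open>The two sides of a Jordan curve\<close>

lemma Jordan_plane:
  fixes \<gamma> :: "real \<Rightarrow> real^2"
  assumes "simple_path \<gamma>" "pathfinish \<gamma> = pathstart \<gamma>"
  obtains I E where "open I" "connected I" "bounded I" "open E" "connected E" "\<not> bounded E"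
    "I \<inter> E = {}" "I \<union> E = - path_image \<gamma>" "frontier I = path_image \<gamma>" "frontier E = path_image \<gamma>"
proof -
  define T :: "real^2 \<Rightarrow> complex" where "T z = Complex (z $ 1) (z $ 2)" for z
  define S :: "complex \<Rightarrow> real^2" where "S c = (\<chi> i. if i = 1 then Re c else Im c)" for c
  have TS: "T (S c) = c" "S (T z) = z" for c z
    by (simp_all add: T_def S_def vec_eq_iff forall_2)
  have lin: "linear T" "linear S"
    by (auto intro!: linearI simp: T_def S_def complex_eq_iff vec_eq_iff)
  have bij: "bij T" "bij S" using TS by (metis bij_betw_byWitness[of UNIV T S UNIV] bij_betw_byWitness[of UNIV S T UNIV] subset_UNIV)+
  have inj: "inj T" "inj S" using bij by (auto simp: bij_is_inj)
  define c where "c = T \<circ> \<gamma>"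
  have "simple_path c" "pathfinish c = pathstart c"
    using assms simple_path_linear_image_eq[OF lin(1) inj(1)]
    by (simp_all add: c_def pathfinish_def pathstart_def)
  note J = Jordan_inside_outside[OF this]
  have img: "path_image \<gamma> = S ` path_image c"
    unfolding c_def path_image_compose image_image TS by simp
  have fr: "frontier (S ` A) = S ` frontier A" for A
    unfolding frontier_def
    by (simp add: closure_injective_linear_image[OF lin(2) inj(2)] interior_bijective_linear_image[OF lin(2) bij(2)] image_set_diff[OF inj(2)])
  have cont: "continuous_on A S" for A
    using lin by (intro linear_continuous_on) (simp add: linear_linear)
  show ?thesis
  proof (rule that[of "S ` inside (path_image c)" "S ` outside (path_image c)"])
    show "open (S ` inside (path_image c))" "open (S ` outside (path_image c))"
      using J open_bijective_linear_image_eq[OF lin(2) bij(2)] by auto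
    show "connected (S ` inside (path_image c))" "connected (S ` outside (path_image c))"
      using J by (auto intro!: connected_continuous_image cont)
    show "bounded (S ` inside (path_image c))"
      using J lin by (auto intro!: bounded_linear_image simp: linear_linear)
    show "\<not> bounded (S ` outside (path_image c))"
    proof
      assume "bounded (S ` outside (path_image c))"
      then have "bounded (T ` S ` outside (path_image c))"
        using lin by (auto intro!: bounded_linear_image simp: linear_linear)
      then show False using J by (simp add: image_image TS)
    qed
    show "S ` inside (path_image c) \<inter> S ` outside (path_image c) = {}"
      using J image_Int[OF inj(2)] by (metis image_empty)
    show "S ` inside (path_image c) \<union> S ` outside (path_image c) = - path_image \<gamma>"
      unfolding img using J bij_image_Compl_eq[OF bij(2)] by (metis image_Un)
    show "frontier (S ` inside (path_image c)) = path_image \<gamma>" "frontier (S ` outside (path_image c)) = path_image \<gamma>"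
      unfolding img fr using J by auto
  qed
qed

lemma lambda2_semicircle:
  assumes C: "compact C" and I: "open I" "connected I" "bounded I"
    and E: "open E" "connected E" "\<not> bounded E" and disj: "I \<inter> E = {}" and un: "I \<union> E = - C"
    and zw: "z \<noteq> w" "z \<notin> C" "w \<notin> C"
  shows "lambda2 (semicircle z w) C = (if z \<in> I \<longleftrightarrow> w \<in> I then 0 else 1)"
proof -
  define X where "X = subtopology ideal_boundary (- Some ` C)"
  define U where "U = Some ` I"
  define V where "V = insert None (Some ` E)"
  have top: "topspace X = U \<union> V" "topspace X = - Some ` C"
    using un disj by (auto simp: X_def ideal_boundary_def U_def V_def image_iff)
  have UV: "U \<inter> V = {}" using disj by (auto simp: U_def V_def)
  have "openin ideal_boundary U"
    using I by (simp add: ideal_boundary_def U_def)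
  then have oU: "openin X U"
    using top unfolding X_def openin_subtopology by blast
  have IC: "I \<union> C = - E" using un disj by blast
  have "closed (I \<union> C)" unfolding IC using E(1) by (simp add: closed_def)
  moreover have "bounded (I \<union> C)" using I(3) C by (simp add: compact_imp_bounded)
  ultimately have "compact (I \<union> C)" by (simp add: compact_eq_bounded_closed)
  then have "openin ideal_boundary V"
    unfolding ideal_boundary_def openin_Alexandroff_compactification V_def
    using IC by (intro disjI2 exI[of _ "I \<union> C"]) (auto simp: compact_imp_closed)
  then have oV: "openin X V"
    using top unfolding X_def openin_subtopology by blast
  have cU: "connectedin X U"
  proof -
    have "connectedin ideal_boundary U"
      unfolding ideal_boundary_def U_def
      by (rule connectedin_continuous_map_image[OF continuous_map_Some]) (use I in simp)
    then show ?thesis using top unfolding X_def by (auto simp: connectedin_subtopology)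
  qed
  have cV: "connectedin X V"
  proof -
    have c: "connectedin ideal_boundary (Some ` E)"
      unfolding ideal_boundary_def
      by (rule connectedin_continuous_map_image[OF continuous_map_Some]) (use E in simp)
    have "None \<in> ideal_boundary closure_of (Some ` E)"
      unfolding in_closure_of
    proof (intro conjI allI impI)
      show "None \<in> topspace ideal_boundary" by (simp add: ideal_boundary_def)
      fix T assume "None \<in> T \<and> openin ideal_boundary T"
      then obtain K where K: "compact K" "T = insert None (Some ` (- K))"
        by (auto simp: ideal_boundary_def openin_Alexandroff_compactification Compl_eq_Diff_UNIV)
      have "\<not> E \<subseteq> K" using K(1) E(3) bounded_subset compact_imp_bounded by blast
      then show "\<exists>y. y \<in> Some ` E \<and> y \<in> T" using K by auto
    qed
    moreover have "Some ` E \<subseteq> ideal_boundary closure_of (Some ` E)"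
      by (rule closure_of_subset) (auto simp: ideal_boundary_def)
    ultimately have "connectedin ideal_boundary V"
      by (intro connectedin_intermediate_closure_of[OF c]) (auto simp: V_def)
    then show ?thesis using top unfolding X_def by (auto simp: connectedin_subtopology)
  qed
  have comp: "connected_component_of_set X x = (if x \<in> U then U else V)" if "x \<in> U \<union> V" for x
  proof (intro equalityI)
    show "(if x \<in> U then U else V) \<subseteq> connected_component_of_set X x"
      using that connected_component_of_maximal[OF cU, of x] connected_component_of_maximal[OF cV, of x] by auto
    have "\<not> (connected_component_of_set X x \<inter> U \<noteq> {} \<and> connected_component_of_set X x \<inter> V \<noteq> {})"
      using connectedinD[OF connectedin_connected_component_of oU oV] UV top
        connected_component_of_subset_topspace[of X x] by blast
    moreover have "x \<in> connected_component_of_set X x"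
      using that top by (simp add: connected_component_of_refl)
    ultimately show "connected_component_of_set X x \<subseteq> (if x \<in> U then U else V)"
      using connected_component_of_subset_topspace[of X x] top that by auto
  qed
  have mem: "Some z \<in> U \<union> V" "Some w \<in> U \<union> V"
    using zw top by auto
  have comps: "connected_components_of X = (\<lambda>x. if x \<in> U then U else V) ` (U \<union> V)"
    unfolding connected_components_of_def top(1) using comp by (intro image_cong) auto
  have ip: "ideal_points (semicircle z w) = {Some z, Some w}"
    using zw(1) by (rule ideal_points_semicircle)
  have Uz: "Some x \<in> U \<longleftrightarrow> x \<in> I" for x by (auto simp: U_def)
  let ?ex = "\<exists>W W'. W \<in> connected_components_of X \<and> W' \<in> connected_components_of X \<and> W \<noteq> W' \<and>
     ideal_points (semicircle z w) \<inter> W \<noteq> {} \<and> ideal_points (semicircle z w) \<inter> W' \<noteq> {}"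
  have "?ex \<longleftrightarrow> \<not> (z \<in> I \<longleftrightarrow> w \<in> I)"
  proof
    assume ?ex
    then obtain W W' where W: "W \<in> {U, V}" "W' \<in> {U, V}" "W \<noteq> W'"
      "{Some z, Some w} \<inter> W \<noteq> {}" "{Some z, Some w} \<inter> W' \<noteq> {}"
      unfolding comps ip by (auto split: if_splits)
    then have "{Some z, Some w} \<inter> U \<noteq> {}" "{Some z, Some w} \<inter> V \<noteq> {}" by auto
    then show "\<not> (z \<in> I \<longleftrightarrow> w \<in> I)" using UV mem Uz by blast
  next
    assume ne: "\<not> (z \<in> I \<longleftrightarrow> w \<in> I)"
    then have "{Some z, Some w} \<inter> U \<noteq> {}" "{Some z, Some w} \<inter> V \<noteq> {}"
      using Uz mem by auto
    moreover from this have "U \<in> connected_components_of X" "V \<in> connected_components_of X" "U \<noteq> V"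
      using UV unfolding comps by (auto simp: image_iff)
    ultimately show ?ex unfolding ip by blast
  qed
  then show ?thesis unfolding lambda2_def X_def by auto
qed

section \<open>Closed curves of class \<open>C\<^sup>2\<close>\<close>

definition nrm :: "real \<Rightarrow> real^2" where "nrm \<phi> = pt (cos \<phi>) (sin \<phi>)"
definition dir :: "real \<Rightarrow> real^2" where "dir \<phi> = pt (- sin \<phi>) (cos \<phi>)"

lemma inner_plane: "x \<bullet> y = x $ 1 * y $ 1 + x $ 2 * y $ 2" for x y :: "real^2"
  by (simp add: inner_vec_def sum_2)

lemma eq_plane: "x = y \<longleftrightarrow> x $ 1 = y $ 1 \<and> x $ 2 = y $ 2" for x y :: "real^2"
  by (simp add: vec_eq_iff forall_2)

lemma norm_frame [simp]: "norm (nrm \<phi>) = 1" "norm (dir \<phi>) = 1"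
  by (simp_all add: norm_eq_sqrt_inner inner_plane nrm_def dir_def flip: power2_eq_square)

lemma line_pt_frame: "line_pt \<phi> p s = p *\<^sub>R nrm \<phi> + s *\<^sub>R dir \<phi>"
  by (simp add: line_pt_def eq_plane nrm_def dir_def)

lemma inner_line_pt [simp]: "nrm \<phi> \<bullet> line_pt \<phi> p s = p" "dir \<phi> \<bullet> line_pt \<phi> p s = s"
proof -
  have "nrm \<phi> \<bullet> line_pt \<phi> p s = p * (cos \<phi> * cos \<phi> + sin \<phi> * sin \<phi>)"
    "dir \<phi> \<bullet> line_pt \<phi> p s = s * (cos \<phi> * cos \<phi> + sin \<phi> * sin \<phi>)"
    unfolding line_pt_def inner_plane nrm_def dir_def pt_nth by (simp_all only: algebra_simps)
  then show "nrm \<phi> \<bullet> line_pt \<phi> p s = p" "dir \<phi> \<bullet> line_pt \<phi> p s = s"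
    by (simp_all only: sin_cos_squared_add3 mult_1_right)
qed

lemma line_pt_inner: "line_pt \<phi> (nrm \<phi> \<bullet> x) (dir \<phi> \<bullet> x) = x"
proof -
  have "line_pt \<phi> (nrm \<phi> \<bullet> x) (dir \<phi> \<bullet> x) $ i = x $ i * (cos \<phi> * cos \<phi> + sin \<phi> * sin \<phi>)" if "i = 1 \<or> i = 2" for i
    using that
  proof
    assume i: "i = 1"
    show ?thesis unfolding i line_pt_def inner_plane nrm_def dir_def pt_nth by algebra
  next
    assume i: "i = 2"
    show ?thesis unfolding i line_pt_def inner_plane nrm_def dir_def pt_nth by algebra
  qed
  then show ?thesis unfolding eq_plane by (simp only: sin_cos_squared_add3 mult_1_right simp_thms)
qed

lemma line_pt_diff: "line_pt \<phi> p t - line_pt \<phi> p s = (t - s) *\<^sub>R dir \<phi>"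
  by (simp add: line_pt_frame scaleR_diff_left)

lemma norm_line_pt_diff [simp]: "norm (line_pt \<phi> p t - line_pt \<phi> p s) = \<bar>t - s\<bar>"
  by (simp add: line_pt_diff)

lemma line_pt_eq_iff [simp]: "line_pt \<phi> p s = line_pt \<phi> p t \<longleftrightarrow> s = t"
  by (metis inner_line_pt(2))

lemma normal_line_eq: "normal_line p \<phi> = range (line_pt \<phi> p)"
proof (intro equalityI subsetI)
  fix x assume "x \<in> normal_line p \<phi>"
  then have "nrm \<phi> \<bullet> x = p" by (simp add: normal_line_def inner_plane nrm_def mult.commute)
  then show "x \<in> range (line_pt \<phi> p)" using line_pt_inner[of \<phi> x] by (metis rangeI)
next
  fix x assume "x \<in> range (line_pt \<phi> p)"
  then have "nrm \<phi> \<bullet> x = p" by auto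
  then show "x \<in> normal_line p \<phi>" by (simp add: normal_line_def inner_plane nrm_def mult.commute)
qed

lemma inner_MVT:
  fixes f :: "real \<Rightarrow> 'a::real_inner"
  assumes f: "\<And>t. (f has_vector_derivative f' t) (at t)"
  obtains \<xi> where "min u v \<le> \<xi>" "\<xi> \<le> max u v" "c \<bullet> f u - c \<bullet> f v = (u - v) * (c \<bullet> f' \<xi>)"
proof -
  have D: "((\<lambda>t. c \<bullet> f t) has_real_derivative c \<bullet> f' t) (at t)" for t
    unfolding has_real_derivative_iff_has_vector_derivative
    using f by (rule bounded_linear.has_vector_derivative[OF bounded_linear_inner_right])
  show ?thesis
  proof (cases u v rule: linorder_cases)
    case less
    from MVT2[OF less D] obtain z where "u < z" "z < v" "c \<bullet> f v - c \<bullet> f u = (v - u) * (c \<bullet> f' z)" by auto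
    then show ?thesis using less by (intro that[of z]) (auto simp: algebra_simps)
  next
    case equal
    then show ?thesis by (intro that[of u]) auto
  next
    case greater
    from MVT2[OF greater D] obtain z where "v < z" "z < u" "c \<bullet> f u - c \<bullet> f v = (u - v) * (c \<bullet> f' z)" by auto
    then show ?thesis using greater by (intro that[of z]) auto
  qed
qed

locale C2_loop =
  fixes \<gamma> \<gamma>' \<gamma>'' :: "real \<Rightarrow> real^2"
  assumes simple: "simple_path \<gamma>"
    and periodic: "\<gamma> (t + 1) = \<gamma> t"
    and deriv: "(\<gamma> has_vector_derivative \<gamma>' t) (at t)"
    and deriv2: "(\<gamma>' has_vector_derivative \<gamma>'' t) (at t)"
    and cont2: "continuous_on UNIV \<gamma>''"
    and regular: "\<gamma>' t \<noteq> 0"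
begin

abbreviation C where "C \<equiv> path_image \<gamma>"

lemma cont: "continuous_on A \<gamma>"
  by (meson continuous_at_imp_continuous_on deriv has_vector_derivative_continuous)

lemma cont1: "continuous_on A \<gamma>'"
  by (meson continuous_at_imp_continuous_on deriv2 has_vector_derivative_continuous)

lemma periodic_nat: "\<gamma> (t + real n) = \<gamma> t"
proof (induction n)
  case (Suc n)
  then show ?case using periodic[of "t + real n"] by (simp add: add.assoc add.commute[of 1])
qed simp

lemma periodic_int: "\<gamma> (t + of_int k) = \<gamma> t"
proof (cases "0 \<le> k")
  case True
  then show ?thesis using periodic_nat[of t "nat k"] by simp
next
  case False
  then show ?thesis using periodic_nat[of "t + of_int k" "nat (- k)"] by simp
qed

lemma frac_eq: "\<gamma> (frac t) = \<gamma> t"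
  using periodic_int[of t "- \<lfloor>t\<rfloor>"] by (simp add: frac_def)

lemma inj_Ico: "inj_on \<gamma> {0..<1}"
  using simple unfolding simple_path_def loop_free_def inj_on_def by fastforce

lemma eq_imp_int: "\<gamma> s = \<gamma> t \<Longrightarrow> \<exists>k. s = t + of_int k"
proof -
  assume "\<gamma> s = \<gamma> t"
  then have "\<gamma> (frac s) = \<gamma> (frac t)" by (simp add: frac_eq)
  then have "frac s = frac t"
    using inj_Ico by (auto simp: inj_on_def frac_lt_1)
  then have "s = t + of_int (\<lfloor>s\<rfloor> - \<lfloor>t\<rfloor>)" by (simp add: frac_def)
  then show ?thesis by blast
qed

lemma range_eq: "range \<gamma> = C"
proof (intro equalityI subsetI)
  fix x assume "x \<in> range \<gamma>"
  then obtain t where "x = \<gamma> (frac t)" by (auto simp: frac_eq)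
  then show "x \<in> C" by (auto simp: path_image_def frac_lt_1 less_imp_le intro!: imageI)
qed (auto simp: path_image_def)

lemma image_Ico: "\<gamma> ` {0..<1} = C"
proof (intro equalityI subsetI)
  fix x assume "x \<in> C"
  then obtain t where "x = \<gamma> (frac t)" by (auto simp: frac_eq path_image_def)
  then show "x \<in> \<gamma> ` {0..<1}" by (auto simp: frac_lt_1)
qed (auto simp: path_image_def)

lemma near_param:
  obtains s' where "\<gamma> s' = \<gamma> s" "\<bar>s' - t\<bar> \<le> 1 / 2"
proof (rule that)
  show "\<gamma> (s + of_int (- round (s - t))) = \<gamma> s" by (rule periodic_int)
  show "\<bar>s + of_int (- round (s - t)) - t\<bar> \<le> 1 / 2"
    using of_int_round_abs_le[of "s - t"] by (simp add: abs_minus_commute algebra_simps)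
qed

lemma pathfinish_eq_pathstart: "pathfinish \<gamma> = pathstart \<gamma>"
  using periodic[of 0] by (simp add: pathfinish_def pathstart_def)


lemma second_deriv_bound:
  obtains M where "M > 0" "\<And>u. u \<in> {-1..2} \<Longrightarrow> norm (\<gamma>'' u) \<le> M"
proof -
  have "compact (\<gamma>'' ` {-1..2})"
    by (intro compact_continuous_image continuous_on_subset[OF cont2]) auto
  then have "bounded (\<gamma>'' ` {-1..2})" by (rule compact_imp_bounded)
  then obtain M where "M > 0" "\<forall>x\<in>\<gamma>'' ` {-1..2}. norm x \<le> M"
    unfolding bounded_pos by blast
  then show ?thesis by (intro that[of M]) auto
qed

lemma bilipschitz:
  obtains c where "c > 0" "\<And>t s. t \<in> {0..1} \<Longrightarrow> \<bar>s - t\<bar> \<le> 1 / 2 \<Longrightarrow> c * \<bar>s - t\<bar> \<le> norm (\<gamma> s - \<gamma> t)"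
proof -
  obtain M where M: "M > 0" "\<And>u. u \<in> {-1..2} \<Longrightarrow> norm (\<gamma>'' u) \<le> M"
    using second_deriv_bound by blast
  obtain m where m: "m > 0" "\<And>u. u \<in> {0..1} \<Longrightarrow> m \<le> norm (\<gamma>' u)"
  proof -
    obtain u0 where "u0 \<in> {0..1::real}" "\<forall>u\<in>{0..1}. norm (\<gamma>' u0) \<le> norm (\<gamma>' u)"
      using continuous_attains_inf[of "{0..1}" "\<lambda>u. norm (\<gamma>' u)"] continuous_on_norm[OF cont1[of "{0..1}"]] by auto
    then show ?thesis using that[of "norm (\<gamma>' u0)"] regular by auto
  qed
  define \<delta> where "\<delta> = m / (2 * M)"
  have \<delta>: "\<delta> > 0" using M m by (simp add: \<delta>_def)
  have near: "m / 2 * \<bar>s - t\<bar> \<le> norm (\<gamma> s - \<gamma> t)"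
    if t: "t \<in> {0..1}" and s: "\<bar>s - t\<bar> \<le> 1 / 2" "\<bar>s - t\<bar> \<le> \<delta>" for s t
  proof -
    define w where "w = \<gamma>' t"
    have w: "norm w > 0" "m \<le> norm w" using regular m(2)[OF t] by (auto simp: w_def)
    obtain \<xi> where \<xi>: "min s t \<le> \<xi>" "\<xi> \<le> max s t" "w \<bullet> \<gamma> s - w \<bullet> \<gamma> t = (s - t) * (w \<bullet> \<gamma>' \<xi>)"
      using inner_MVT[OF deriv] by metis
    obtain \<zeta> where \<zeta>: "min \<xi> t \<le> \<zeta>" "\<zeta> \<le> max \<xi> t" "w \<bullet> \<gamma>' \<xi> - w \<bullet> \<gamma>' t = (\<xi> - t) * (w \<bullet> \<gamma>'' \<zeta>)"
      using inner_MVT[OF deriv2] by metis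
    have "\<zeta> \<in> {-1..2}" using \<xi> \<zeta> s t by (auto simp: min_def max_def abs_le_iff split: if_splits)
    then have "\<bar>w \<bullet> \<gamma>'' \<zeta>\<bar> \<le> norm w * M"
      by (meson Cauchy_Schwarz_ineq2 M(2) mult_left_mono norm_ge_zero order_trans)
    moreover have "\<bar>\<xi> - t\<bar> \<le> \<delta>" using \<xi> s by (auto simp: min_def max_def abs_le_iff split: if_splits)
    ultimately have "\<bar>(\<xi> - t) * (w \<bullet> \<gamma>'' \<zeta>)\<bar> \<le> \<delta> * (norm w * M)"
      unfolding abs_mult using \<delta> by (intro mult_mono) auto
    also have "\<dots> = norm w * (m / 2)" using M by (simp add: \<delta>_def)
    also have "\<dots> \<le> norm w * (norm w / 2)" using w by (intro mult_left_mono) auto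
    finally have "w \<bullet> \<gamma>' \<xi> \<ge> w \<bullet> w - norm w * (norm w / 2)" using \<zeta>(3) by (simp add: w_def abs_le_iff)
    then have "w \<bullet> \<gamma>' \<xi> \<ge> norm w * (norm w / 2)" by (simp add: dot_square_norm power2_eq_square)
    then have "\<bar>s - t\<bar> * (norm w * (norm w / 2)) \<le> \<bar>w \<bullet> (\<gamma> s - \<gamma> t)\<bar>"
      unfolding inner_diff_right \<xi>(3) abs_mult by (intro mult_left_mono) auto
    also have "\<dots> \<le> norm w * norm (\<gamma> s - \<gamma> t)" by (rule Cauchy_Schwarz_ineq2)
    finally have "norm w * (\<bar>s - t\<bar> * (norm w / 2)) \<le> norm w * norm (\<gamma> s - \<gamma> t)" by (simp add: mult_ac)
    then have "\<bar>s - t\<bar> * (norm w / 2) \<le> norm (\<gamma> s - \<gamma> t)" using w(1) mult_le_cancel_left_pos by blast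
    moreover have "m / 2 * \<bar>s - t\<bar> \<le> \<bar>s - t\<bar> * (norm w / 2)"
      using mult_right_mono[OF w(2), of "\<bar>s - t\<bar> / 2"] by (simp add: mult_ac)
    ultimately show ?thesis by linarith
  qed
  obtain m2 where m2: "m2 > 0"
    "\<And>s t. t \<in> {0..1} \<Longrightarrow> \<delta> \<le> \<bar>s - t\<bar> \<Longrightarrow> \<bar>s - t\<bar> \<le> 1 / 2 \<Longrightarrow> m2 \<le> norm (\<gamma> s - \<gamma> t)"
  proof -
    define S where "S = {(t, s). t \<in> {0..1} \<and> s \<in> {-1..2} \<and> \<delta> \<le> \<bar>s - t\<bar> \<and> \<bar>s - t\<bar> \<le> 1 / 2}"
    have "S = ({0..1} \<times> {-1..2}) \<inter> {x. \<delta> \<le> \<bar>snd x - fst x\<bar>} \<inter> {x. \<bar>snd x - fst x\<bar> \<le> 1 / 2}"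
      by (auto simp: S_def)
    moreover have "closed {x. \<delta> \<le> \<bar>snd x - fst x\<bar>}" "closed {x. \<bar>snd x - fst x\<bar> \<le> (1::real) / 2}"
      by (intro closed_Collect_le continuous_intros)+
    moreover have "compact ({0..1::real} \<times> {-1..2::real})" by (intro compact_Times) simp_all
    ultimately have S: "compact S" by (simp only: compact_Int_closed)
    have c: "continuous_on S (\<lambda>x. norm (\<gamma> (snd x) - \<gamma> (fst x)))"
      by (intro continuous_intros continuous_on_compose2[OF cont[of UNIV]]) auto
    have pos: "0 < norm (\<gamma> s - \<gamma> t)" if st: "(t, s) \<in> S" for s t
    proof -
      have "\<gamma> s \<noteq> \<gamma> t"
      proof
        assume "\<gamma> s = \<gamma> t"
        then obtain k where "s = t + of_int k" using eq_imp_int by blast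
        then have "\<bar>real_of_int k\<bar> \<le> 1 / 2" "k \<noteq> 0" using st \<delta> by (auto simp: S_def)
        then have "\<bar>real_of_int k\<bar> < 1" "1 \<le> \<bar>k\<bar>" by auto
        then show False by linarith
      qed
      then show ?thesis by simp
    qed
    have inS: "(t, s) \<in> S" if "t \<in> {0..1}" "\<delta> \<le> \<bar>s - t\<bar>" "\<bar>s - t\<bar> \<le> 1 / 2" for s t
    proof -
      have "- 1 \<le> s" "s \<le> 2" using that(1,3) unfolding atLeastAtMost_iff by linarith+
      then show ?thesis using that by (simp add: S_def)
    qed
    show ?thesis
    proof (cases "S = {}")
      case True
      then show ?thesis using inS by (intro that[of 1]) auto
    next
      case False
      from continuous_attains_inf[OF S False c] obtain x0 where x0: "x0 \<in> S"
        "\<And>x. x \<in> S \<Longrightarrow> norm (\<gamma> (snd x0) - \<gamma> (fst x0)) \<le> norm (\<gamma> (snd x) - \<gamma> (fst x))" by blast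
      show ?thesis
      proof (rule that[of "norm (\<gamma> (snd x0) - \<gamma> (fst x0))"])
        show "0 < norm (\<gamma> (snd x0) - \<gamma> (fst x0))"
          by (rule pos) (use x0(1) in simp)
        fix s t :: real assume "t \<in> {0..1}" "\<delta> \<le> \<bar>s - t\<bar>" "\<bar>s - t\<bar> \<le> 1 / 2"
        from x0(2)[OF inS[OF this]] show "norm (\<gamma> (snd x0) - \<gamma> (fst x0)) \<le> norm (\<gamma> s - \<gamma> t)" by simp
      qed
    qed
  qed
  show ?thesis
  proof (rule that[of "min (m / 2) m2"])
    show "min (m / 2) m2 > 0" using m m2 by simp
    fix t s :: real assume t: "t \<in> {0..1}" and s: "\<bar>s - t\<bar> \<le> 1 / 2"
    show "min (m / 2) m2 * \<bar>s - t\<bar> \<le> norm (\<gamma> s - \<gamma> t)"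
    proof (cases "\<bar>s - t\<bar> \<le> \<delta>")
      case True
      have "min (m / 2) m2 * \<bar>s - t\<bar> \<le> m / 2 * \<bar>s - t\<bar>" by (intro mult_right_mono) auto
      then show ?thesis using near[OF t s True] by linarith
    next
      case False
      have "min (m / 2) m2 * \<bar>s - t\<bar> \<le> m2 * 1" using s m2(1) m by (intro mult_mono) auto
      then show ?thesis using m2(2)[OF t _ s] False by simp
    qed
  qed
qed

text \<open>By Rolle, the tangent is parallel to the chord at some parameter \<open>\<xi>\<close> between \<open>t\<close> and \<open>s\<close>; the bound is then the Lipschitz bound for \<open>\<gamma>'\<close> between \<open>t\<close> and \<open>\<xi>\<close>.\<close>

lemma chord_angle_bound:
  obtains K where "K > 0" "\<And>\<phi> p t s a b. t \<in> {0..1} \<Longrightarrow> \<gamma> t = line_pt \<phi> p a \<Longrightarrow> \<gamma> s = line_pt \<phi> p b \<Longrightarrow> a \<noteq> b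
    \<Longrightarrow> \<bar>nrm \<phi> \<bullet> \<gamma>' t\<bar> \<le> K * \<bar>a - b\<bar>"
proof -
  obtain M where M: "M > 0" "\<And>u. u \<in> {-1..2} \<Longrightarrow> norm (\<gamma>'' u) \<le> M"
    using second_deriv_bound by blast
  obtain c where c: "c > 0" "\<And>t s. t \<in> {0..1} \<Longrightarrow> \<bar>s - t\<bar> \<le> 1 / 2 \<Longrightarrow> c * \<bar>s - t\<bar> \<le> norm (\<gamma> s - \<gamma> t)"
    using bilipschitz by blast
  show ?thesis
  proof (rule that[of "M / c"])
    show "M / c > 0" using M c by simp
    fix \<phi> p t s a b
    assume t: "t \<in> {0..1}" "\<gamma> t = line_pt \<phi> p a" and s0: "\<gamma> s = line_pt \<phi> p b" and ab: "a \<noteq> b"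
    obtain s' where "\<gamma> s' = \<gamma> s" and s'2: "\<bar>s' - t\<bar> \<le> 1 / 2"
      by (rule near_param)
    with s0 have s'1: "\<gamma> s' = line_pt \<phi> p b" by simp
    note s' = s'1 s'2
    have ne: "s' \<noteq> t" using t s' ab by auto
    obtain \<xi> where \<xi>: "min s' t \<le> \<xi>" "\<xi> \<le> max s' t" "nrm \<phi> \<bullet> \<gamma> s' - nrm \<phi> \<bullet> \<gamma> t = (s' - t) * (nrm \<phi> \<bullet> \<gamma>' \<xi>)"
      using inner_MVT[OF deriv] by metis
    then have z: "nrm \<phi> \<bullet> \<gamma>' \<xi> = 0" using t s' ne by simp
    obtain \<zeta> where \<zeta>: "min \<xi> t \<le> \<zeta>" "\<zeta> \<le> max \<xi> t" "nrm \<phi> \<bullet> \<gamma>' \<xi> - nrm \<phi> \<bullet> \<gamma>' t = (\<xi> - t) * (nrm \<phi> \<bullet> \<gamma>'' \<zeta>)"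
      using inner_MVT[OF deriv2] by metis
    have "\<zeta> \<in> {-1..2}" using \<xi> \<zeta> s' t by (auto simp: min_def max_def abs_le_iff split: if_splits)
    then have "\<bar>nrm \<phi> \<bullet> \<gamma>'' \<zeta>\<bar> \<le> M"
      using Cauchy_Schwarz_ineq2[of "nrm \<phi>" "\<gamma>'' \<zeta>"] M(2)[of \<zeta>] by simp
    moreover have "\<bar>\<xi> - t\<bar> \<le> \<bar>s' - t\<bar>" using \<xi> by (auto simp: min_def max_def split: if_splits)
    ultimately have "\<bar>(\<xi> - t) * (nrm \<phi> \<bullet> \<gamma>'' \<zeta>)\<bar> \<le> \<bar>s' - t\<bar> * M"
      unfolding abs_mult by (intro mult_mono) auto
    then have "\<bar>nrm \<phi> \<bullet> \<gamma>' t\<bar> \<le> \<bar>s' - t\<bar> * M" using \<zeta>(3) z by simp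
    also have "\<dots> \<le> M / c * \<bar>a - b\<bar>"
    proof -
      have "c * \<bar>s' - t\<bar> \<le> \<bar>a - b\<bar>" using c(2)[OF t(1) s'(2)] unfolding t(2) s'(1) norm_line_pt_diff by linarith
      then have "\<bar>s' - t\<bar> \<le> \<bar>a - b\<bar> / c" using c(1) by (simp add: pos_le_divide_eq mult.commute)
      then show ?thesis using M(1) mult_left_mono[of "\<bar>s' - t\<bar>" "\<bar>a - b\<bar> / c" M] by (simp add: mult_ac)
    qed
    finally show "\<bar>nrm \<phi> \<bullet> \<gamma>' t\<bar> \<le> M / c * \<bar>a - b\<bar>" .
  qed
qed


section \<open>Almost every line is transverse\<close>

lemma borel_measurable_inner_curve [measurable (raw)]:
  assumes "f \<in> borel_measurable M" "g \<in> borel_measurable M"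
  shows "(\<lambda>x. f x \<bullet> \<gamma> (g x)) \<in> borel_measurable M"
  using assms(1) measurable_compose[OF assms(2) borel_measurable_continuous_onI[OF cont]]
  by (rule borel_measurable_inner)

text \<open>
  A one-dimensional coarea inequality by Fatou's lemma: as \<open>\<epsilon> = 1 / (k + 1)\<close> tends to \<open>0\<close>, the
  length of \<open>{t. \<bar>c \<bullet> \<gamma> t - p\<bar> < \<epsilon>}\<close> divided by \<open>2 \<epsilon>\<close> is asymptotically at least the sum of
  \<open>1 / \<bar>c \<bullet> \<gamma>' t\<bar>\<close> over the zeros of \<open>c \<bullet> \<gamma> t - p\<close>, and infinite at a degenerate
  zero. This takes the place of Sard's theorem. The interval \<open>[-1, 2]\<close> contains a neighbourhood
  of every zero in the period \<open>[0, 1]\<close>.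
\<close>

definition hits_at :: "nat \<Rightarrow> real^2 \<Rightarrow> real \<Rightarrow> ennreal" where
  "hits_at k c p = (\<integral>\<^sup>+t. indicator {-1..2} t * indicator {..<1 / real (Suc k)} \<bar>c \<bullet> \<gamma> t - p\<bar> * ennreal (real (Suc k) / 2) \<partial>lborel)"

definition hits :: "real^2 \<Rightarrow> real \<Rightarrow> ennreal" where
  "hits c p = liminf (\<lambda>k. hits_at k c p)"

lemma borel_measurable_hits_at [measurable (raw)]:
  assumes [measurable]: "f \<in> borel_measurable M" "g \<in> borel_measurable M"
  shows "(\<lambda>x. hits_at k (f x) (g x)) \<in> borel_measurable M"
  unfolding hits_at_def by measurable

lemma borel_measurable_hits [measurable (raw)]:
  assumes [measurable]: "f \<in> borel_measurable M" "g \<in> borel_measurable M"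
  shows "(\<lambda>x. hits (f x) (g x)) \<in> borel_measurable M"
  unfolding hits_def by measurable

lemma hits_uminus: "hits (- c) (- p) = hits c p"
  unfolding hits_def hits_at_def by (simp add: abs_minus_commute)

lemma nn_integral_hits: "(\<integral>\<^sup>+p. hits c p \<partial>lborel) \<le> 3"
proof -
  have "(\<integral>\<^sup>+p. hits_at k c p \<partial>lborel) = 3" for k
  proof -
    have "(\<integral>\<^sup>+p. hits_at k c p \<partial>lborel) =
      (\<integral>\<^sup>+t. \<integral>\<^sup>+p. indicator {-1..2} t * indicator {..<1 / real (Suc k)} \<bar>c \<bullet> \<gamma> t - p\<bar> * ennreal (real (Suc k) / 2) \<partial>lborel \<partial>lborel)"
      unfolding hits_at_def by (rule lborel_pair.Fubini') measurable
    also have "\<dots> = (\<integral>\<^sup>+t. indicator {-1..2::real} t * 1 \<partial>lborel)"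
    proof (rule nn_integral_cong)
      fix t
      let ?e = "1 / real (Suc k)"
      have "(\<integral>\<^sup>+p. indicator {-1..2} t * indicator {..<?e} \<bar>c \<bullet> \<gamma> t - p\<bar> * ennreal (real (Suc k) / 2) \<partial>lborel) =
        (\<integral>\<^sup>+p. (indicator {-1..2} t * ennreal (real (Suc k) / 2)) * indicator {c \<bullet> \<gamma> t - ?e<..<c \<bullet> \<gamma> t + ?e} p \<partial>lborel)"
        by (intro nn_integral_cong) (auto split: split_indicator simp del: of_nat_Suc)
      also have "\<dots> = indicator {-1..2} t * ennreal (real (Suc k) / 2) * ennreal (2 * ?e)"
        by (subst nn_integral_cmult_indicator) (auto simp del: of_nat_Suc)
      also have "\<dots> = indicator {-1..2} t * (ennreal (real (Suc k) / 2) * ennreal (2 * ?e))"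
        by (simp only: mult.assoc)
      also have "ennreal (real (Suc k) / 2) * ennreal (2 * ?e) = 1"
        by (subst ennreal_mult[symmetric]) (auto simp del: of_nat_Suc)
      finally show "(\<integral>\<^sup>+p. indicator {-1..2} t * indicator {..<?e} \<bar>c \<bullet> \<gamma> t - p\<bar> * ennreal (real (Suc k) / 2) \<partial>lborel) =
          indicator {-1..2} t * 1" .
    qed
    also have "\<dots> = 3" by simp
    finally show ?thesis .
  qed
  then have "liminf (\<lambda>k. \<integral>\<^sup>+p. hits_at k c p \<partial>lborel) = 3" by (simp add: Liminf_const)
  then show ?thesis
    unfolding hits_def using nn_integral_liminf[of "\<lambda>k p. hits_at k c p" lborel] by auto
qed

lemma hits_ge:
  assumes T: "finite T" "T \<subseteq> {0..1}"
    and B: "\<And>t. t \<in> T \<Longrightarrow> c \<bullet> \<gamma> t = p \<and> \<bar>c \<bullet> \<gamma>' t\<bar> < B t"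
  shows "ennreal (\<Sum>t\<in>T. 1 / B t) \<le> hits c p"
proof -
  have Bpos: "B t > 0" if "t \<in> T" for t using B[OF that] abs_ge_zero[of "c \<bullet> \<gamma>' t"] by linarith
  have "\<exists>d>0. \<forall>s. \<bar>s - t\<bar> < d \<longrightarrow> \<bar>c \<bullet> \<gamma> s - p\<bar> \<le> B t * \<bar>s - t\<bar>" if t: "t \<in> T" for t
  proof -
    have "((\<lambda>t. c \<bullet> \<gamma> t) has_real_derivative c \<bullet> \<gamma>' t) (at t)"
      unfolding has_real_derivative_iff_has_vector_derivative
      using deriv by (rule bounded_linear.has_vector_derivative[OF bounded_linear_inner_right])
    then have "((\<lambda>s. (c \<bullet> \<gamma> s - c \<bullet> \<gamma> t) / (s - t)) \<longlongrightarrow> c \<bullet> \<gamma>' t) (at t)"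
      by (simp add: has_field_derivative_iff)
    then have "((\<lambda>s. \<bar>(c \<bullet> \<gamma> s - c \<bullet> \<gamma> t) / (s - t)\<bar>) \<longlongrightarrow> \<bar>c \<bullet> \<gamma>' t\<bar>) (at t)"
      by (rule tendsto_rabs)
    then have "eventually (\<lambda>s. \<bar>(c \<bullet> \<gamma> s - c \<bullet> \<gamma> t) / (s - t)\<bar> < B t) (at t)"
      using B[OF t] by (intro order_tendstoD(2)) auto
    then obtain d where d: "d > 0" "\<And>s. s \<noteq> t \<Longrightarrow> \<bar>s - t\<bar> < d \<Longrightarrow> \<bar>(c \<bullet> \<gamma> s - c \<bullet> \<gamma> t) / (s - t)\<bar> < B t"
      unfolding eventually_at dist_real_def by auto
    have "\<bar>c \<bullet> \<gamma> s - p\<bar> \<le> B t * \<bar>s - t\<bar>" if s: "\<bar>s - t\<bar> < d" for s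
    proof (cases "s = t")
      case False
      then have "\<bar>c \<bullet> \<gamma> s - c \<bullet> \<gamma> t\<bar> / \<bar>s - t\<bar> < B t" using d(2)[OF False s] by (simp only: abs_divide)
      then have "\<bar>c \<bullet> \<gamma> s - c \<bullet> \<gamma> t\<bar> < B t * \<bar>s - t\<bar>" using False by (simp add: pos_divide_less_eq)
      then show ?thesis using B[OF t] by simp
    qed (use B[OF t] in simp)
    then show ?thesis using d(1) by blast
  qed
  then obtain d where d: "\<And>t. t \<in> T \<Longrightarrow> d t > 0"
    "\<And>t s. t \<in> T \<Longrightarrow> \<bar>s - t\<bar> < d t \<Longrightarrow> \<bar>c \<bullet> \<gamma> s - p\<bar> \<le> B t * \<bar>s - t\<bar>" by metis
  have small: "eventually (\<lambda>k. 1 / real (Suc k) / B t < e) sequentially" if "t \<in> T" "e > 0" for t e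
  proof -
    have "(\<lambda>k. 1 / real (Suc k) / B t) \<longlonglongrightarrow> 0 / B t"
      using Bpos[OF that(1)] lim_inverse_n' by (intro tendsto_divide tendsto_const LIMSEQ_Suc) auto
    then show ?thesis using that(2) by (intro order_tendstoD(2)) auto
  qed
  have "eventually (\<lambda>k. \<forall>t\<in>T. 1 / real (Suc k) / B t < min (d t) 1) sequentially"
    using T(1) d(1) by (intro eventually_ball_finite ballI small) auto
  moreover have "eventually (\<lambda>k. \<forall>t\<in>T. \<forall>t'\<in>T - {t}. 1 / real (Suc k) / B t < \<bar>t - t'\<bar> / 2) sequentially"
    using T(1) by (intro eventually_ball_finite ballI small) auto
  ultimately have "eventually (\<lambda>k. ennreal (\<Sum>t\<in>T. 1 / B t) \<le> hits_at k c p) sequentially"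
  proof eventually_elim
    case (elim k)
    define e where "e = 1 / real (Suc k)"
    have e: "e > 0" by (simp add: e_def)
    define J where "J t = {t - e / B t<..<t + e / B t}" for t
    have J: "J t \<subseteq> {-1..2}" "J t \<subseteq> {s. \<bar>c \<bullet> \<gamma> s - p\<bar> < e}" if t: "t \<in> T" for t
    proof -
      have eB: "e / B t < d t" "e / B t < 1" using elim(1) t by (auto simp: e_def)
      then show "J t \<subseteq> {-1..2}" using t T by (force simp: J_def)
      show "J t \<subseteq> {s. \<bar>c \<bullet> \<gamma> s - p\<bar> < e}"
      proof clarify
        fix s assume "s \<in> J t"
        then have s: "\<bar>s - t\<bar> < e / B t" by (auto simp: J_def abs_less_iff)
        then have "\<bar>c \<bullet> \<gamma> s - p\<bar> \<le> B t * \<bar>s - t\<bar>" using eB d(2)[OF t] by auto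
        also have "\<dots> < B t * (e / B t)" using Bpos[OF t] s by (intro mult_strict_left_mono)
        also have "\<dots> = e" using Bpos[OF t] by simp
        finally show "\<bar>c \<bullet> \<gamma> s - p\<bar> < e" .
      qed
    qed
    have disj: "t = t'" if "t \<in> T" "t' \<in> T" "s \<in> J t" "s \<in> J t'" for t t' s
    proof (rule ccontr)
      assume ne: "t \<noteq> t'"
      have e2: "e / B t < \<bar>t - t'\<bar> / 2" "e / B t' < \<bar>t - t'\<bar> / 2"
        using bspec[OF bspec[OF elim(2) that(1)], of t'] bspec[OF bspec[OF elim(2) that(2)], of t] that(1,2) ne
        unfolding e_def abs_minus_commute[of t' t] by blast+
      have s: "\<bar>s - t\<bar> < e / B t" "\<bar>s - t'\<bar> < e / B t'"
        using that(3,4) by (auto simp: J_def abs_less_iff)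
      have "\<bar>t - t'\<bar> \<le> \<bar>s - t\<bar> + \<bar>s - t'\<bar>" by linarith
      also have "\<dots> < e / B t + e / B t'" using s by (rule add_strict_mono)
      also have "\<dots> < \<bar>t - t'\<bar> / 2 + \<bar>t - t'\<bar> / 2" using e2 by (rule add_strict_mono)
      finally show False by simp
    qed
    have "ennreal (\<Sum>t\<in>T. 1 / B t) = (\<Sum>t\<in>T. ennreal (1 / B t))"
      using Bpos by (intro sum_ennreal[symmetric]) (auto intro: less_imp_le)
    also have "\<dots> = (\<Sum>t\<in>T. \<integral>\<^sup>+s. ennreal (1 / e / 2) * indicator (J t) s \<partial>lborel)"
    proof (rule sum.cong[OF refl])
      fix t assume t: "t \<in> T"
      have "(\<integral>\<^sup>+s. ennreal (1 / e / 2) * indicator (J t) s \<partial>lborel) = ennreal (1 / e / 2) * ennreal (2 * (e / B t))"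
        using e Bpos[OF t] unfolding J_def by (subst nn_integral_cmult_indicator) auto
      also have "\<dots> = ennreal (1 / B t)"
        using e Bpos[OF t] by (subst ennreal_mult[symmetric]) auto
      finally show "ennreal (1 / B t) = (\<integral>\<^sup>+s. ennreal (1 / e / 2) * indicator (J t) s \<partial>lborel)" ..
    qed
    also have "\<dots> = (\<integral>\<^sup>+s. (\<Sum>t\<in>T. ennreal (1 / e / 2) * indicator (J t) s) \<partial>lborel)"
      by (subst nn_integral_sum) (auto simp: J_def)
    also have "\<dots> \<le> (\<integral>\<^sup>+s. indicator {-1..2} s * indicator {..<e} \<bar>c \<bullet> \<gamma> s - p\<bar> * ennreal (1 / e / 2) \<partial>lborel)"
    proof (rule nn_integral_mono)
      fix s
      show "(\<Sum>t\<in>T. ennreal (1 / e / 2) * indicator (J t) s) \<le> indicator {-1..2} s * indicator {..<e} \<bar>c \<bullet> \<gamma> s - p\<bar> * ennreal (1 / e / 2)"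
      proof (cases "\<exists>t\<in>T. s \<in> J t")
        case True
        then obtain t where t: "t \<in> T" "s \<in> J t" by blast
        then have "(\<Sum>t\<in>T. ennreal (1 / e / 2) * indicator (J t) s) = (\<Sum>t'\<in>{t}. ennreal (1 / e / 2) * indicator (J t') s)"
          using T(1) disj by (intro sum.mono_neutral_right) (auto simp: indicator_def)
        also have "\<dots> = ennreal (1 / e / 2)" using t by simp
        finally have "(\<Sum>t\<in>T. ennreal (1 / e / 2) * indicator (J t) s) = ennreal (1 / e / 2)" .
        moreover have "s \<in> {-1..2}" "\<bar>c \<bullet> \<gamma> s - p\<bar> \<in> {..<e}" using J[OF t(1)] t by blast+
        ultimately show ?thesis by simp
      next
        case False
        then have "(\<Sum>t\<in>T. ennreal (1 / e / 2) * indicator (J t) s) = 0"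
          by (intro sum.neutral) auto
        then show ?thesis by simp
      qed
    qed
    also have "\<dots> = hits_at k c p" by (simp add: hits_at_def e_def del: of_nat_Suc)
    finally show ?case .
  qed
  then show ?thesis unfolding hits_def by (intro Liminf_bounded)
qed

lemma
  assumes fin: "hits c p < \<infinity>"
  shows hits_transverse: "t \<in> {0..1} \<Longrightarrow> c \<bullet> \<gamma> t = p \<Longrightarrow> c \<bullet> \<gamma>' t \<noteq> 0"
    and hits_finite: "finite {t \<in> {0..1}. c \<bullet> \<gamma> t = p}"
    and hits_sum: "T \<subseteq> {0..1} \<Longrightarrow> finite T \<Longrightarrow> (\<And>t. t \<in> T \<Longrightarrow> c \<bullet> \<gamma> t = p) \<Longrightarrow> ennreal (\<Sum>t\<in>T. 1 / \<bar>c \<bullet> \<gamma>' t\<bar>) \<le> 2 * hits c p"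
proof -
  obtain h where h: "hits c p = ennreal h" "h \<ge> 0"
    using fin by (cases "hits c p") auto
  have tr: "c \<bullet> \<gamma>' t \<noteq> 0" if t: "t \<in> {0..1}" "c \<bullet> \<gamma> t = p" for t
  proof
    assume z: "c \<bullet> \<gamma>' t = 0"
    have "ennreal (\<Sum>t\<in>{t}. 1 / (1 / (h + 1))) \<le> hits c p"
      by (rule hits_ge) (use t z h in auto)
    then show False using h by simp
  qed
  then show "t \<in> {0..1} \<Longrightarrow> c \<bullet> \<gamma> t = p \<Longrightarrow> c \<bullet> \<gamma>' t \<noteq> 0" for t by blast
  have "bounded ((\<lambda>t. c \<bullet> \<gamma>' t) ` {0..1})"
    by (intro compact_imp_bounded compact_continuous_image continuous_intros cont1) simp
  then obtain B where B: "B > 0" "\<And>t. t \<in> {0..1} \<Longrightarrow> \<bar>c \<bullet> \<gamma>' t\<bar> \<le> B"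
    unfolding bounded_pos by auto
  show "finite {t \<in> {0..1}. c \<bullet> \<gamma> t = p}"
  proof (rule ccontr)
    assume inf: "infinite {t \<in> {0..1}. c \<bullet> \<gamma> t = p}"
    obtain n :: nat where n: "real n > h * (B + 1)" using reals_Archimedean2 by blast
    obtain T where T: "finite T" "card T = n" "T \<subseteq> {t \<in> {0..1}. c \<bullet> \<gamma> t = p}"
      using infinite_arbitrarily_large[OF inf] by blast
    have "ennreal (\<Sum>t\<in>T. 1 / (B + 1)) \<le> hits c p"
    proof (rule hits_ge[OF T(1)])
      show "c \<bullet> \<gamma> t = p \<and> \<bar>c \<bullet> \<gamma>' t\<bar> < B + 1" if "t \<in> T" for t
        using that T(3) B(2)[of t] by auto
    qed (use T in auto)
    then have "real n / (B + 1) \<le> h" using T h B(1) by (simp add: ennreal_le_iff)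
    then show False using n B(1) by (simp add: pos_divide_le_eq)
  qed
  show "ennreal (\<Sum>t\<in>T. 1 / \<bar>c \<bullet> \<gamma>' t\<bar>) \<le> 2 * hits c p"
    if T: "T \<subseteq> {0..1}" "finite T" "\<And>t. t \<in> T \<Longrightarrow> c \<bullet> \<gamma> t = p"
  proof -
    have "ennreal (\<Sum>t\<in>T. 1 / (2 * \<bar>c \<bullet> \<gamma>' t\<bar>)) \<le> hits c p"
    proof (rule hits_ge[OF T(2,1)])
      fix t assume "t \<in> T"
      then have "c \<bullet> \<gamma> t = p" "c \<bullet> \<gamma>' t \<noteq> 0" using T tr by auto
      then show "c \<bullet> \<gamma> t = p \<and> \<bar>c \<bullet> \<gamma>' t\<bar> < 2 * \<bar>c \<bullet> \<gamma>' t\<bar>" by simp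
    qed
    then have "2 * ennreal (\<Sum>t\<in>T. 1 / (2 * \<bar>c \<bullet> \<gamma>' t\<bar>)) \<le> 2 * hits c p" by (rule mult_left_mono) simp
    moreover have "2 * ennreal (\<Sum>t\<in>T. 1 / (2 * \<bar>c \<bullet> \<gamma>' t\<bar>)) = ennreal (2 * (\<Sum>t\<in>T. 1 / (2 * \<bar>c \<bullet> \<gamma>' t\<bar>)))"
      by (subst ennreal_mult) (auto intro: sum_nonneg)
    moreover have "2 * (\<Sum>t\<in>T. 1 / (2 * \<bar>c \<bullet> \<gamma>' t\<bar>)) = (\<Sum>t\<in>T. 1 / \<bar>c \<bullet> \<gamma>' t\<bar>)"
      by (simp add: sum_distrib_left)
    ultimately show ?thesis by simp
  qed
qed

end

section \<open>Parity of the crossings\<close>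

lemma connected_subset_cases:
  assumes "connected A" "open I" "open E" "I \<inter> E = {}" "A \<subseteq> I \<union> E"
  shows "A \<subseteq> I \<or> A \<subseteq> E"
  using connectedD[OF assms(1-3)] assms(4,5) by blast

lemma frame_decomp: "x = (nrm \<phi> \<bullet> x) *\<^sub>R nrm \<phi> + (dir \<phi> \<bullet> x) *\<^sub>R dir \<phi>"
  using line_pt_inner[of \<phi> x] by (simp add: line_pt_frame)

lemma nrm_dir: "nrm \<phi> \<bullet> dir \<phi> = 0"
  by (simp add: inner_plane nrm_def dir_def)

context C2_loop begin

text \<open>The sets \<open>{\<gamma> t + r v | \<bar>t - t0\<bar> < \<delta>, 0 < r < \<rho>}\<close> and the same with \<open>-\<rho> < r < 0\<close>, where \<open>v\<close> is the direction of the line, are connected, avoid the curve and, together with the curve, cover a neighbourhood of the crossing. Both components reach the crossing, so each of the two sets lies in a different one.\<close>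

lemma crossing_flip:
  assumes I: "open I" and E: "open E" and disj: "I \<inter> E = {}" and un: "I \<union> E = - C"
    and fr: "frontier I = C" "frontier E = C"
    and t0: "\<gamma> t0 = line_pt \<phi> p s0" and tr: "nrm \<phi> \<bullet> \<gamma>' t0 \<noteq> 0"
  obtains \<rho> where "\<rho> > 0" "\<And>r1 r2. 0 < r1 \<Longrightarrow> r1 < \<rho> \<Longrightarrow> 0 < r2 \<Longrightarrow> r2 < \<rho> \<Longrightarrow>
     line_pt \<phi> p (s0 - r1) \<in> I \<longleftrightarrow> line_pt \<phi> p (s0 + r2) \<notin> I"
proof -
  define n where "n = nrm \<phi>"
  define v where "v = dir \<phi>"
  have nv: "n \<bullet> v = 0" "norm n = 1" "norm v = 1" by (simp_all add: n_def v_def nrm_dir)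
  have decomp: "x = (n \<bullet> x) *\<^sub>R n + (v \<bullet> x) *\<^sub>R v" for x
    unfolding n_def v_def by (rule frame_decomp)
  have contn: "continuous_on A (\<lambda>t. n \<bullet> \<gamma> t)" for A by (intro continuous_intros cont)
  obtain \<delta>0 where \<delta>0: "\<delta>0 > 0" "\<delta>0 \<le> 1 / 4" "\<And>t. \<bar>t - t0\<bar> < \<delta>0 \<Longrightarrow> n \<bullet> \<gamma>' t \<noteq> 0"
  proof -
    have "continuous_on UNIV (\<lambda>t. n \<bullet> \<gamma>' t)" by (intro continuous_intros cont1)
    then have "open ((\<lambda>t. n \<bullet> \<gamma>' t) -` (- {0}))" by (intro open_vimage) auto
    moreover have "t0 \<in> (\<lambda>t. n \<bullet> \<gamma>' t) -` (- {0})" using tr by (simp add: n_def)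
    ultimately obtain e where e: "e > 0" "ball t0 e \<subseteq> (\<lambda>t. n \<bullet> \<gamma>' t) -` (- {0})"
      using openE by blast
    show ?thesis
    proof (rule that[of "min e (1 / 4)"])
      fix t assume "\<bar>t - t0\<bar> < min e (1 / 4)"
      then have "t \<in> ball t0 e" by (simp add: dist_real_def abs_minus_commute)
      then show "n \<bullet> \<gamma>' t \<noteq> 0" using e(2) by auto
    qed (use e(1) in auto)
  qed
  have inj: "s = t" if st: "\<bar>s - t0\<bar> < \<delta>0" "\<bar>t - t0\<bar> < \<delta>0" "n \<bullet> \<gamma> s = n \<bullet> \<gamma> t" for s t
  proof -
    obtain \<xi> where \<xi>: "min s t \<le> \<xi>" "\<xi> \<le> max s t" "n \<bullet> \<gamma> s - n \<bullet> \<gamma> t = (s - t) * (n \<bullet> \<gamma>' \<xi>)"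
      using inner_MVT[OF deriv] by metis
    have "\<bar>\<xi> - t0\<bar> < \<delta>0" using \<xi>(1,2) st by (auto simp: min_def max_def abs_less_iff split: if_splits)
    then show ?thesis using \<xi>(3) \<delta>0(3) st(3) by simp
  qed
  obtain d where d: "d > 0" "\<And>s. \<bar>s - t0\<bar> \<le> 1 / 2 \<Longrightarrow> \<delta>0 \<le> \<bar>s - t0\<bar> \<Longrightarrow> d \<le> norm (\<gamma> s - \<gamma> t0)"
  proof -
    let ?S = "{s. \<bar>s - t0\<bar> \<le> 1 / 2 \<and> \<delta>0 \<le> \<bar>s - t0\<bar>}"
    have "\<bar>s - t0\<bar> \<le> 1 / 2 \<longleftrightarrow> s \<in> {t0 - 1 / 2..t0 + 1 / 2}" for s
      unfolding atLeastAtMost_iff by linarith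
    then have eq: "?S = {t0 - 1 / 2..t0 + 1 / 2} \<inter> {s. \<delta>0 \<le> \<bar>s - t0\<bar>}" by blast
    have "closed {s. \<delta>0 \<le> \<bar>s - t0\<bar>}" by (intro closed_Collect_le continuous_intros)
    then have "compact ?S" unfolding eq by (intro compact_Int_closed) simp_all
    then have "compact (\<gamma> ` ?S)" by (intro compact_continuous_image cont)
    moreover have "\<gamma> t0 \<notin> \<gamma> ` ?S"
    proof
      assume "\<gamma> t0 \<in> \<gamma> ` ?S"
      then obtain s where s: "\<gamma> s = \<gamma> t0" "\<bar>s - t0\<bar> \<le> 1 / 2" "\<delta>0 \<le> \<bar>s - t0\<bar>" by auto
      then obtain k where k: "s = t0 + of_int k" using eq_imp_int by blast
      then have "\<bar>real_of_int k\<bar> < 1" "1 \<le> \<bar>k\<bar>" using s \<delta>0(1) by auto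
      then show False by linarith
    qed
    ultimately obtain d where "d > 0" "\<forall>y\<in>\<gamma> ` ?S. d \<le> dist (\<gamma> t0) y"
      using separate_point_closed[OF compact_imp_closed] by blast
    then show ?thesis by (intro that[of d]) (auto simp: dist_norm norm_minus_commute)
  qed
  define \<rho> where "\<rho> = d / 2"
  have \<rho>: "\<rho> > 0" using d by (simp add: \<rho>_def)
  obtain \<delta> where \<delta>: "\<delta> > 0" "\<delta> \<le> \<delta>0" "\<And>t. \<bar>t - t0\<bar> < \<delta> \<Longrightarrow> norm (\<gamma> t - \<gamma> t0) < \<rho> / 2"
  proof -
    have "isCont \<gamma> t0" using cont[of UNIV] by (simp add: continuous_on_eq_continuous_at)
    then obtain e where e: "e > 0" "\<And>t. dist t t0 < e \<Longrightarrow> dist (\<gamma> t) (\<gamma> t0) < \<rho> / 2"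
      unfolding continuous_at_eps_delta using \<rho> by (metis half_gt_zero)
    show ?thesis
      by (rule that[of "min e \<delta>0"]) (use e \<delta>0 in \<open>auto simp: dist_norm\<close>)
  qed
  have avoid: "r = 0" if tr: "\<bar>t - t0\<bar> < \<delta>" "\<bar>r\<bar> < \<rho>" and inC: "\<gamma> t + r *\<^sub>R v \<in> C" for t r
  proof -
    obtain s where "\<gamma> s = \<gamma> t + r *\<^sub>R v" using inC range_eq by (metis rangeE)
    then obtain s' where s': "\<gamma> s' = \<gamma> t + r *\<^sub>R v" "\<bar>s' - t0\<bar> \<le> 1 / 2"
      using near_param[of s t0] by metis
    have "norm (\<gamma> s' - \<gamma> t0) \<le> norm (\<gamma> t - \<gamma> t0) + \<bar>r\<bar>"
      using norm_triangle_ineq[of "\<gamma> t - \<gamma> t0" "r *\<^sub>R v"] nv s' by (simp add: algebra_simps)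
    also have "\<dots> < d" using \<delta>(3)[OF tr(1)] tr(2) \<rho> by (simp add: \<rho>_def)
    finally have "\<bar>s' - t0\<bar> < \<delta>0" using d(2)[OF s'(2)] by linarith
    moreover have "n \<bullet> \<gamma> s' = n \<bullet> \<gamma> t" using s'(1) nv by (simp add: inner_add_right)
    ultimately have "s' = t" using inj[of s' t] tr \<delta>(2) by auto
    then show ?thesis using s'(1) nv by auto
  qed
  define side where "side R = (\<lambda>(t, r). \<gamma> t + r *\<^sub>R v) ` ({t0 - \<delta><..<t0 + \<delta>} \<times> R)" for R
  have conn: "connected (side R)" if "connected R" for R
    unfolding side_def
  proof (rule connected_continuous_image)
    show "continuous_on ({t0 - \<delta><..<t0 + \<delta>} \<times> R) (\<lambda>(t, r). \<gamma> t + r *\<^sub>R v)"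
      unfolding case_prod_beta by (intro continuous_intros continuous_on_compose2[OF cont[of UNIV]]) auto
    show "connected ({t0 - \<delta><..<t0 + \<delta>} \<times> R)" using that by (intro connected_Times) auto
  qed
  let ?P = "side {0<..<\<rho>}" and ?N = "side {-\<rho><..<0}"
  have sub: "side R \<subseteq> I \<union> E" if R: "\<And>r. r \<in> R \<Longrightarrow> \<bar>r\<bar> < \<rho> \<and> r \<noteq> 0" for R
    unfolding un
  proof (rule subsetI, rule ComplI)
    fix x assume "x \<in> side R" "x \<in> C"
    then obtain t r where "t \<in> {t0 - \<delta><..<t0 + \<delta>}" "r \<in> R" "\<gamma> t + r *\<^sub>R v \<in> C" by (auto simp: side_def)
    then show False using avoid[of t r] R[of r] by (auto simp: abs_less_iff)
  qed
  have cases: "?P \<subseteq> I \<or> ?P \<subseteq> E" "?N \<subseteq> I \<or> ?N \<subseteq> E"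
    by (intro connected_subset_cases[OF conn I E disj] sub; auto)+
  obtain \<eta> where \<eta>: "\<eta> > 0" "\<And>a. \<bar>a - n \<bullet> \<gamma> t0\<bar> < \<eta> \<Longrightarrow> \<exists>t. \<bar>t - t0\<bar> < \<delta> \<and> n \<bullet> \<gamma> t = a"
  proof -
    have "open ((\<lambda>t. n \<bullet> \<gamma> t) ` {t0 - \<delta><..<t0 + \<delta>})"
    proof (rule invariance_of_domain[OF contn])
      show "inj_on (\<lambda>t. n \<bullet> \<gamma> t) {t0 - \<delta><..<t0 + \<delta>}"
        using inj \<delta>(2) by (auto simp: inj_on_def abs_less_iff)
    qed simp
    moreover have "n \<bullet> \<gamma> t0 \<in> (\<lambda>t. n \<bullet> \<gamma> t) ` {t0 - \<delta><..<t0 + \<delta>}" using \<delta>(1) by auto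
    ultimately obtain e where e: "e > 0" "ball (n \<bullet> \<gamma> t0) e \<subseteq> (\<lambda>t. n \<bullet> \<gamma> t) ` {t0 - \<delta><..<t0 + \<delta>}"
      using openE by blast
    show ?thesis
    proof (rule that[OF e(1)])
      fix a assume "\<bar>a - n \<bullet> \<gamma> t0\<bar> < e"
      then have "a \<in> ball (n \<bullet> \<gamma> t0) e" by (simp add: dist_real_def abs_minus_commute)
      then obtain t where "t \<in> {t0 - \<delta><..<t0 + \<delta>}" "n \<bullet> \<gamma> t = a" using e(2) by blast
      then show "\<exists>t. \<bar>t - t0\<bar> < \<delta> \<and> n \<bullet> \<gamma> t = a" by (intro exI[of _ t]) (auto simp: abs_less_iff)
    qed
  qed
  have nbhd: "x \<in> ?P \<union> ?N \<union> C" if x: "norm (x - \<gamma> t0) < min \<eta> (\<rho> / 2)" for x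
  proof -
    have "\<bar>n \<bullet> x - n \<bullet> \<gamma> t0\<bar> \<le> norm (x - \<gamma> t0)"
      using Cauchy_Schwarz_ineq2[of n "x - \<gamma> t0"] nv by (simp add: inner_diff_right)
    then obtain t where t: "\<bar>t - t0\<bar> < \<delta>" "n \<bullet> \<gamma> t = n \<bullet> x" using \<eta>(2)[of "n \<bullet> x"] x by auto
    define r where "r = v \<bullet> (x - \<gamma> t)"
    have "n \<bullet> (x - \<gamma> t) = 0" using t(2) by (simp add: inner_diff_right)
    then have "x - \<gamma> t = r *\<^sub>R v" using decomp[of "x - \<gamma> t"] unfolding r_def by (metis add_0 scaleR_zero_left)
    then have xr: "x = \<gamma> t + r *\<^sub>R v" by (simp add: algebra_simps)
    have "\<bar>r\<bar> \<le> norm (x - \<gamma> t)" using Cauchy_Schwarz_ineq2[of v "x - \<gamma> t"] nv by (simp add: r_def)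
    also have "\<dots> \<le> norm (x - \<gamma> t0) + norm (\<gamma> t - \<gamma> t0)"
      using norm_triangle_ineq4[of "x - \<gamma> t0" "\<gamma> t - \<gamma> t0"] by simp
    also have "\<dots> < \<rho>" using x \<delta>(3)[OF t(1)] by simp
    finally have r: "\<bar>r\<bar> < \<rho>" .
    have tJ: "t \<in> {t0 - \<delta><..<t0 + \<delta>}" using t(1) by (auto simp: abs_less_iff)
    consider "r = 0" | "r \<in> {0<..<\<rho>}" | "r \<in> {-\<rho><..<0}" using r by fastforce
    then show ?thesis
    proof cases
      case 1
      then show ?thesis using xr range_eq by auto
    next
      case 2
      then have "x \<in> side {0<..<\<rho>}"
        unfolding side_def using tJ by (intro image_eqI[of _ _ "(t, r)"]) (auto simp: xr)
      then show ?thesis by blast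
    next
      case 3
      then have "x \<in> side {-\<rho><..<0}"
        unfolding side_def using tJ by (intro image_eqI[of _ _ "(t, r)"]) (auto simp: xr)
      then show ?thesis by blast
    qed
  qed
  have meets: "(?P \<union> ?N) \<inter> A \<noteq> {}" if "frontier A = C" "A \<inter> C = {}" for A
  proof -
    have "\<gamma> t0 \<in> closure A" using that(1) range_eq by (auto simp: frontier_def)
    then obtain x where "x \<in> A" "dist x (\<gamma> t0) < min \<eta> (\<rho> / 2)"
      unfolding closure_approachable using \<eta>(1) \<rho> by (metis half_gt_zero min_less_iff_conj)
    then show ?thesis using nbhd[of x] that(2) by (auto simp: dist_norm)
  qed
  have "I \<inter> C = {}" "E \<inter> C = {}" using un by auto
  then have m: "(?P \<union> ?N) \<inter> I \<noteq> {}" "(?P \<union> ?N) \<inter> E \<noteq> {}" using meets fr by blast+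
  have opp: "?P \<subseteq> I \<and> ?N \<subseteq> E \<or> ?P \<subseteq> E \<and> ?N \<subseteq> I"
    using cases m disj by blast
  show ?thesis
  proof (rule that[OF \<rho>])
    fix r1 r2 assume r: "0 < r1" "r1 < \<rho>" "0 < r2" "r2 < \<rho>"
    have lp: "line_pt \<phi> p (s0 + r) = \<gamma> t0 + r *\<^sub>R v" for r
      by (simp add: t0 line_pt_frame v_def scaleR_add_left)
    have t0J: "t0 \<in> {t0 - \<delta><..<t0 + \<delta>}" using \<delta>(1) by simp
    have "line_pt \<phi> p (s0 + r2) \<in> ?P"
      unfolding lp side_def using t0J r by (intro image_eqI[of _ _ "(t0, r2)"]) auto
    moreover have "line_pt \<phi> p (s0 + - r1) \<in> ?N"
      unfolding lp side_def using t0J r by (intro image_eqI[of _ _ "(t0, - r1)"]) auto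
    ultimately show "line_pt \<phi> p (s0 - r1) \<in> I \<longleftrightarrow> line_pt \<phi> p (s0 + r2) \<notin> I"
      using opp disj by auto
  qed
qed

lemma crossing_parity:
  assumes I: "open I" and E: "open E" and disj: "I \<inter> E = {}" and un: "I \<union> E = - C"
    and fr: "frontier I = C" "frontier E = C"
    and tr: "\<And>t s. t \<in> {0..1} \<Longrightarrow> \<gamma> t = line_pt \<phi> p s \<Longrightarrow> nrm \<phi> \<bullet> \<gamma>' t \<noteq> 0"
    and fin: "finite {s. line_pt \<phi> p s \<in> C}"
    and ab: "a < b" "line_pt \<phi> p a \<notin> C" "line_pt \<phi> p b \<notin> C"
  shows "(line_pt \<phi> p a \<in> I \<longleftrightarrow> line_pt \<phi> p b \<in> I) \<longleftrightarrow> even (card ({s. line_pt \<phi> p s \<in> C} \<inter> {a<..<b}))"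
  using ab
proof (induction "card ({s. line_pt \<phi> p s \<in> C} \<inter> {a<..<b})" arbitrary: a)
  case 0
  let ?A = "{s. line_pt \<phi> p s \<in> C}"
  have "?A \<inter> {a<..<b} = {}" using 0(1) fin by simp
  then have "line_pt \<phi> p ` {a..b} \<subseteq> - C"
    using 0(3,4) by (auto simp: disjoint_iff less_eq_real_def)
  moreover have "connected (line_pt \<phi> p ` {a..b})"
    unfolding line_pt_frame by (intro connected_continuous_image continuous_intros) auto
  ultimately have "line_pt \<phi> p ` {a..b} \<subseteq> I \<or> line_pt \<phi> p ` {a..b} \<subseteq> E"
    using connected_subset_cases[OF _ I E disj] un by metis
  moreover have "a \<in> {a..b}" "b \<in> {a..b}" using 0(2) by auto
  ultimately have "line_pt \<phi> p a \<in> I \<longleftrightarrow> line_pt \<phi> p b \<in> I" using disj by blast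
  then show ?case using 0(1) by simp
next
  case (Suc m)
  let ?A = "{s. line_pt \<phi> p s \<in> C}"
  have finA: "finite (?A \<inter> {a<..<b})" using fin by simp
  have ne: "?A \<inter> {a<..<b} \<noteq> {}" using Suc(2) by auto
  define c where "c = Min (?A \<inter> {a<..<b})"
  have c: "c \<in> ?A" "a < c" "c < b" using Min_in[OF finA ne] by (auto simp: c_def)
  have cmin: "s \<notin> ?A" if "a < s" "s < c" for s
  proof
    assume "s \<in> ?A"
    then have "c \<le> s" using that c finA unfolding c_def by (intro Min_le) auto
    then show False using that by simp
  qed
  obtain t0 where t0: "t0 \<in> {0..1}" "\<gamma> t0 = line_pt \<phi> p c"
    using c(1) unfolding path_image_def mem_Collect_eq by (metis imageE)
  obtain \<rho> where \<rho>: "\<rho> > 0" "\<And>r1 r2. 0 < r1 \<Longrightarrow> r1 < \<rho> \<Longrightarrow> 0 < r2 \<Longrightarrow> r2 < \<rho> \<Longrightarrow>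
     line_pt \<phi> p (c - r1) \<in> I \<longleftrightarrow> line_pt \<phi> p (c + r2) \<notin> I"
    using crossing_flip[OF I E disj un fr t0(2) tr[OF t0]] by blast
  obtain r where r: "0 < r" "r < \<rho>" "r < c - a" "r < b - c" "\<And>s. c < s \<Longrightarrow> s \<le> c + r \<Longrightarrow> s \<notin> ?A"
  proof -
    have "finite (?A - {c})" using fin by simp
    then obtain e where e: "e > 0" "\<forall>x\<in>?A - {c}. e \<le> dist c x"
      using finite_set_avoid[of "?A - {c}" c] by auto
    define q where "q = min (min e \<rho>) (min (c - a) (b - c))"
    have q: "0 < q" "q \<le> e" "q \<le> \<rho>" "q \<le> c - a" "q \<le> b - c" using e \<rho> c by (auto simp: q_def)
    show ?thesis
    proof (rule that[of "q / 2"])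
      show "0 < q / 2" "q / 2 < \<rho>" "q / 2 < c - a" "q / 2 < b - c" using q by linarith+
      fix s assume "c < s" "s \<le> c + q / 2"
      moreover have "q / 2 < e" using q by linarith
      ultimately show "s \<notin> ?A" using e(2) by (force simp: dist_real_def)
    qed
  qed
  have "(line_pt \<phi> p a \<in> I \<longleftrightarrow> line_pt \<phi> p (c - r) \<in> I)"
  proof -
    have "line_pt \<phi> p ` {a..c - r} \<subseteq> - C"
      using Suc(4) cmin r(1) by (auto simp: less_eq_real_def)
    moreover have "connected (line_pt \<phi> p ` {a..c - r})"
      unfolding line_pt_frame by (intro connected_continuous_image continuous_intros) auto
    ultimately have "line_pt \<phi> p ` {a..c - r} \<subseteq> I \<or> line_pt \<phi> p ` {a..c - r} \<subseteq> E"
      using connected_subset_cases[OF _ I E disj] un by metis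
    moreover have "a \<in> {a..c - r}" "c - r \<in> {a..c - r}" using r by auto
    ultimately show ?thesis using disj by blast
  qed
  also have "\<dots> \<longleftrightarrow> line_pt \<phi> p (c + r) \<notin> I" using \<rho>(2)[of r r] r by simp
  finally have flip: "line_pt \<phi> p a \<in> I \<longleftrightarrow> line_pt \<phi> p (c + r) \<notin> I" .
  have "?A \<inter> {a<..<b} = insert c (?A \<inter> {c + r<..<b})"
  proof (intro equalityI subsetI)
    fix s assume s: "s \<in> ?A \<inter> {a<..<b}"
    then have "\<not> s < c" "\<not> (c < s \<and> s \<le> c + r)" using cmin[of s] r(5)[of s] by auto
    then show "s \<in> insert c (?A \<inter> {c + r<..<b})" using s by auto
  next
    fix s assume "s \<in> insert c (?A \<inter> {c + r<..<b})"
    then show "s \<in> ?A \<inter> {a<..<b}" using c r(1) by auto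
  qed
  then have card: "card (?A \<inter> {a<..<b}) = Suc (card (?A \<inter> {c + r<..<b}))"
    using fin r(1) by simp
  have "(line_pt \<phi> p (c + r) \<in> I \<longleftrightarrow> line_pt \<phi> p b \<in> I) \<longleftrightarrow> even (card (?A \<inter> {c + r<..<b}))"
  proof (rule Suc(1))
    show "m = card (?A \<inter> {c + r<..<b})" using Suc(2) card by simp
    show "c + r < b" using r by simp
    show "line_pt \<phi> p (c + r) \<notin> C" using r(5)[of "c + r"] r(1) by simp
    show "line_pt \<phi> p b \<notin> C" by fact
  qed
  then show ?case using flip card by auto
qed

end

section \<open>The excess of crossings as a Borel function\<close>

definition interior_pt :: "real^2 \<Rightarrow> real^2 \<Rightarrow> real \<Rightarrow> real^2" where
  "interior_pt z w r = (1 - r) *\<^sub>R z + r *\<^sub>R w"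

lemma open_segment_eq_interior_pt: "z \<noteq> w \<Longrightarrow> open_segment z w = interior_pt z w ` {0<..<1}"
  by (auto simp: in_segment interior_pt_def)

lemma sum_indicator_eq_card_Collect:
  "(\<Sum>j<N. indicator (M j) q) = card {j \<in> {..<N}. q \<in> M j}" for M :: "nat \<Rightarrow> 'z set"
  by (simp add: indicator_def of_bool_def sum.If_cases Int_def)

context C2_loop begin

definition meets :: "real \<Rightarrow> real \<Rightarrow> ((real^2) \<times> (real^2)) set" where
  "meets a b = {(z, w). \<exists>t\<in>{a..<b}. \<gamma> t \<in> interior_pt z w ` {0<..<1}}"

lemma meets_borel [measurable]: "meets a b \<in> sets borel"
proof -
  define T where "T = {(x :: real \<times> real, q :: (real^2) \<times> (real^2)). \<gamma> (fst x) = interior_pt (fst q) (snd q) (snd x)}"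
  have "closed T"
  proof -
    have "T = {y. \<gamma> (fst (fst y)) = interior_pt (fst (snd y)) (snd (snd y)) (snd (fst y))}"
      by (auto simp: T_def)
    then show ?thesis
      unfolding interior_pt_def
      by (auto intro!: closed_Collect_eq continuous_intros continuous_on_compose2[OF cont[of UNIV]])
  qed
  define D where "D m = {q. \<exists>x. x \<in> {a..b - 1 / real (Suc m)} \<times> {1 / real (Suc m)..1 - 1 / real (Suc m)} \<and> (x, q) \<in> T}" for m
  have cl: "closed (D m)" for m
    unfolding D_def by (rule closed_compact_projection[OF _ \<open>closed T\<close>]) (auto intro: compact_Times)
  have "meets a b = (\<Union>m. D m)"
  proof (intro equalityI subsetI)
    fix q assume "q \<in> meets a b"
    then obtain t r where tr: "a \<le> t" "t < b" "0 < r" "r < 1" "\<gamma> t = interior_pt (fst q) (snd q) r"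
      by (auto simp: meets_def)
    obtain m where "1 / real (Suc m) < min (b - t) (min r (1 - r))"
      using tr reals_Archimedean[of "min (b - t) (min r (1 - r))"] unfolding inverse_eq_divide by auto
    then have "q \<in> D m" using tr unfolding D_def T_def by (intro CollectI exI[of _ "(t, r)"]) auto
    then show "q \<in> (\<Union>m. D m)" by blast
  next
    fix q assume "q \<in> (\<Union>m. D m)"
    then obtain m t r where tr: "a \<le> t" "t \<le> b - 1 / real (Suc m)" "1 / real (Suc m) \<le> r" "r \<le> 1 - 1 / real (Suc m)"
      "\<gamma> t = interior_pt (fst q) (snd q) r"
      unfolding D_def T_def by auto
    moreover have "0 < 1 / real (Suc m)" by simp
    ultimately have "t < b" "0 < r" "r < 1" by linarith+
    with tr show "q \<in> meets a b" by (auto simp: meets_def intro!: bexI[of _ t])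
  qed
  then show ?thesis using cl by (auto intro: borel_closed)
qed

definition cell_count :: "nat \<Rightarrow> (real^2) \<times> (real^2) \<Rightarrow> nat" where
  "cell_count k q = (\<Sum>j<Suc k. indicator (meets (real j / real (Suc k)) (real (Suc j) / real (Suc k))) q)"

text \<open>Defined as a limit only to make it Borel without exceptional sets. It has its meaning for segments that cross the curve finitely often.\<close>

definition excess :: "(real^2) \<times> (real^2) \<Rightarrow> ennreal" where
  "excess q = liminf (\<lambda>k. ennreal (real (2 * (cell_count k q div 2))))"

lemma excess_borel [measurable]: "excess \<in> borel_measurable borel"
proof -
  have [measurable]: "cell_count k \<in> borel_measurable borel" for k
    unfolding cell_count_def by measurable
  have "(\<lambda>n::nat. ennreal (real (2 * (n div 2)))) \<in> borel_measurable borel"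
    by (rule borel_measurable_continuous_onI) simp
  then have [measurable]: "(\<lambda>q. ennreal (real (2 * (cell_count k q div 2)))) \<in> borel_measurable borel" for k
    by (rule measurable_compose[rotated]) measurable
  show ?thesis unfolding excess_def by measurable
qed

lemma excess_eq:
  assumes zw: "z \<noteq> w" and fin: "finite (open_segment z w \<inter> C)"
  shows "excess (z, w) = ennreal (real (2 * (card (open_segment z w \<inter> C) div 2)))"
proof -
  define S where "S = {t \<in> {0..<1}. \<gamma> t \<in> open_segment z w}"
  have inj: "inj_on \<gamma> S" using inj_Ico by (rule inj_on_subset) (auto simp: S_def)
  have img: "\<gamma> ` S = open_segment z w \<inter> C" unfolding image_Ico[symmetric] S_def by auto
  have finS: "finite S" using fin inj img finite_image_iff by metis
  have cardS: "card S = card (open_segment z w \<inter> C)" using card_image[OF inj] img by simp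
  obtain e where e: "e > 0" "\<And>t t'. t \<in> S \<Longrightarrow> t' \<in> S \<Longrightarrow> t \<noteq> t' \<Longrightarrow> e \<le> \<bar>t - t'\<bar>"
  proof -
    have "\<exists>e>0. \<forall>t'\<in>S. t' \<noteq> t \<longrightarrow> e \<le> dist t t'" for t
      using finite_set_avoid[OF finS] by metis
    then obtain g where g: "\<And>t. g t > 0" "\<And>t t'. t' \<in> S \<Longrightarrow> t' \<noteq> t \<Longrightarrow> g t \<le> dist t t'" by metis
    show ?thesis
    proof (rule that[of "Min (insert 1 (g ` S))"])
      show "Min (insert 1 (g ` S)) > 0" using g finS by simp
      fix t t' assume t: "t \<in> S" "t' \<in> S" "t \<noteq> t'"
      then have "Min (insert 1 (g ` S)) \<le> g t" using finS by (intro Min_le) auto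
      also have "\<dots> \<le> \<bar>t - t'\<bar>" using g(2)[OF t(2), of t] t by (simp add: dist_real_def)
      finally show "Min (insert 1 (g ` S)) \<le> \<bar>t - t'\<bar>" .
    qed
  qed
  have "eventually (\<lambda>k. cell_count k (z, w) = card S) sequentially"
  proof -
    have "eventually (\<lambda>k. 1 / real (Suc k) < e) sequentially"
      using lim_inverse_n' e by (intro order_tendstoD(2) LIMSEQ_Suc) auto
    then show ?thesis
    proof eventually_elim
      case (elim k)
      define n where "n = real (Suc k)"
      have n: "n > 0" by (simp add: n_def)
      define cell where "cell t = nat \<lfloor>n * t\<rfloor>" for t
      have cell: "cell t = j \<longleftrightarrow> real j / n \<le> t \<and> t < real (Suc j) / n" if "0 \<le> t" for t j
      proof -
        have "cell t = j \<longleftrightarrow> \<lfloor>n * t\<rfloor> = int j" using that n by (auto simp: cell_def)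
        also have "\<dots> \<longleftrightarrow> real j \<le> n * t \<and> n * t < real j + 1" by (simp add: floor_eq_iff)
        also have "\<dots> \<longleftrightarrow> real j / n \<le> t \<and> t < real (Suc j) / n"
          using n by (simp add: pos_divide_le_eq pos_less_divide_eq mult.commute add.commute)
        finally show ?thesis .
      qed
      have inj_cell: "inj_on cell S"
      proof (rule inj_onI)
        fix t t' assume t: "t \<in> S" "t' \<in> S" and eq: "cell t = cell t'"
        then have "0 \<le> t" "0 \<le> t'" by (auto simp: S_def)
        from cell[OF this(1), of "cell t"] cell[OF this(2), of "cell t"] eq
        have "real (cell t) / n \<le> t" "t < real (cell t) / n + 1 / n"
          "real (cell t) / n \<le> t'" "t' < real (cell t) / n + 1 / n"
          by (simp_all add: add_divide_distrib)
        then have "\<bar>t - t'\<bar> < 1 / n" by linarith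
        also have "\<dots> < e" using elim by (simp add: n_def)
        finally show "t = t'" using e(2)[OF t] by fastforce
      qed
      have "cell_count k (z, w) = card {j \<in> {..<Suc k}. (z, w) \<in> meets (real j / n) (real (Suc j) / n)}"
        unfolding cell_count_def n_def[symmetric] by (rule sum_indicator_eq_card_Collect)
      also have "{j \<in> {..<Suc k}. (z, w) \<in> meets (real j / n) (real (Suc j) / n)} = cell ` S"
      proof (intro equalityI subsetI)
        fix j assume "j \<in> {j \<in> {..<Suc k}. (z, w) \<in> meets (real j / n) (real (Suc j) / n)}"
        then obtain t where t: "j < Suc k" "real j / n \<le> t" "t < real (Suc j) / n" "\<gamma> t \<in> open_segment z w"
          by (auto simp: meets_def open_segment_eq_interior_pt[OF zw])
        have "0 \<le> real j / n" using n by simp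
        then have t0: "0 \<le> t" using t(2) by linarith
        have "real (Suc j) / n \<le> 1" using t(1) n by (simp add: n_def)
        then have "t \<in> S" using t t0 by (simp add: S_def)
        moreover have "cell t = j" using cell[OF t0] t by simp
        ultimately show "j \<in> cell ` S" by blast
      next
        fix j assume "j \<in> cell ` S"
        then obtain t where t: "t \<in> S" "j = cell t" by blast
        then have t': "0 \<le> t" "t < 1" "\<gamma> t \<in> open_segment z w" by (auto simp: S_def)
        with cell[OF t'(1), of j] t have j: "real j / n \<le> t" "t < real (Suc j) / n" by auto
        have "real j < n" using j(1) t'(2) n by (simp add: pos_divide_le_eq) (metis less_le_trans mult.commute mult_less_cancel_left2 not_le order.strict_trans1)
        then have "j < Suc k" by (simp add: n_def)
        then show "j \<in> {j \<in> {..<Suc k}. (z, w) \<in> meets (real j / n) (real (Suc j) / n)}"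
          using j t' by (auto simp: meets_def open_segment_eq_interior_pt[OF zw] intro!: bexI[of _ t])
      qed
      finally show ?case using card_image[OF inj_cell] by simp
    qed
  qed
  then have "eventually (\<lambda>k. ennreal (real (2 * (cell_count k (z, w) div 2))) = ennreal (real (2 * (card S div 2)))) sequentially"
    by eventually_elim simp
  then have "excess (z, w) = liminf (\<lambda>k::nat. ennreal (real (2 * (card S div 2))))"
    unfolding excess_def by (rule Liminf_eq)
  then show ?thesis by (simp add: Liminf_const cardS)
qed

end

section \<open>The contribution of a single line\<close>

lemma line_pt_convex: "(1 - u) *\<^sub>R line_pt \<phi> p s + u *\<^sub>R line_pt \<phi> p t = line_pt \<phi> p ((1 - u) * s + u * t)"
  by (simp add: line_pt_frame algebra_simps)

lemma closed_segment_line_pt: "closed_segment (line_pt \<phi> p s) (line_pt \<phi> p t) = line_pt \<phi> p ` {min s t..max s t}"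
proof -
  have "closed_segment (line_pt \<phi> p s) (line_pt \<phi> p t) = line_pt \<phi> p ` closed_segment s t"
    unfolding closed_segment_def line_pt_convex by (auto simp: image_iff)
  then show ?thesis by (simp add: closed_segment_eq_real_ivl min_def max_def)
qed

lemma open_segment_line_pt: "open_segment (line_pt \<phi> p s) (line_pt \<phi> p t) = line_pt \<phi> p ` {min s t<..<max s t}"
  unfolding open_segment_def closed_segment_line_pt by (auto simp: min_def max_def less_le split: if_splits)

context C2_loop begin

definition crossings :: "real \<Rightarrow> real \<Rightarrow> real set" where
  "crossings \<phi> p = {s. line_pt \<phi> p s \<in> C}"

definition line_excess :: "real \<Rightarrow> real \<Rightarrow> ennreal" where
  "line_excess \<phi> p = (\<integral>\<^sup>+s. \<integral>\<^sup>+t. ennreal (1 / \<bar>t - s\<bar> ^ 3) * excess (line_pt \<phi> p s, line_pt \<phi> p t) \<partial>lborel \<partial>lborel)"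

lemma excess_line_pt_measurable [measurable (raw)]:
  assumes [measurable]: "f \<in> borel_measurable M" "g \<in> borel_measurable M" "h \<in> borel_measurable M" "k \<in> borel_measurable M"
  shows "(\<lambda>x. excess (line_pt (f x) (g x) (h x), line_pt (f x) (g x) (k x))) \<in> borel_measurable M"
proof -
  have "(\<lambda>x. (line_pt (f x) (g x) (h x), line_pt (f x) (g x) (k x))) \<in> measurable M (borel \<Otimes>\<^sub>M borel)"
    by measurable
  then show ?thesis using excess_borel unfolding borel_prod by (rule measurable_compose)
qed

lemma line_excess_measurable [measurable (raw)]:
  assumes [measurable]: "f \<in> borel_measurable M" "g \<in> borel_measurable M"
  shows "(\<lambda>x. line_excess (f x) (g x)) \<in> borel_measurable M"
  unfolding line_excess_def by measurable

lemma crossings_eq: "crossings \<phi> p = (\<lambda>t. dir \<phi> \<bullet> \<gamma> t) ` {t \<in> {0..<1}. nrm \<phi> \<bullet> \<gamma> t = p}"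
proof (intro equalityI subsetI)
  fix s assume "s \<in> crossings \<phi> p"
  then obtain t where t: "t \<in> {0..<1}" "\<gamma> t = line_pt \<phi> p s"
    unfolding crossings_def image_Ico[symmetric] by force
  then show "s \<in> (\<lambda>t. dir \<phi> \<bullet> \<gamma> t) ` {t \<in> {0..<1}. nrm \<phi> \<bullet> \<gamma> t = p}"
    by (intro image_eqI[of _ _ t]) auto
next
  fix s assume "s \<in> (\<lambda>t. dir \<phi> \<bullet> \<gamma> t) ` {t \<in> {0..<1}. nrm \<phi> \<bullet> \<gamma> t = p}"
  then obtain t where "t \<in> {0..<1}" "nrm \<phi> \<bullet> \<gamma> t = p" "s = dir \<phi> \<bullet> \<gamma> t" by blast
  then have "line_pt \<phi> p s = \<gamma> t" using line_pt_inner by metis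
  then show "s \<in> crossings \<phi> p" using range_eq by (auto simp: crossings_def)
qed

lemma finite_crossings: "hits (nrm \<phi>) p < \<infinity> \<Longrightarrow> finite (crossings \<phi> p)"
  unfolding crossings_eq using hits_finite[of "nrm \<phi>" p]
  by (intro finite_imageI) (rule finite_subset, auto)

lemma segment_crossings:
  "closed_segment (line_pt \<phi> p s) (line_pt \<phi> p t) \<inter> C = line_pt \<phi> p ` (crossings \<phi> p \<inter> {min s t..max s t})"
  "open_segment (line_pt \<phi> p s) (line_pt \<phi> p t) \<inter> C = line_pt \<phi> p ` (crossings \<phi> p \<inter> {min s t<..<max s t})"
  unfolding closed_segment_line_pt open_segment_line_pt crossings_def by auto

lemma card_line_pt_image: "card (line_pt \<phi> p ` X) = card X"
  by (rule card_image) (auto simp: inj_on_def)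

lemma excess_line_pt:
  assumes "finite (crossings \<phi> p)" "s \<noteq> t"
  shows "excess (line_pt \<phi> p s, line_pt \<phi> p t) = ennreal (real (even_part (crossings \<phi> p) s t))"
  using assms by (subst excess_eq) (auto simp: segment_crossings card_line_pt_image even_part_def)

lemma line_excess_eq_even_part:
  assumes "finite (crossings \<phi> p)"
  shows "line_excess \<phi> p = (\<integral>\<^sup>+(s, t). ennreal (1 / \<bar>t - s\<bar> ^ 3) * ennreal (real (even_part (crossings \<phi> p) s t)) \<partial>lborel)"
proof -
  have "line_excess \<phi> p = (\<integral>\<^sup>+x. (case x of (s, t) \<Rightarrow> ennreal (1 / \<bar>t - s\<bar> ^ 3) * excess (line_pt \<phi> p s, line_pt \<phi> p t)) \<partial>(lborel \<Otimes>\<^sub>M lborel))"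
    unfolding line_excess_def by (subst lborel.nn_integral_fst[symmetric]) auto
  also have "\<dots> = (\<integral>\<^sup>+(s, t). ennreal (1 / \<bar>t - s\<bar> ^ 3) * ennreal (real (even_part (crossings \<phi> p) s t)) \<partial>lborel)"
    unfolding lborel_prod
  proof (rule nn_integral_cong, clarify)
    fix s t
    show "ennreal (1 / \<bar>t - s\<bar> ^ 3) * excess (line_pt \<phi> p s, line_pt \<phi> p t) =
      ennreal (1 / \<bar>t - s\<bar> ^ 3) * ennreal (real (even_part (crossings \<phi> p) s t))"
      by (cases "s = t") (simp_all add: excess_line_pt[OF assms])
  qed
  finally show ?thesis .
qed

definition chord_sum :: "(real^2) set \<Rightarrow> real" where
  "chord_sum L = (\<Sum>(x, y) \<in> {(x, y). x \<in> L \<inter> C \<and> y \<in> L \<inter> C \<and> x \<noteq> y}.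
     (-1) ^ card (closed_segment x y \<inter> C) / norm (y - x))"

lemma normal_line_inter_curve: "normal_line p \<phi> \<inter> C = line_pt \<phi> p ` crossings \<phi> p"
  unfolding normal_line_eq crossings_def by auto

lemma
  assumes fin: "finite (crossings \<phi> p)"
  shows line_excess_eq_chord_sum: "line_excess \<phi> p = ennreal (chord_sum (normal_line p \<phi>))"
    and chord_sum_nonneg: "0 \<le> chord_sum (normal_line p \<phi>)"
proof -
  let ?A = "crossings \<phi> p" and ?l = "line_pt \<phi> p"
  have eq: "{(x, y). x \<in> ?l ` ?A \<and> y \<in> ?l ` ?A \<and> x \<noteq> y} = map_prod ?l ?l ` {(a, b). a \<in> ?A \<and> b \<in> ?A \<and> a \<noteq> b}"
    by force
  have "inj_on (map_prod ?l ?l) {(a, b). a \<in> ?A \<and> b \<in> ?A \<and> a \<noteq> b}"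
    by (auto simp: inj_on_def)
  then have "chord_sum (normal_line p \<phi>) =
    (\<Sum>(a, b)\<in>{(a, b). a \<in> ?A \<and> b \<in> ?A \<and> a \<noteq> b}. (-1) ^ card (?A \<inter> {min a b..max a b}) / \<bar>b - a\<bar>)"
    unfolding chord_sum_def normal_line_inter_curve eq
    by (subst sum.reindex) (auto intro!: sum.cong simp: segment_crossings card_line_pt_image)
  then show "line_excess \<phi> p = ennreal (chord_sum (normal_line p \<phi>))" "0 \<le> chord_sum (normal_line p \<phi>)"
    unfolding line_excess_eq_even_part[OF fin] nn_integral_even_part[OF fin]
    using alternating_chord_sum_nonneg[OF fin] by simp_all
qed

lemma line_excess_le_hits:
  obtains K where "K \<ge> 0" "\<And>\<phi> p. hits (nrm \<phi>) p < \<infinity> \<Longrightarrow> line_excess \<phi> p \<le> ennreal K * hits (nrm \<phi>) p"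
proof -
  obtain K where K: "K > 0" "\<And>\<phi> p t s a b. t \<in> {0..1} \<Longrightarrow> \<gamma> t = line_pt \<phi> p a \<Longrightarrow> \<gamma> s = line_pt \<phi> p b \<Longrightarrow> a \<noteq> b
    \<Longrightarrow> \<bar>nrm \<phi> \<bullet> \<gamma>' t\<bar> \<le> K * \<bar>a - b\<bar>"
    using chord_angle_bound by blast
  show ?thesis
  proof (rule that[of "4 * K"])
    fix \<phi> p assume h: "hits (nrm \<phi>) p < \<infinity>"
    let ?A = "crossings \<phi> p"
    define T where "T = {t \<in> {0..<1}. nrm \<phi> \<bullet> \<gamma> t = p}"
    define \<tau> where "\<tau> = (\<lambda>a. SOME t. t \<in> T \<and> dir \<phi> \<bullet> \<gamma> t = a)"
    have fin: "finite ?A" using h by (rule finite_crossings)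
    have \<tau>: "\<tau> a \<in> T" "dir \<phi> \<bullet> \<gamma> (\<tau> a) = a" if "a \<in> ?A" for a
    proof -
      have "\<exists>t. t \<in> T \<and> dir \<phi> \<bullet> \<gamma> t = a" using that unfolding crossings_eq T_def by blast
      then have "\<tau> a \<in> T \<and> dir \<phi> \<bullet> \<gamma> (\<tau> a) = a" unfolding \<tau>_def by (rule someI_ex)
      then show "\<tau> a \<in> T" "dir \<phi> \<bullet> \<gamma> (\<tau> a) = a" by auto
    qed
    have inj: "inj_on \<tau> ?A" by (rule inj_on_inverseI[of _ "\<lambda>t. dir \<phi> \<bullet> \<gamma> t"]) (rule \<tau>)
    have g\<tau>: "\<gamma> (\<tau> a) = line_pt \<phi> p a" "\<tau> a \<in> {0..1}" if "a \<in> ?A" for a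
    proof -
      have "nrm \<phi> \<bullet> \<gamma> (\<tau> a) = p" "\<tau> a \<in> {0..1}" using \<tau>(1)[OF that] by (auto simp: T_def)
      then show "\<gamma> (\<tau> a) = line_pt \<phi> p a" "\<tau> a \<in> {0..1}" using line_pt_inner[of \<phi> "\<gamma> (\<tau> a)"] \<tau>(2)[OF that] by simp_all
    qed
    have gap: "1 / (next_in ?A a - a) \<le> K * (1 / \<bar>nrm \<phi> \<bullet> \<gamma>' (\<tau> a)\<bar>)" if a: "a \<in> ?A - {Max ?A}" for a
    proof -
      have "Max ?A \<in> {b \<in> ?A. a < b}" using a fin by (auto intro: Max_in simp: less_le)
      then have "next_in ?A a \<in> {b \<in> ?A. a < b}" unfolding next_in_def using fin by (intro Min_in) auto
      then have nx: "next_in ?A a \<in> ?A" "a < next_in ?A a" by auto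
      have "\<bar>nrm \<phi> \<bullet> \<gamma>' (\<tau> a)\<bar> \<le> K * \<bar>a - next_in ?A a\<bar>"
        using K(2)[OF g\<tau>(2)[of a] g\<tau>(1)[of a] g\<tau>(1)[OF nx(1)]] a nx(2) by auto
      moreover have "nrm \<phi> \<bullet> \<gamma>' (\<tau> a) \<noteq> 0"
        using hits_transverse[OF h g\<tau>(2)] a \<tau>(1)[of a] by (auto simp: T_def)
      ultimately show ?thesis using nx(2) by (simp add: divide_simps)
    qed
    have "line_excess \<phi> p \<le> ennreal (2 * (\<Sum>a\<in>?A - {Max ?A}. 1 / (next_in ?A a - a)))"
      unfolding line_excess_eq_even_part[OF fin] by (rule nn_integral_even_part_le[OF fin])
    also have "\<dots> \<le> ennreal (2 * (\<Sum>a\<in>?A. K * (1 / \<bar>nrm \<phi> \<bullet> \<gamma>' (\<tau> a)\<bar>)))"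
    proof (intro ennreal_leI mult_left_mono)
      have "(\<Sum>a\<in>?A - {Max ?A}. 1 / (next_in ?A a - a)) \<le> (\<Sum>a\<in>?A - {Max ?A}. K * (1 / \<bar>nrm \<phi> \<bullet> \<gamma>' (\<tau> a)\<bar>))"
        by (rule sum_mono) (rule gap)
      also have "\<dots> \<le> (\<Sum>a\<in>?A. K * (1 / \<bar>nrm \<phi> \<bullet> \<gamma>' (\<tau> a)\<bar>))"
        by (rule sum_mono2) (use fin K(1) in auto)
      finally show "(\<Sum>a\<in>?A - {Max ?A}. 1 / (next_in ?A a - a)) \<le> (\<Sum>a\<in>?A. K * (1 / \<bar>nrm \<phi> \<bullet> \<gamma>' (\<tau> a)\<bar>))" .
    qed simp
    also have "2 * (\<Sum>a\<in>?A. K * (1 / \<bar>nrm \<phi> \<bullet> \<gamma>' (\<tau> a)\<bar>)) = (2 * K) * (\<Sum>t\<in>\<tau> ` ?A. 1 / \<bar>nrm \<phi> \<bullet> \<gamma>' t\<bar>)"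
      by (simp add: sum.reindex[OF inj] sum_distrib_left)
    also have "ennreal \<dots> = ennreal (2 * K) * ennreal (\<Sum>t\<in>\<tau> ` ?A. 1 / \<bar>nrm \<phi> \<bullet> \<gamma>' t\<bar>)"
      using K(1) by (intro ennreal_mult sum_nonneg) auto
    also have "\<dots> \<le> ennreal (2 * K) * (2 * hits (nrm \<phi>) p)"
    proof (intro mult_left_mono hits_sum[OF h])
      show "\<tau> ` ?A \<subseteq> {0..1}" using g\<tau>(2) by blast
      show "finite (\<tau> ` ?A)" using fin by simp
      show "nrm \<phi> \<bullet> \<gamma> t = p" if "t \<in> \<tau> ` ?A" for t using that \<tau>(1) by (auto simp: T_def)
    qed simp
    also have "\<dots> = ennreal (4 * K) * hits (nrm \<phi>) p"
    proof -
      have "ennreal (2 * K) * 2 = ennreal (4 * K)"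
        using K(1) ennreal_mult[of "2 * K" 2] by simp
      then show ?thesis by (metis mult.assoc)
    qed
    finally show "line_excess \<phi> p \<le> ennreal (4 * K) * hits (nrm \<phi>) p" .
  qed (use K(1) in simp)
qed

end

section \<open>Almost every geodesic is transverse\<close>

lemma card_semicircle_cylinder:
  assumes "z \<noteq> w"
  shows "finite (semicircle z w \<inter> (C \<times> {0<..})) \<longleftrightarrow> finite (open_segment z w \<inter> C)"
    and "card (semicircle z w \<inter> (C \<times> {0<..})) = card (open_segment z w \<inter> C)"
proof -
  let ?f = "\<lambda>u. midpoint z w + (u / 2) *\<^sub>R (w - z)"
  have inj: "inj_on fst (semicircle z w)"
    unfolding semicircle_eq[OF assms] using assms by (auto simp: inj_on_def)
  have f: "?f u = interior_pt z w ((1 + u) / 2)" for u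
    by (simp add: interior_pt_def midpoint_def vec_eq_iff field_simps)
  have "(\<lambda>u::real. (1 + u) / 2) ` {-1<..<1} = {0<..<1}"
  proof (intro equalityI subsetI)
    fix r :: real assume "r \<in> {0<..<1}"
    then show "r \<in> (\<lambda>u. (1 + u) / 2) ` {-1<..<1}" by (intro image_eqI[of _ _ "2 * r - 1"]) auto
  qed auto
  then have "fst ` semicircle z w = open_segment z w"
    unfolding semicircle_eq[OF assms] image_image fst_conv f open_segment_eq_interior_pt[OF assms]
    by (metis image_image)
  moreover have "0 < snd q" if "q \<in> semicircle z w" for q using that by (auto simp: semicircle_def)
  ultimately have img: "fst ` (semicircle z w \<inter> (C \<times> {0<..})) = open_segment z w \<inter> C"
    by (fastforce simp: image_iff)
  have inj': "inj_on fst (semicircle z w \<inter> (C \<times> {0<..}))" by (rule inj_on_subset[OF inj]) blast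
  show "finite (semicircle z w \<inter> (C \<times> {0<..})) \<longleftrightarrow> finite (open_segment z w \<inter> C)"
    using finite_image_iff[OF inj'] img by simp
  show "card (semicircle z w \<inter> (C \<times> {0<..})) = card (open_segment z w \<inter> C)"
    using card_image[OF inj'] img by simp
qed

lemma unit_eq_dir: "norm v = 1 \<Longrightarrow> \<exists>\<phi>. v = dir \<phi>" for v :: "real^2"
proof -
  assume "norm v = 1"
  then have "(v $ 2)\<^sup>2 + (- (v $ 1))\<^sup>2 = 1"
    by (simp add: norm_eq_sqrt_inner inner_plane power2_eq_square)
  then obtain \<phi> where "v $ 2 = cos \<phi>" "- (v $ 1) = sin \<phi>" using sincos_total_2pi by metis
  then show ?thesis by (intro exI[of _ \<phi>]) (simp add: dir_def eq_plane)
qed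

lemma ex_line_pt:
  assumes "z \<noteq> w"
  obtains \<phi> p s t where "z = line_pt \<phi> p s" "w = line_pt \<phi> p t" "s < t"
proof -
  have "norm ((w - z) /\<^sub>R norm (w - z)) = 1" using assms by simp
  then obtain \<phi> where \<phi>: "(w - z) /\<^sub>R norm (w - z) = dir \<phi>" using unit_eq_dir by blast
  have wz: "w = z + norm (w - z) *\<^sub>R dir \<phi>" unfolding \<phi>[symmetric] using assms by simp
  have "z = line_pt \<phi> (nrm \<phi> \<bullet> z) (dir \<phi> \<bullet> z)" by (rule line_pt_inner[symmetric])
  moreover from this have "w = line_pt \<phi> (nrm \<phi> \<bullet> z) (dir \<phi> \<bullet> z + norm (w - z))"
    by (subst wz) (simp only: line_pt_frame scaleR_add_left add.assoc[symmetric] frame_decomp[of z \<phi>, symmetric])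
  ultimately show ?thesis using assms by (intro that[of \<phi> _ _ "dir \<phi> \<bullet> z + norm (w - z)"]) auto
qed

definition perp :: "real^2 \<Rightarrow> real^2" where "perp x = pt (x $ 2) (- (x $ 1))"

lemma perp_dir: "perp (r *\<^sub>R dir \<phi>) = r *\<^sub>R nrm \<phi>"
  by (simp add: perp_def dir_def nrm_def eq_plane)

context C2_loop begin

definition pair_hits :: "(real^2) \<times> (real^2) \<Rightarrow> ennreal" where
  "pair_hits q = (let c = perp (snd q - fst q) /\<^sub>R norm (snd q - fst q) in hits c (c \<bullet> fst q))"

lemma pair_hits_borel [measurable]: "pair_hits \<in> borel_measurable borel"
proof -
  have [measurable]: "(\<lambda>q :: (real^2) \<times> (real^2). perp (snd q - fst q)) \<in> borel_measurable borel"
    unfolding perp_def pt_def by (intro borel_measurable_continuous_onI continuous_intros)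
  have [measurable]: "(fst :: (real^2) \<times> (real^2) \<Rightarrow> real^2) \<in> borel_measurable borel" "(snd :: (real^2) \<times> (real^2) \<Rightarrow> real^2) \<in> borel_measurable borel"
    by (auto intro!: borel_measurable_continuous_onI continuous_intros)
  show ?thesis unfolding pair_hits_def Let_def by measurable
qed

lemma pair_hits_line_pt:
  assumes "s \<noteq> t"
  shows "pair_hits (line_pt \<phi> p s, line_pt \<phi> p t) = hits (nrm \<phi>) p"
proof -
  have "perp (line_pt \<phi> p t - line_pt \<phi> p s) /\<^sub>R norm (line_pt \<phi> p t - line_pt \<phi> p s) = sgn (t - s) *\<^sub>R nrm \<phi>"
    by (simp add: line_pt_diff perp_dir sgn_div_norm)
  then show ?thesis
    using assms hits_uminus[of "nrm \<phi>" p] by (simp add: pair_hits_def sgn_real_def)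
qed

lemma AE_hits_finite: "AE p in lborel. hits c p < \<infinity>"
proof -
  have "(\<integral>\<^sup>+p. hits c p \<partial>lborel) \<noteq> \<infinity>" using nn_integral_hits[of c] by (auto simp: top_unique)
  then have "AE p in lborel. hits c p \<noteq> \<infinity>" by (intro nn_integral_PInf_AE) measurable
  then show ?thesis by eventually_elim (simp add: less_top)
qed

lemma compact_curve: "compact C"
  using simple by (simp add: compact_simple_path_image)

lemma AE_transverse_pair: "AE (z, w) in lborel. pair_hits (z, w) < \<infinity> \<and> z \<notin> C \<and> w \<notin> C"
proof -
  let ?B = "{q. pair_hits q = \<infinity>} \<union> (C \<times> UNIV) \<union> (UNIV \<times> C)"
  have "closed C" using compact_curve by (rule compact_imp_closed)
  moreover have "{q. pair_hits q = \<infinity>} \<in> sets borel"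
    using measurable_sets[OF pair_hits_borel, of "{\<infinity>}"] by (simp add: vimage_def)
  ultimately have [measurable]: "?B \<in> sets borel"
    by (intro sets.Un borel_closed[OF closed_Times]) auto
  have meas: "(indicator ?B :: _ \<Rightarrow> ennreal) \<in> borel_measurable borel" by measurable
  have "(\<integral>\<^sup>+p. \<integral>\<^sup>+s. \<integral>\<^sup>+t. ennreal \<bar>t - s\<bar> * indicator ?B (line_pt \<phi> p s, line_pt \<phi> p t) \<partial>lborel \<partial>lborel \<partial>lborel) = 0" for \<phi>
  proof -
    have "AE p in lborel. (\<integral>\<^sup>+s. \<integral>\<^sup>+t. ennreal \<bar>t - s\<bar> * indicator ?B (line_pt \<phi> p s, line_pt \<phi> p t) \<partial>lborel \<partial>lborel) = 0"
      using AE_hits_finite[of "nrm \<phi>"]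
    proof eventually_elim
      case (elim p)
      have fin: "finite (crossings \<phi> p)" using elim by (rule finite_crossings)
      have ae: "AE s in lborel. s \<notin> crossings \<phi> p"
        using fin by (intro AE_not_in finite_imp_null_set_lborel)
      have "AE s in lborel. (\<integral>\<^sup>+t. ennreal \<bar>t - s\<bar> * indicator ?B (line_pt \<phi> p s, line_pt \<phi> p t) \<partial>lborel) = 0"
        using ae
      proof eventually_elim
        case (elim s)
        have "AE t in lborel. ennreal \<bar>t - s\<bar> * indicator ?B (line_pt \<phi> p s, line_pt \<phi> p t) = 0"
          using ae AE_lborel_singleton[of s]
        proof eventually_elim
          case (elim t)
          then have "(line_pt \<phi> p s, line_pt \<phi> p t) \<notin> ?B"
            using \<open>s \<notin> crossings \<phi> p\<close> \<open>hits (nrm \<phi>) p < \<infinity>\<close> pair_hits_line_pt[of s t \<phi> p] by (auto simp: crossings_def)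
          then show ?case by simp
        qed
        then have "(\<integral>\<^sup>+t. ennreal \<bar>t - s\<bar> * indicator ?B (line_pt \<phi> p s, line_pt \<phi> p t) \<partial>lborel) = (\<integral>\<^sup>+t. 0 \<partial>(lborel :: real measure))"
          by (rule nn_integral_cong_AE)
        then show ?case by simp
      qed
      then have "(\<integral>\<^sup>+s. \<integral>\<^sup>+t. ennreal \<bar>t - s\<bar> * indicator ?B (line_pt \<phi> p s, line_pt \<phi> p t) \<partial>lborel \<partial>lborel) = (\<integral>\<^sup>+s. 0 \<partial>(lborel :: real measure))"
        by (rule nn_integral_cong_AE)
      then show ?case by simp
    qed
    then have "(\<integral>\<^sup>+p. \<integral>\<^sup>+s. \<integral>\<^sup>+t. ennreal \<bar>t - s\<bar> * indicator ?B (line_pt \<phi> p s, line_pt \<phi> p t) \<partial>lborel \<partial>lborel \<partial>lborel) = (\<integral>\<^sup>+p. 0 \<partial>(lborel :: real measure))"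
      by (rule nn_integral_cong_AE)
    then show ?thesis by simp
  qed
  then have "(\<integral>\<^sup>+q. indicator ?B q \<partial>lborel) = 0"
    unfolding nn_integral_line_pt[OF meas] by simp
  then have "AE q in lborel. indicator ?B q = (0::ennreal)"
    using meas by (subst (asm) nn_integral_0_iff_AE) auto
  then show ?thesis
    by eventually_elim (auto simp: indicator_eq_0_iff less_top)
qed

lemma transverse_pair:
  assumes zw: "z \<noteq> w" and h: "pair_hits (z, w) < \<infinity>" and C: "z \<notin> C" "w \<notin> C"
  shows "finite (semicircle z w \<inter> (C \<times> {0<..}))"
    and "real (card (semicircle z w \<inter> (C \<times> {0<..}))) - real (lambda2 (semicircle z w) C) =
      real (2 * (card (open_segment z w \<inter> C) div 2))"
    and "excess (z, w) = ennreal (real (2 * (card (open_segment z w \<inter> C) div 2)))"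
proof -
  obtain \<phi> p s t where st: "z = line_pt \<phi> p s" "w = line_pt \<phi> p t" "s < t" using ex_line_pt[OF zw] by blast
  have hl: "hits (nrm \<phi>) p < \<infinity>" using h st pair_hits_line_pt[of s t \<phi> p] by simp
  have fin: "finite (crossings \<phi> p)" using hl by (rule finite_crossings)
  have seg: "open_segment z w \<inter> C = line_pt \<phi> p ` (crossings \<phi> p \<inter> {s<..<t})"
    unfolding st(1,2) segment_crossings using st(3) by simp
  have finseg: "finite (open_segment z w \<inter> C)" unfolding seg using fin by simp
  show "finite (semicircle z w \<inter> (C \<times> {0<..}))" using card_semicircle_cylinder(1)[OF zw] finseg by simp
  show "excess (z, w) = ennreal (real (2 * (card (open_segment z w \<inter> C) div 2)))" by (rule excess_eq[OF zw finseg])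
  obtain I E where IE: "open I" "connected I" "bounded I" "open E" "connected E" "\<not> bounded E"
    "I \<inter> E = {}" "I \<union> E = - C" "frontier I = C" "frontier E = C"
    by (rule Jordan_plane[OF simple pathfinish_eq_pathstart])
  have par: "(z \<in> I \<longleftrightarrow> w \<in> I) \<longleftrightarrow> even (card (open_segment z w \<inter> C))"
  proof -
    have "(line_pt \<phi> p s \<in> I \<longleftrightarrow> line_pt \<phi> p t \<in> I) \<longleftrightarrow> even (card ({s. line_pt \<phi> p s \<in> C} \<inter> {s<..<t}))"
    proof (rule crossing_parity[OF IE(1,4,7-10)])
      show "nrm \<phi> \<bullet> \<gamma>' u \<noteq> 0" if "u \<in> {0..1}" "\<gamma> u = line_pt \<phi> p r" for u r
        using hits_transverse[OF hl that(1)] that(2) by simp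
    qed (use fin st C in \<open>auto simp: crossings_def\<close>)
    then show ?thesis by (simp only: seg card_line_pt_image crossings_def st(1,2)[symmetric])
  qed
  have l2: "lambda2 (semicircle z w) C = (if z \<in> I \<longleftrightarrow> w \<in> I then 0 else 1)"
    by (rule lambda2_semicircle[OF compact_curve IE(1-8) zw C])
  have "real n - real (if even n then 0 else 1) = real (2 * (n div 2))" for n :: nat
    by (cases "even n") (auto elim!: evenE oddE)
  then show "real (card (semicircle z w \<inter> (C \<times> {0<..}))) - real (lambda2 (semicircle z w) C) =
      real (2 * (card (open_segment z w \<inter> C) div 2))"
    unfolding l2 par card_semicircle_cylinder(2)[OF zw] .
qed

end

section \<open>Comparison of the two integrals\<close>

lemma line_pt_add_pi: "line_pt (\<phi> + pi) p s = line_pt \<phi> (- p) (- s)"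
  by (simp add: line_pt_def)

lemma nn_integral_uminus:
  fixes f :: "real \<Rightarrow> ennreal"
  assumes [measurable]: "f \<in> borel_measurable borel"
  shows "(\<integral>\<^sup>+x. f (- x) \<partial>lborel) = (\<integral>\<^sup>+x. f x \<partial>lborel)"
  by (subst (2) nn_integral_real_affine[where c = "-1" and t = 0]) auto

lemma nn_integral_half_turn:
  fixes G :: "real \<Rightarrow> real \<Rightarrow> ennreal"
  assumes [measurable]: "(\<lambda>(\<phi>, p). G \<phi> p) \<in> borel_measurable (borel \<Otimes>\<^sub>M borel)"
    and turn: "\<And>\<phi> p. G (\<phi> + pi) p = G \<phi> (- p)"
  shows "(\<integral>\<^sup>+(p, \<phi>). G \<phi> p * indicator ({0..} \<times> {0..<2 * pi}) (p, \<phi>) \<partial>lborel) =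
    (\<integral>\<^sup>+\<phi>. (\<integral>\<^sup>+p. G \<phi> p \<partial>lborel) * indicator {0<..<pi} \<phi> \<partial>lborel)"
proof -
  have [measurable (raw)]: "(\<lambda>x. G (f x) (g x)) \<in> borel_measurable M"
    if "f \<in> borel_measurable M" "g \<in> borel_measurable M" for f g and M :: "'z measure"
    using measurable_compose[OF measurable_Pair[OF that] assms(1)] by simp
  define Q where "Q \<phi> = (\<integral>\<^sup>+p. G \<phi> p * indicator {0..} p \<partial>lborel)" for \<phi>
  have Qm [measurable]: "Q \<in> borel_measurable borel" unfolding Q_def by measurable
  have Q2: "Q \<phi> + Q (\<phi> + pi) = (\<integral>\<^sup>+p. G \<phi> p \<partial>lborel)" for \<phi>
  proof -
    have "Q (\<phi> + pi) = (\<integral>\<^sup>+p. G \<phi> (- p) * indicator {..0} (- p) \<partial>lborel)"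
      unfolding Q_def turn by (intro nn_integral_cong) (auto split: split_indicator)
    also have "\<dots> = (\<integral>\<^sup>+p. G \<phi> p * indicator {..0} p \<partial>lborel)"
      by (rule nn_integral_uminus) measurable
    finally have "Q \<phi> + Q (\<phi> + pi) = (\<integral>\<^sup>+p. G \<phi> p * indicator {0..} p + G \<phi> p * indicator {..0} p \<partial>lborel)"
      unfolding Q_def by (subst nn_integral_add) auto
    also have "\<dots> = (\<integral>\<^sup>+p. G \<phi> p \<partial>lborel)"
      by (rule nn_integral_cong_AE, rule AE_mp[OF AE_lborel_singleton[of 0]]) (auto split: split_indicator)
    finally show ?thesis .
  qed
  have "(\<integral>\<^sup>+(p, \<phi>). G \<phi> p * indicator ({0..} \<times> {0..<2 * pi}) (p, \<phi>) \<partial>lborel) =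
    (\<integral>\<^sup>+(p, \<phi>). G \<phi> p * (indicator {0..} p * indicator {0..<2 * pi} \<phi>) \<partial>(lborel \<Otimes>\<^sub>M lborel))"
    unfolding lborel_prod by (intro nn_integral_cong) (auto split: split_indicator)
  also have "\<dots> = (\<integral>\<^sup>+\<phi>. \<integral>\<^sup>+p. G \<phi> p * (indicator {0..} p * indicator {0..<2 * pi} \<phi>) \<partial>lborel \<partial>lborel)"
    by (subst lborel_pair.nn_integral_snd[symmetric]) auto
  also have "\<dots> = (\<integral>\<^sup>+\<phi>. Q \<phi> * indicator {0..<2 * pi} \<phi> \<partial>lborel)"
    unfolding Q_def by (intro nn_integral_cong) (simp add: nn_integral_multc mult.assoc[symmetric])
  also have "\<dots> = (\<integral>\<^sup>+\<phi>. Q \<phi> * indicator {0<..<pi} \<phi> + Q \<phi> * indicator {pi<..<2 * pi} \<phi> \<partial>lborel)"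
    by (rule nn_integral_cong_AE, rule AE_mp[OF AE_lborel_singleton[of 0]], rule AE_mp[OF AE_lborel_singleton[of pi]])
      (auto split: split_indicator)
  also have "\<dots> = (\<integral>\<^sup>+\<phi>. Q \<phi> * indicator {0<..<pi} \<phi> \<partial>lborel) + (\<integral>\<^sup>+\<phi>. Q \<phi> * indicator {pi<..<2 * pi} \<phi> \<partial>lborel)"
    by (rule nn_integral_add) measurable
  also have "(\<integral>\<^sup>+\<phi>. Q \<phi> * indicator {pi<..<2 * pi} \<phi> \<partial>lborel) = (\<integral>\<^sup>+\<phi>. Q (\<phi> + pi) * indicator {0<..<pi} \<phi> \<partial>lborel)"
    by (subst nn_integral_real_affine[where c = 1 and t = pi])
      (auto intro!: nn_integral_cong simp: add.commute split: split_indicator)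
  also have "(\<integral>\<^sup>+\<phi>. Q \<phi> * indicator {0<..<pi} \<phi> \<partial>lborel) + (\<integral>\<^sup>+\<phi>. Q (\<phi> + pi) * indicator {0<..<pi} \<phi> \<partial>lborel) =
      (\<integral>\<^sup>+\<phi>. (Q \<phi> + Q (\<phi> + pi)) * indicator {0<..<pi} \<phi> \<partial>lborel)"
    by (subst nn_integral_add[symmetric]) (auto simp: distrib_right)
  finally show ?thesis unfolding Q2 .
qed

context C2_loop begin

lemma line_excess_add_pi: "line_excess (\<phi> + pi) p = line_excess \<phi> (- p)"
proof -
  let ?f = "\<lambda>s t. ennreal (1 / \<bar>t - s\<bar> ^ 3) * excess (line_pt \<phi> (- p) s, line_pt \<phi> (- p) t)"
  have "line_excess (\<phi> + pi) p = (\<integral>\<^sup>+s. \<integral>\<^sup>+t. ?f (- s) (- t) \<partial>lborel \<partial>lborel)"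
    unfolding line_excess_def line_pt_add_pi by (simp add: abs_minus_commute)
  also have "\<dots> = (\<integral>\<^sup>+s. \<integral>\<^sup>+t. ?f (- s) t \<partial>lborel \<partial>lborel)"
    by (rule nn_integral_cong, rule nn_integral_uminus) measurable
  also have "\<dots> = (\<integral>\<^sup>+s. \<integral>\<^sup>+t. ?f s t \<partial>lborel \<partial>lborel)"
    by (rule nn_integral_uminus) measurable
  finally show ?thesis unfolding line_excess_def .
qed

lemma nn_integral_pair_excess:
  "(\<integral>\<^sup>+q. ennreal (1 / 2 * (4 / norm (snd q - fst q) ^ 4)) * excess q \<partial>lborel) =
    (\<integral>\<^sup>+\<phi>. (\<integral>\<^sup>+p. 2 * line_excess \<phi> p \<partial>lborel) * indicator {0<..<pi} \<phi> \<partial>lborel)"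
proof -
  have "(\<lambda>q :: (real^2) \<times> (real^2). norm (snd q - fst q)) \<in> borel_measurable borel"
    by (intro borel_measurable_continuous_onI continuous_intros)
  then have m: "(\<lambda>q. ennreal (1 / 2 * (4 / norm (snd q - fst q) ^ 4)) * excess q) \<in> borel_measurable borel"
    by measurable
  have "(\<integral>\<^sup>+s. \<integral>\<^sup>+t. ennreal \<bar>t - s\<bar> * (ennreal (1 / 2 * (4 / norm (line_pt \<phi> p t - line_pt \<phi> p s) ^ 4)) * excess (line_pt \<phi> p s, line_pt \<phi> p t)) \<partial>lborel \<partial>lborel)
     = 2 * line_excess \<phi> p" for \<phi> p
  proof -
    have "ennreal \<bar>t - s\<bar> * (ennreal (1 / 2 * (4 / norm (line_pt \<phi> p t - line_pt \<phi> p s) ^ 4)) * e) = 2 * (ennreal (1 / \<bar>t - s\<bar> ^ 3) * e)" for s t and e :: ennreal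
    proof -
      have "u * (1 / 2 * (4 / u ^ 4)) = 2 * (1 / u ^ 3)" for u :: real
        by (cases "u = 0") (simp_all add: field_simps power_numeral_reduce)
      note this[of "\<bar>t - s\<bar>"]
      moreover have "ennreal (\<bar>t - s\<bar> * (1 / 2 * (4 / \<bar>t - s\<bar> ^ 4))) = ennreal \<bar>t - s\<bar> * ennreal (1 / 2 * (4 / \<bar>t - s\<bar> ^ 4))"
        by (rule ennreal_mult) auto
      moreover have "ennreal (2 * (1 / \<bar>t - s\<bar> ^ 3)) = 2 * ennreal (1 / \<bar>t - s\<bar> ^ 3)"
        by (subst ennreal_mult) auto
      ultimately show ?thesis unfolding norm_line_pt_diff by (metis mult.assoc)
    qed
    then show ?thesis unfolding line_excess_def by (simp add: nn_integral_cmult)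
  qed
  then show ?thesis unfolding nn_integral_line_pt[OF m] fst_conv snd_conv by simp
qed

lemma nn_integral_line_excess_finite:
  "(\<integral>\<^sup>+\<phi>. (\<integral>\<^sup>+p. 2 * line_excess \<phi> p \<partial>lborel) * indicator {0<..<pi} \<phi> \<partial>lborel) < \<infinity>"
proof -
  obtain K where K: "K \<ge> 0" "\<And>\<phi> p. hits (nrm \<phi>) p < \<infinity> \<Longrightarrow> line_excess \<phi> p \<le> ennreal K * hits (nrm \<phi>) p"
    using line_excess_le_hits by blast
  have "(\<integral>\<^sup>+p. 2 * line_excess \<phi> p \<partial>lborel) \<le> 2 * (ennreal K * 3)" for \<phi>
  proof -
    have "AE p in lborel. 2 * line_excess \<phi> p \<le> 2 * (ennreal K * hits (nrm \<phi>) p)"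
      using AE_hits_finite[of "nrm \<phi>"] by eventually_elim (intro mult_left_mono K, auto)
    then have "(\<integral>\<^sup>+p. 2 * line_excess \<phi> p \<partial>lborel) \<le> (\<integral>\<^sup>+p. 2 * (ennreal K * hits (nrm \<phi>) p) \<partial>lborel)"
      by (rule nn_integral_mono_AE)
    also have "\<dots> = 2 * (ennreal K * (\<integral>\<^sup>+p. hits (nrm \<phi>) p \<partial>lborel))"
      by (simp add: nn_integral_cmult)
    also have "\<dots> \<le> 2 * (ennreal K * 3)" by (intro mult_left_mono nn_integral_hits) auto
    finally show ?thesis .
  qed
  then have "(\<integral>\<^sup>+\<phi>. (\<integral>\<^sup>+p. 2 * line_excess \<phi> p \<partial>lborel) * indicator {0<..<pi} \<phi> \<partial>lborel) \<le>
      (\<integral>\<^sup>+\<phi>. 2 * (ennreal K * 3) * indicator {0<..<pi} \<phi> \<partial>lborel)"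
    by (intro nn_integral_mono mult_right_mono) auto
  also have "\<dots> = 2 * (ennreal K * 3) * ennreal pi"
    by (subst nn_integral_cmult_indicator) auto
  also have "\<dots> < \<infinity>" by (simp add: ennreal_mult_less_top)
  finally show ?thesis .
qed


lemma nn_integral_line_excess:
  "(\<integral>\<^sup>+x. ennreal 2 * line_excess (snd x) (fst x) * indicator ({0..} \<times> {0..<2 * pi}) x \<partial>lborel) =
    (\<integral>\<^sup>+\<phi>. (\<integral>\<^sup>+p. 2 * line_excess \<phi> p \<partial>lborel) * indicator {0<..<pi} \<phi> \<partial>lborel)"
proof -
  have "(\<lambda>(\<phi>, p). 2 * line_excess \<phi> p) \<in> borel_measurable (borel \<Otimes>\<^sub>M borel)" by measurable
  from nn_integral_half_turn[OF this] line_excess_add_pi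
  show ?thesis by (simp add: case_prod_beta')
qed

lemma AE_transverse_line: "AE x in lborel. hits (nrm (snd x)) (fst x) < \<infinity>"
proof -
  let ?B = "{x. hits (nrm (snd x)) (fst x) = \<infinity>}"
  have m: "(\<lambda>x. hits (nrm (snd x)) (fst x)) \<in> borel_measurable (lborel \<Otimes>\<^sub>M lborel)"
    unfolding nrm_def by measurable
  have B [measurable]: "?B \<in> sets (lborel \<Otimes>\<^sub>M lborel)"
    using measurable_sets[OF m, of "{\<infinity>}"] by (simp add: vimage_def space_pair_measure)
  have ind: "(indicator ?B :: _ \<Rightarrow> ennreal) \<in> borel_measurable (lborel \<Otimes>\<^sub>M lborel)"
    using B by (rule borel_measurable_indicator)
  have "(\<integral>\<^sup>+x. indicator ?B x \<partial>(lborel \<Otimes>\<^sub>M lborel)) = (\<integral>\<^sup>+\<phi>. \<integral>\<^sup>+p. indicator ?B (p, \<phi>) \<partial>lborel \<partial>lborel)"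
    using ind by (subst lborel_pair.nn_integral_snd) auto
  also have "\<dots> = (\<integral>\<^sup>+\<phi>. 0 \<partial>(lborel :: real measure))"
  proof (rule nn_integral_cong)
    fix \<phi>
    have "(\<integral>\<^sup>+p. indicator ?B (p, \<phi>) \<partial>lborel) = (\<integral>\<^sup>+p. 0 \<partial>(lborel :: real measure))"
      by (rule nn_integral_cong_AE) (use AE_hits_finite[of "nrm \<phi>"] in eventually_elim, auto)
    then show "(\<integral>\<^sup>+p. indicator ?B (p, \<phi>) \<partial>lborel) = 0" by simp
  qed
  finally have "(\<integral>\<^sup>+x. indicator ?B x \<partial>(lborel \<Otimes>\<^sub>M lborel)) = 0" by simp
  then have "AE x in (lborel \<Otimes>\<^sub>M lborel). indicator ?B x = (0::ennreal)"
    by (rule nn_integral_0_iff_AE[OF ind, THEN iffD1])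
  then show ?thesis
    unfolding lborel_prod by eventually_elim (auto simp: indicator_eq_0_iff less_top)
qed

lemma AE_normal_line:
  "AE x in lborel. finite (normal_line (fst x) (snd x) \<inter> C) \<and> 0 \<le> chord_sum (normal_line (fst x) (snd x)) \<and>
     ennreal (chord_sum (normal_line (fst x) (snd x))) = line_excess (snd x) (fst x)"
  using AE_transverse_line
proof eventually_elim
  case (elim x)
  then have "finite (crossings (snd x) (fst x))" by (rule finite_crossings)
  then show ?case
    by (simp add: normal_line_inter_curve chord_sum_nonneg line_excess_eq_chord_sum)
qed

lemma AE_semicircle:
  "AE q in lborel. fst q \<noteq> snd q \<longrightarrow> finite (semicircle (fst q) (snd q) \<inter> (C \<times> {0<..})) \<and>
     0 \<le> real (card (semicircle (fst q) (snd q) \<inter> (C \<times> {0<..}))) - real (lambda2 (semicircle (fst q) (snd q)) C) \<and>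
     ennreal (real (card (semicircle (fst q) (snd q) \<inter> (C \<times> {0<..}))) - real (lambda2 (semicircle (fst q) (snd q)) C)) = excess q"
  using AE_transverse_pair
proof eventually_elim
  case (elim q)
  then have h: "pair_hits (fst q, snd q) < \<infinity>" "fst q \<notin> C" "snd q \<notin> C" by (auto simp: case_prod_beta)
  show ?case
  proof
    assume ne: "fst q \<noteq> snd q"
    show "finite (semicircle (fst q) (snd q) \<inter> (C \<times> {0<..})) \<and>
       0 \<le> real (card (semicircle (fst q) (snd q) \<inter> (C \<times> {0<..}))) - real (lambda2 (semicircle (fst q) (snd q)) C) \<and>
       ennreal (real (card (semicircle (fst q) (snd q) \<inter> (C \<times> {0<..}))) - real (lambda2 (semicircle (fst q) (snd q)) C)) = excess q"
      using transverse_pair[OF ne h] by simp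
  qed
qed

lemma geodesic_measure_eq:
  "geodesic_measure = push_measure h3_geodesics (\<lambda>q. semicircle (fst q) (snd q))
     (density (restrict_space lebesgue {q. fst q \<noteq> snd q}) (\<lambda>q. ennreal (1 / 2 * (4 / norm (snd q - fst q) ^ 4))))"
  unfolding geodesic_measure_def case_prod_beta by simp

lemma line_measure_eq:
  "line_measure = push_measure plane_lines (\<lambda>x. normal_line (fst x) (snd x))
     (density (restrict_space lebesgue ({0..} \<times> {0..<2 * pi})) (\<lambda>x. ennreal 2))"
  unfolding line_measure_def case_prod_beta by simp

lemma distinct_pairs_borel: "{q :: (real^2) \<times> (real^2). fst q \<noteq> snd q} \<in> sets borel"
  by (intro borel_open open_Collect_neq continuous_intros)

lemma line_box_borel: "({0..} \<times> {0..<2 * pi}) \<in> sets (borel :: (real \<times> real) measure)"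
  unfolding borel_prod[symmetric] by (rule pair_measureI) auto

lemma pair_density_borel: "(\<lambda>q :: (real^2) \<times> (real^2). 1 / 2 * (4 / norm (snd q - fst q) ^ 4)) \<in> borel_measurable borel"
proof -
  have [measurable]: "(\<lambda>q :: (real^2) \<times> (real^2). norm (snd q - fst q)) \<in> borel_measurable borel"
    by (intro borel_measurable_continuous_onI continuous_intros)
  show ?thesis by measurable
qed

lemma line_excess_pair_borel: "(\<lambda>x. line_excess (snd x) (fst x)) \<in> borel_measurable borel"
  unfolding borel_prod[symmetric] by measurable

lemma geodesic_line_integrals:
  shows "AE l in geodesic_measure. finite (l \<inter> (C \<times> {0<..}))"
    and "integrable geodesic_measure (\<lambda>l. real (card (l \<inter> (C \<times> {0<..}))) - real (lambda2 l C))"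
    and "AE L in line_measure. finite (L \<inter> C)"
    and "integrable line_measure chord_sum"
    and "(\<integral>l. (real (card (l \<inter> (C \<times> {0<..}))) - real (lambda2 l C)) \<partial>geodesic_measure) = (\<integral>L. chord_sum L \<partial>line_measure)"
proof -
  let ?I = "\<integral>\<^sup>+\<phi>. (\<integral>\<^sup>+p. 2 * line_excess \<phi> p \<partial>lborel) * indicator {0<..<pi} \<phi> \<partial>lborel"
  let ?d = "\<lambda>q :: (real^2) \<times> (real^2). 1 / 2 * (4 / norm (snd q - fst q) ^ 4)"
  let ?S = "{q :: (real^2) \<times> (real^2). fst q \<noteq> snd q}"
  let ?h = "\<lambda>l. real (card (l \<inter> (C \<times> {0<..}))) - real (lambda2 l C)"
  have geo: "semicircle (fst q) (snd q) \<in> h3_geodesics" if "q \<in> ?S" for q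
    using that semicircle_geodesic by auto
  have lin: "normal_line (fst x) (snd x) \<in> plane_lines" if "x \<in> {0..} \<times> {0..<2 * pi}" for x
    by (rule normal_line_plane_line)
  have "(\<integral>\<^sup>+q. ennreal (?d q) * excess q * indicator ?S q \<partial>lborel) = (\<integral>\<^sup>+q. ennreal (?d q) * excess q \<partial>lborel)"
    by (intro nn_integral_cong) (auto split: split_indicator)
  then have I1: "(\<integral>\<^sup>+q. ennreal (?d q) * excess q * indicator ?S q \<partial>lborel) = ?I"
    unfolding nn_integral_pair_excess .
  have ae1: "AE q in lborel. q \<in> ?S \<longrightarrow> 0 \<le> ?h (semicircle (fst q) (snd q)) \<and> ennreal (?h (semicircle (fst q) (snd q))) = excess q"
    using AE_semicircle by eventually_elim simp
  have fin1: "(\<integral>\<^sup>+q. ennreal (?d q) * excess q * indicator ?S q \<partial>lborel) < \<infinity>"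
    unfolding I1 by (rule nn_integral_line_excess_finite)
  note G = push_lebesgue_density[OF distinct_pairs_borel geo pair_density_borel excess_borel ae1 fin1, folded geodesic_measure_eq]
  show "integrable geodesic_measure ?h" by (rule G(1))
  have "AE q in lborel. q \<in> ?S \<longrightarrow> finite (semicircle (fst q) (snd q) \<inter> (C \<times> {0<..}))"
    using AE_semicircle by eventually_elim simp
  from AE_push_lebesgue_density[OF distinct_pairs_borel geo pair_density_borel this, folded geodesic_measure_eq]
  show "AE l in geodesic_measure. finite (l \<inter> (C \<times> {0<..}))" .
  have ae2: "AE x in lborel. x \<in> {0..} \<times> {0..<2 * pi} \<longrightarrow> 0 \<le> chord_sum (normal_line (fst x) (snd x)) \<and>
      ennreal (chord_sum (normal_line (fst x) (snd x))) = line_excess (snd x) (fst x)"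
    using AE_normal_line by eventually_elim simp
  have fin2: "(\<integral>\<^sup>+x. ennreal 2 * line_excess (snd x) (fst x) * indicator ({0..} \<times> {0..<2 * pi}) x \<partial>lborel) < \<infinity>"
    unfolding nn_integral_line_excess by (rule nn_integral_line_excess_finite)
  note L = push_lebesgue_density[OF line_box_borel lin borel_measurable_const line_excess_pair_borel ae2 fin2, folded line_measure_eq]
  show "integrable line_measure chord_sum" by (rule L(1))
  have "AE x in lborel. x \<in> {0..} \<times> {0..<2 * pi} \<longrightarrow> finite (normal_line (fst x) (snd x) \<inter> C)"
    using AE_normal_line by eventually_elim simp
  from AE_push_lebesgue_density[OF line_box_borel lin borel_measurable_const this, of 2, folded line_measure_eq]
  show "AE L in line_measure. finite (L \<inter> C)" .
  show "(\<integral>l. ?h l \<partial>geodesic_measure) = (\<integral>L. chord_sum L \<partial>line_measure)"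
  proof -
    have "(\<integral>l. ?h l \<partial>geodesic_measure) = enn2real ?I" using G(2) unfolding I1 .
    also have "\<dots> = (\<integral>L. chord_sum L \<partial>line_measure)" using L(2) unfolding nn_integral_line_excess by (rule sym)
    finally show ?thesis .
  qed
qed

end

theorem proposition10:
  fixes C :: "(real^2) set"
  assumes "C2_simple_closed_curve C"
  shows "(AE l in geodesic_measure. finite (l \<inter> (C \<times> {0<..}))) \<and>
    integrable geodesic_measure
      (\<lambda>l. real (card (l \<inter> (C \<times> {0<..}))) - real (lambda2 l C)) \<and>
    (AE L in line_measure. finite (L \<inter> C)) \<and>
    integrable line_measure
      (\<lambda>L. \<Sum>(x, y) \<in> {(x, y). x \<in> L \<inter> C \<and> y \<in> L \<inter> C \<and> x \<noteq> y}.
             (-1) ^ card (closed_segment x y \<inter> C) / norm (y - x)) \<and>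
    (\<integral>l. (real (card (l \<inter> (C \<times> {0<..}))) - real (lambda2 l C)) \<partial>geodesic_measure) =
    (\<integral>L. (\<Sum>(x, y) \<in> {(x, y). x \<in> L \<inter> C \<and> y \<in> L \<inter> C \<and> x \<noteq> y}.
             (-1) ^ card (closed_segment x y \<inter> C) / norm (y - x)) \<partial>line_measure)"
proof -
  obtain \<gamma> :: "real \<Rightarrow> real^2" and \<gamma>' \<gamma>'' where \<gamma>: "simple_path \<gamma>" "\<forall>t. \<gamma> (t + 1) = \<gamma> t"
      "\<forall>t. (\<gamma> has_vector_derivative \<gamma>' t) (at t)" "\<forall>t. (\<gamma>' has_vector_derivative \<gamma>'' t) (at t)"
      "continuous_on UNIV \<gamma>''" "\<forall>t. \<gamma>' t \<noteq> 0"
    and C: "path_image \<gamma> = C"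
    using assms unfolding C2_simple_closed_curve_def by blast
  interpret C2_loop \<gamma> \<gamma>' \<gamma>'' using \<gamma> by unfold_locales auto
  show ?thesis
    using geodesic_line_integrals unfolding chord_sum_def[abs_def] C by blast
qed

end
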